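(* Let $\mathbb{F}$ be a field of characteristic $0$ and let $i<n$ be positive integers with $n\equiv \pm 1 \pmod i$. Let $r=r_{CG}(i,n)\in\mathfrak{sl}_n\wedge\mathfrak{sl}_n$ be the Cremmer–Gervais $r$-matrix of type $(i,n)$ and let $\Phi:\mathbb{F}^\times\to SL_n$ be the map $\Phi(t)=t^{2nH}g$ defined in the context. Then: (1) there exist $r^\prime\in\mathcal{M}$ and $b\in\mathcal{C}$, not depending on $t$, such that $\Phi(t).r=r^\prime+t^{2n}b$ for all $t\in\mathbb{F}^\times$; (2) the $r$-matrices $r^\prime$ and $b$ in (1) lie in the Zariski closure of the component of $\mathcal{M}$ containing $r$; (3) $b$ is a boundary solution to the classical Yang–Baxter equation; (4) the carrier of $b$ is the maximal parabolic subalgebra $\mathfrak{p}(i,n)\subseteq\mathfrak{sl}_n$.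
   Context: Notation: $e_{jk}$ is the $n\times n$ matrix unit, with the convention $e_{jk}:=0$ if $j$ or $k$ lies outside $[1,n]$; $[a,b]=\{a,a+1,\dots,b\}$; for integers $p$ and $q>0$, $p \bmod q$ denotes the residue in $[0,q-1]$. For vectors $u,v$, $u\wedge v:=\tfrac12(u\otimes v-v\otimes u)$. $g\in SL_n$ acts on $\mathfrak{gl}_n\otimes\mathfrak{gl}_n$ by $g.(u\otimes v)=gug^{-1}\otimes gvg^{-1}$; $x\in\mathfrak{gl}_n$ acts by $x.(u\otimes v)=[x,u]\otimes v+u\otimes[x,v]$. CYBE/MCYBE: for $r\in\mathfrak{sl}_n\wedge\mathfrak{sl}_n$, $\langle r,r\rangle:=[r_{12},r_{13}]+[r_{12},r_{23}]+[r_{13},r_{23}]$ where $r_{12}=r\otimes1$, $r_{23}=1\otimes r$, $r_{13}=\sigma(r_{23})$ with $\sigma(x\otimes y\otimes z)=y\otimes x\otimes z$. $\mathcal{C}$ is the set of $r$ with $\langle r,r\rangle=0$; $\mathcal{M}$ is the set of $r$ with $\langle r,r\rangle$ nonzero and $\mathfrak{sl}_n$-invariant. A boundary solution to the CYBE is an element of $\mathcal{C}$ lying in the Zariski closure of $\mathcal{M}$ (as points of $\mathbb{P}(\mathfrak{sl}_n\wedge\mathfrak{sl}_n)$). The component of $\mathcal{M}$ containing $r_{CG}(i,n)$ is $\{\lambda\, g.r_{CG}(i,n):\lambda\in\mathbb{F}^\times, g\in SL_n\}$. The carrier of $r$ is the span of $\{(\varphi\otimes1)r:\varphi\in\mathfrak{sl}_n^*\}$.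 $\mathfrak{p}(i,n)$ is the set of traceless $n\times n$ matrices whose $(j,k)$ entry is $0$ whenever $j>i$ and $k\le i$. Cremmer–Gervais $r$-matrix ($\gcd(i,n)=1$): let $\mathcal{S}_1=[1,n-1]\setminus\{n-i\}$ and $\mathcal{T}:\mathcal{S}_1\to[1,n-1]\setminus\{i\}$, $\mathcal{T}(j)=(j+i)\bmod n$. Put $j\prec k$ on $[1,n-1]$ iff $\mathcal{T}^N(j)=k$ for some $N\ge1$. For positive root vectors ($j<k$, $\ell<m$) put $e_{jk}\prec e_{\ell m}$ iff $m-\ell=k-j$ and $j+s\prec\ell+s$ for all $s\in[0,k-j-1]$. Set $\alpha:=2\sum e_{jk}\wedge e_{m\ell}$ over all $(j,k,\ell,m)$ with $e_{jk}\prec e_{\ell m}$; $\beta:=\sum_{1\le j<\ell\le n}\big(-1+\tfrac2n((j-\ell)i^{-1}\bmod n)\big)e_{jj}\wedge e_{\ell\ell}$, where $i^{-1}$ is the inverse of $i$ modulo $n$; $\gamma:=\sum_{1\le k<\ell\le n}e_{k\ell}\wedge e_{\ell k}$. Then $r_{CG}(i,n):=\alpha+\beta+\gamma$. The map $\Phi$: let $\epsilon:=1$ if $n\bmod i=1$ and $\epsilon:=-1$ otherwise; $c_k:=\lfloor (n-k)/i\rfloor$, $a_k:=\epsilon((-nk)\bmod i)$. For $k,\ell\in\mathbb{Z}$, $\xi_{k\ell}:=\sum_{p\in\mathbb{Z}}e_{k+ip,\ell+ip}$, and $E_{k\ell}:=\xi_{k+1,\ell+1}$ if $n\bmod i=1$,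 $E_{k\ell}:=-\xi_{i-\ell,i-k}$ otherwise. $X:=\sum_{1\le j\le n-i}c_je_{j,j+i}$, $Z:=\sum_{1\le j<i}a_j\xi_{j+1,j}$. $H:=\operatorname{diag}(H_1,\dots,H_n)$ where $H_j=s-q+\Theta$ when $j-1=qi+s$ with $0\le s<i$ (so the diagonal is $(0,1,\dots,i-1,-1,0,\dots,i-2,-2,\dots)+\Theta$), and $\Theta$ is the scalar making $H$ traceless; then each $2nH_j$ is an integer and $t^{2nH}:=\operatorname{diag}(t^{2nH_1},\dots,t^{2nH_n})$. Let $g:=e^{-Z}e^{-X}\exp\big(-\sum_{1\le k<i}\binom{i}{k}E_{ki}\big)\in SL_n$ and $\Phi(t):=t^{2nH}g$. *)

theory Defs
  imports Main "HOL-Combinatorics.Permutations" "HOL-Number_Theory.Cong"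
begin

section \<open>n x n matrices, 1-based indices in [1,n], entries zero outside\<close>

type_synonym 'a sqm = "nat \<Rightarrow> nat \<Rightarrow> 'a"

definition inR :: "nat \<Rightarrow> nat \<Rightarrow> bool" where
  "inR n j \<longleftrightarrow> 1 \<le> j \<and> j \<le> n"

definition msupp :: "nat \<Rightarrow> 'a::zero sqm \<Rightarrow> bool" where
  "msupp n A \<longleftrightarrow> (\<forall>a b. \<not> (inR n a \<and> inR n b) \<longrightarrow> A a b = 0)"

definition munit :: "nat \<Rightarrow> nat \<Rightarrow> nat \<Rightarrow> 'a::{zero,one} sqm" where
  "munit n j k = (\<lambda>a b. if a = j \<and> b = k \<and> inR n j \<and> inR n k then 1 else 0)"

definition mid :: "nat \<Rightarrow> 'a::{zero,one} sqm" where
  "mid n = (\<lambda>a b. if a = b \<and> inR n a then 1 else 0)"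

definition madd :: "'a::plus sqm \<Rightarrow> 'a sqm \<Rightarrow> 'a sqm" where
  "madd A B = (\<lambda>a b. A a b + B a b)"

definition mscale :: "'a::times \<Rightarrow> 'a sqm \<Rightarrow> 'a sqm" where
  "mscale c A = (\<lambda>a b. c * A a b)"

definition mneg :: "'a::uminus sqm \<Rightarrow> 'a sqm" where
  "mneg A = (\<lambda>a b. - A a b)"

definition mmul :: "nat \<Rightarrow> 'a::comm_ring_1 sqm \<Rightarrow> 'a sqm \<Rightarrow> 'a sqm" where
  "mmul n A B = (\<lambda>a b. if inR n a \<and> inR n b then (\<Sum>x\<in>{1..n}. A a x * B x b) else 0)"

definition mpow :: "nat \<Rightarrow> 'a::comm_ring_1 sqm \<Rightarrow> nat \<Rightarrow> 'a sqm" where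
  "mpow n A m = ((mmul n A) ^^ m) (mid n)"

text \<open>Exponential of a nilpotent n x n matrix (A^n = 0, so the series terminates).
  Only applied below to nilpotent (strictly triangular) matrices.\<close>
definition mexp_nil :: "nat \<Rightarrow> 'a::field_char_0 sqm \<Rightarrow> 'a sqm" where
  "mexp_nil n A = (\<lambda>a b. \<Sum>m\<in>{0..n}. mpow n A m a b / fact m)"

definition mtrace :: "nat \<Rightarrow> 'a::comm_ring_1 sqm \<Rightarrow> 'a" where
  "mtrace n A = (\<Sum>j\<in>{1..n}. A j j)"

definition sl :: "nat \<Rightarrow> 'a::comm_ring_1 sqm set" where
  "sl n = {A. msupp n A \<and> mtrace n A = 0}"

definition mdet :: "nat \<Rightarrow> 'a::comm_ring_1 sqm \<Rightarrow> 'a" where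
  "mdet n A = (\<Sum>p | p permutes {1..n}. of_int (sign p) * (\<Prod>j\<in>{1..n}. A j (p j)))"

definition SL :: "nat \<Rightarrow> 'a::comm_ring_1 sqm set" where
  "SL n = {g. msupp n g \<and> mdet n g = 1}"

definition minv :: "nat \<Rightarrow> 'a::comm_ring_1 sqm \<Rightarrow> 'a sqm" where
  "minv n g = (SOME h. msupp n h \<and> mmul n g h = mid n)"

section \<open>gl_n \<otimes> gl_n: T j k l m is the coefficient of e_jk \<otimes> e_lm\<close>

type_synonym 'a tens2 = "nat \<Rightarrow> nat \<Rightarrow> nat \<Rightarrow> nat \<Rightarrow> 'a"

definition tadd :: "'a::plus tens2 \<Rightarrow> 'a tens2 \<Rightarrow> 'a tens2" where
  "tadd S T = (\<lambda>j k l m. S j k l m + T j k l m)"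

definition tscale :: "'a::times \<Rightarrow> 'a tens2 \<Rightarrow> 'a tens2" where
  "tscale c T = (\<lambda>j k l m. c * T j k l m)"

definition wedge :: "'a::field sqm \<Rightarrow> 'a sqm \<Rightarrow> 'a tens2" where
  "wedge u v = (\<lambda>j k l m. (u j k * v l m - v j k * u l m) / 2)"

text \<open>sl_n \<wedge> sl_n, realised as the antisymmetric tensors in sl_n \<otimes> sl_n inside gl_n \<otimes> gl_n\<close>
definition W :: "nat \<Rightarrow> 'a::field tens2 set" where
  "W n = {T. (\<forall>j k l m. \<not> (inR n j \<and> inR n k \<and> inR n l \<and> inR n m) \<longrightarrow> T j k l m = 0)
            \<and> (\<forall>j k l m. T j k l m = - T l m j k)
            \<and> (\<forall>l m. (\<Sum>j\<in>{1..n}. T j j l m) = 0)}"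

text \<open>g.(u \<otimes> v) = g u g^-1 \<otimes> g v g^-1, extended linearly\<close>
definition act :: "nat \<Rightarrow> 'a::field sqm \<Rightarrow> 'a tens2 \<Rightarrow> 'a tens2" where
  "act n g T = (let gi = minv n g in (\<lambda>a b c d.
     if inR n a \<and> inR n b \<and> inR n c \<and> inR n d then
       (\<Sum>j\<in>{1..n}. \<Sum>k\<in>{1..n}. \<Sum>l\<in>{1..n}. \<Sum>m\<in>{1..n}.
          g a j * T j k l m * gi k b * g c l * gi m d)
     else 0))"

text \<open>A a b c d e f is the coefficient of e_ab \<otimes> e_cd \<otimes> e_ef in Mat_n^{\<otimes>3}\<close>
type_synonym 'a tens3 = "nat \<Rightarrow> nat \<Rightarrow> nat \<Rightarrow> nat \<Rightarrow> nat \<Rightarrow> nat \<Rightarrow> 'a"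

definition r12 :: "nat \<Rightarrow> 'a::field tens2 \<Rightarrow> 'a tens3" where
  "r12 n r = (\<lambda>a b c d e f. r a b c d * mid n e f)"

definition r23 :: "nat \<Rightarrow> 'a::field tens2 \<Rightarrow> 'a tens3" where
  "r23 n r = (\<lambda>a b c d e f. mid n a b * r c d e f)"

definition r13 :: "nat \<Rightarrow> 'a::field tens2 \<Rightarrow> 'a tens3" where
  "r13 n r = (\<lambda>a b c d e f. r a b e f * mid n c d)"

definition mul3 :: "nat \<Rightarrow> 'a::field tens3 \<Rightarrow> 'a tens3 \<Rightarrow> 'a tens3" where
  "mul3 n A B = (\<lambda>a b c d e f. \<Sum>x\<in>{1..n}. \<Sum>y\<in>{1..n}. \<Sum>z\<in>{1..n}.
      A a x c y e z * B x b y d z f)"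

definition comm3 :: "nat \<Rightarrow> 'a::field tens3 \<Rightarrow> 'a tens3 \<Rightarrow> 'a tens3" where
  "comm3 n A B = (\<lambda>a b c d e f. mul3 n A B a b c d e f - mul3 n B A a b c d e f)"

definition cybe :: "nat \<Rightarrow> 'a::field tens2 \<Rightarrow> 'a tens3" where
  "cybe n r = (\<lambda>a b c d e f. comm3 n (r12 n r) (r13 n r) a b c d e f
                 + comm3 n (r12 n r) (r23 n r) a b c d e f
                 + comm3 n (r13 n r) (r23 n r) a b c d e f)"

text \<open>adjoint action of x \<in> gl_n on triple tensors:
  x.(u\<otimes>v\<otimes>w) = [x,u]\<otimes>v\<otimes>w + u\<otimes>[x,v]\<otimes>w + u\<otimes>v\<otimes>[x,w]\<close>
definition lie_act3 :: "nat \<Rightarrow> 'a::field sqm \<Rightarrow> 'a tens3 \<Rightarrow> 'a tens3" where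
  "lie_act3 n x A = (\<lambda>a b c d e f.
      (\<Sum>y\<in>{1..n}. x a y * A y b c d e f - A a y c d e f * x y b)
    + (\<Sum>y\<in>{1..n}. x c y * A a b y d e f - A a b c y e f * x y d)
    + (\<Sum>y\<in>{1..n}. x e y * A a b c d y f - A a b c d e y * x y f))"

definition CYBE :: "nat \<Rightarrow> 'a::field tens2 set" where
  "CYBE n = {r \<in> W n. cybe n r = (\<lambda>_ _ _ _ _ _. 0)}"

definition MCYBE :: "nat \<Rightarrow> 'a::field tens2 set" where
  "MCYBE n = {r \<in> W n. cybe n r \<noteq> (\<lambda>_ _ _ _ _ _. 0)
        \<and> (\<forall>x \<in> sl n. lie_act3 n x (cybe n r) = (\<lambda>_ _ _ _ _ _. 0))}"

inductive_set polyfun :: "('a::field tens2 \<Rightarrow> 'a) set" where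
  pconst: "(\<lambda>T. c) \<in> polyfun"
| pcoord: "(\<lambda>T. T j k l m) \<in> polyfun"
| padd: "p \<in> polyfun \<Longrightarrow> q \<in> polyfun \<Longrightarrow> (\<lambda>T. p T + q T) \<in> polyfun"
| pmul: "p \<in> polyfun \<Longrightarrow> q \<in> polyfun \<Longrightarrow> (\<lambda>T. p T * q T) \<in> polyfun"

text \<open>For a set S closed under nonzero scaling (a cone), the nonzero points of W n in the
  affine Zariski closure of S are exactly the representatives of the points of the
  projective Zariski closure of the image of S in P(sl_n \<wedge> sl_n).\<close>
definition proj_closure :: "nat \<Rightarrow> 'a::field tens2 set \<Rightarrow> 'a tens2 set" where
  "proj_closure n S = {x \<in> W n. x \<noteq> (\<lambda>_ _ _ _. 0)
        \<and> (\<forall>p \<in> polyfun. (\<forall>y \<in> S. p y = 0) \<longrightarrow> p x = 0)}"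

definition boundary_solution :: "nat \<Rightarrow> 'a::field tens2 \<Rightarrow> bool" where
  "boundary_solution n b \<longleftrightarrow> b \<in> CYBE n \<and> b \<in> proj_closure n (MCYBE n)"

definition component :: "nat \<Rightarrow> 'a::field tens2 \<Rightarrow> 'a tens2 set" where
  "component n r = {tscale c (act n g r) | c g. c \<noteq> 0 \<and> g \<in> SL n}"

text \<open>carrier: {(\<phi>\<otimes>1) r}; every functional on sl_n is the restriction of
  u \<mapsto> \<Sum> f_ab u_ab for some matrix f\<close>
definition carrier :: "nat \<Rightarrow> 'a::field tens2 \<Rightarrow> 'a sqm set" where
  "carrier n r = {(\<lambda>c d. \<Sum>a\<in>{1..n}. \<Sum>b\<in>{1..n}. f a b * r a b c d) | f. True}"

definition parabolic :: "nat \<Rightarrow> nat \<Rightarrow> 'a::field sqm set" where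
  "parabolic i n = {M \<in> sl n. \<forall>j k. i < j \<and> k \<le> i \<longrightarrow> M j k = 0}"

definition cgT :: "nat \<Rightarrow> nat \<Rightarrow> nat \<Rightarrow> nat" where
  "cgT i n j = (j + i) mod n"

definition cgS1 :: "nat \<Rightarrow> nat \<Rightarrow> nat set" where
  "cgS1 i n = {1..n-1} - {n - i}"

definition cg_prec :: "nat \<Rightarrow> nat \<Rightarrow> nat \<Rightarrow> nat \<Rightarrow> bool" where
  "cg_prec i n j k \<longleftrightarrow> j \<in> {1..n-1} \<and>
     (\<exists>N\<ge>1. (\<forall>s<N. (cgT i n ^^ s) j \<in> cgS1 i n) \<and> (cgT i n ^^ N) j = k)"

definition root_prec :: "nat \<Rightarrow> nat \<Rightarrow> nat \<Rightarrow> nat \<Rightarrow> nat \<Rightarrow> nat \<Rightarrow> bool" where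
  "root_prec i n j k l m \<longleftrightarrow> j < k \<and> l < m \<and> m - l = k - j \<and>
     (\<forall>s<k - j. cg_prec i n (j + s) (l + s))"

definition cg_alpha :: "nat \<Rightarrow> nat \<Rightarrow> 'a::field tens2" where
  "cg_alpha i n = (\<lambda>a b c d. 2 * (\<Sum>j\<in>{1..n}. \<Sum>k\<in>{1..n}. \<Sum>l\<in>{1..n}. \<Sum>m\<in>{1..n}.
      if root_prec i n j k l m then wedge (munit n j k) (munit n m l) a b c d else 0))"

definition inv_mod :: "nat \<Rightarrow> nat \<Rightarrow> int" where
  "inv_mod i n = (SOME u. [u * int i = 1] (mod int n))"

definition cg_beta :: "nat \<Rightarrow> nat \<Rightarrow> 'a::field tens2" where
  "cg_beta i n = (\<lambda>a b c d. \<Sum>j\<in>{1..n}. \<Sum>l\<in>{1..n}.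
      if j < l then (-1 + 2 / of_nat n * of_int (((int j - int l) * inv_mod i n) mod int n))
                    * wedge (munit n j j) (munit n l l) a b c d
      else 0)"

definition cg_gamma :: "nat \<Rightarrow> nat \<Rightarrow> 'a::field tens2" where
  "cg_gamma i n = (\<lambda>a b c d. \<Sum>k\<in>{1..n}. \<Sum>l\<in>{1..n}.
      if k < l then wedge (munit n k l) (munit n l k) a b c d else 0)"

definition rCG :: "nat \<Rightarrow> nat \<Rightarrow> 'a::field tens2" where
  "rCG i n = tadd (cg_alpha i n) (tadd (cg_beta i n) (cg_gamma i n))"

definition phi_eps :: "nat \<Rightarrow> nat \<Rightarrow> int" where
  "phi_eps i n = (if n mod i = 1 then 1 else -1)"

definition phi_c :: "nat \<Rightarrow> nat \<Rightarrow> nat \<Rightarrow> int" where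
  "phi_c i n k = (int n - int k) div int i"

definition phi_a :: "nat \<Rightarrow> nat \<Rightarrow> nat \<Rightarrow> int" where
  "phi_a i n k = phi_eps i n * ((- (int n * int k)) mod int i)"

definition xi :: "nat \<Rightarrow> nat \<Rightarrow> int \<Rightarrow> int \<Rightarrow> 'a::field sqm" where
  "xi i n k l = (\<lambda>a b. if inR n a \<and> inR n b \<and>
       (\<exists>p::int. int a = k + int i * p \<and> int b = l + int i * p) then 1 else 0)"

definition bigE :: "nat \<Rightarrow> nat \<Rightarrow> int \<Rightarrow> int \<Rightarrow> 'a::field sqm" where
  "bigE i n k l = (if n mod i = 1 then xi i n (k + 1) (l + 1)
                   else mneg (xi i n (int i - l) (int i - k)))"

definition phiX :: "nat \<Rightarrow> nat \<Rightarrow> 'a::field sqm" where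
  "phiX i n = (\<lambda>a b. \<Sum>j\<in>{1..n - i}. of_int (phi_c i n j) * munit n j (j + i) a b)"

definition phiZ :: "nat \<Rightarrow> nat \<Rightarrow> 'a::field sqm" where
  "phiZ i n = (\<lambda>a b. \<Sum>j\<in>{1..<i}. of_int (phi_a i n j) * xi i n (int j + 1) (int j) a b)"

text \<open>H_j = s - q + \<Theta> where j - 1 = q i + s, 0 \<le> s < i; the integer 2 n H_j\<close>
definition Hbase :: "nat \<Rightarrow> nat \<Rightarrow> int" where
  "Hbase i j = int ((j - 1) mod i) - int ((j - 1) div i)"

definition Hexp :: "nat \<Rightarrow> nat \<Rightarrow> nat \<Rightarrow> int" where
  "Hexp i n j = 2 * int n * Hbase i j - 2 * (\<Sum>k\<in>{1..n}. Hbase i k)"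

definition tpowH :: "nat \<Rightarrow> nat \<Rightarrow> 'a::field \<Rightarrow> 'a sqm" where
  "tpowH i n t = (\<lambda>a b. if a = b \<and> inR n a then t powi Hexp i n a else 0)"

definition phi_g :: "nat \<Rightarrow> nat \<Rightarrow> 'a::field_char_0 sqm" where
  "phi_g i n = mmul n (mexp_nil n (mneg (phiZ i n)))
      (mmul n (mexp_nil n (mneg (phiX i n)))
        (mexp_nil n (mneg (\<lambda>a b. \<Sum>k\<in>{1..<i}. of_nat (i choose k) * bigE i n (int k) (int i) a b))))"

definition Phi :: "nat \<Rightarrow> nat \<Rightarrow> 'a::field_char_0 \<Rightarrow> 'a sqm" where
  "Phi i n t = mmul n (tpowH i n t) (phi_g i n)"

end

theory Submission
  imports Defs "HOL-Library.Function_Algebras" "HOL-Library.FuncSet"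
    "HOL-Computational_Algebra.Formal_Power_Series" "HOL-Computational_Algebra.Polynomial"
begin

text \<open>Identify a skew tensor \<open>r\<close> with a linear map on traceless matrices by contracting its first leg under
  the trace form. If the graph of all pairs \<open>(r x + x/2, r x - x/2)\<close> lies in a set of pairs that is closed
  under brackets and isotropic for \<open>tr a a' - tr b b'\<close>, then that set determines \<open>r\<close>, and the
  Yang--Baxter expression of \<open>r\<close> is a fixed multiple of the invariant cubic tensor.
  For the Cremmer--Gervais tensor the set consists of the pairs lying in two opposite maximal parabolic
  subalgebras with Levi components matched by the cyclic shift by \<open>i\<close>. Conjugation by \<open>g\<close> straightens
  it into a set that visibly contains the graph of an explicit tensor \<open>r' + b\<close>, where \<open>r'\<close> and \<open>b\<close> are
  homogeneous of weights 0 and 1 for \<open>H\<close>; this yields the formula for \<open>\<Phi>(t).r\<close> by uniqueness.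
  The Yang--Baxter expression of \<open>r' + s b\<close> is quadratic in \<open>s\<close> and constant for infinitely many \<open>s\<close>, so \<open>r'\<close>
  solves the modified and \<open>b\<close> the classical equation; likewise a polynomial vanishing on infinitely many
  points of a line vanishes on the line, which gives the closure statements. The carrier of \<open>b\<close> is the
  parabolic because the bracket with one fixed matrix inverts the map of \<open>b\<close>, as for a Frobenius subalgebra.\<close>

text \<open>Conjugating the defining sums by \<open>g\<close> directly would be unwieldy, but
  isotropy alone makes a graph unique, so it is enough to verify linear relations for a guessed
  tensor. Let N send e_d to e_(d+i), let V be spanned by the first i basis vectors and U by the last
  i. The Levi condition says that N intertwines a and b modulo V and that a on U agrees with b on V.
  This explains the factors of \<open>g\<close>: [-X, N] = 1 modulo V, so exp(-X) trades N for 1 +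
  N, while the exponentials of Z and of the E-terms respect N modulo V and bring the identification
  of ker(1 + N) with V into the form of a difference operator or its inverse. The congruence n = 1
  or -1 modulo i keeps the E-terms compatible with N at the end of the index range. The grading H
  gives N and the unit shift inside V the same weight -1, so 1 + N and the difference operator live
  in weights 0 and -1, and the relations admit a solution in weights 0 and 1. Up to sign, the weight
  -1 parts add up to the matrix whose bracket inverts the map of b.\<close>

declare One_nat_def [simp del]

section \<open>Matrices and tensors as functions\<close>

lemma inR_iff [simp]: "inR n j \<longleftrightarrow> j \<in> {1..n}"
  by (auto simp: inR_def)

lemma msuppD: "msupp n A \<Longrightarrow> a \<notin> {1..n} \<or> b \<notin> {1..n} \<Longrightarrow> A a b = 0"
  unfolding msupp_def by auto

lemma msuppI: "(\<And>a b. a \<notin> {1..n} \<or> b \<notin> {1..n} \<Longrightarrow> A a b = 0) \<Longrightarrow> msupp n A"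
  unfolding msupp_def by auto

lemma msupp_mmul [simp]: "msupp n (mmul n A B)"
  by (auto simp: msupp_def mmul_def)

lemma msupp_mid [simp]: "msupp n (mid n)"
  by (auto simp: msupp_def mid_def)

lemma msupp_munit [simp]: "msupp n (munit n j k)"
  by (auto simp: msupp_def munit_def)

lemma msupp_add [simp]:
  fixes A B :: "'a::monoid_add sqm"
  shows "msupp n A \<Longrightarrow> msupp n B \<Longrightarrow> msupp n (A + B)"
  by (auto simp: msupp_def)

lemma msupp_diff [simp]:
  fixes A B :: "'a::group_add sqm"
  shows "msupp n A \<Longrightarrow> msupp n B \<Longrightarrow> msupp n (A - B)"
  by (auto simp: msupp_def)

lemma msupp_mscale [simp]:
  fixes A :: "'a::mult_zero sqm"
  shows "msupp n A \<Longrightarrow> msupp n (mscale c A)"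
  by (auto simp: msupp_def mscale_def)

lemma mmul_apply: "a \<in> {1..n} \<Longrightarrow> b \<in> {1..n} \<Longrightarrow> mmul n A B a b = (\<Sum>x\<in>{1..n}. A a x * B x b)"
  by (simp add: mmul_def)

lemma mmul_assoc: "mmul n (mmul n A B) C = mmul n A (mmul n B C)"
proof (intro ext)
  fix a b
  show "mmul n (mmul n A B) C a b = mmul n A (mmul n B C) a b"
  proof (cases "a \<in> {1..n} \<and> b \<in> {1..n}")
    case True
    have "(\<Sum>x\<in>{1..n}. (\<Sum>y\<in>{1..n}. A a y * B y x) * C x b)
        = (\<Sum>y\<in>{1..n}. A a y * (\<Sum>x\<in>{1..n}. B y x * C x b))"
      by (simp add: sum_distrib_left sum_distrib_right mult.assoc) (rule sum.swap)
    with True show ?thesis by (simp add: mmul_apply)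
  qed (auto simp: mmul_def)
qed

lemma mmul_mid_left [simp]: "msupp n A \<Longrightarrow> mmul n (mid n) A = A"
  by (intro ext) (auto simp: mmul_def mid_def msupp_def if_distrib[of "\<lambda>x. x * _"] sum.delta cong: if_cong)

lemma mmul_mid_right [simp]: "msupp n A \<Longrightarrow> mmul n A (mid n) = A"
  by (intro ext) (auto simp: mmul_def mid_def msupp_def if_distrib[of "\<lambda>x. _ * x"] sum.delta' cong: if_cong)

lemma mmul_add_left: "mmul n (A + B) C = mmul n A C + mmul n B C"
  by (intro ext) (auto simp: mmul_def distrib_right sum.distrib)

lemma mmul_add_right: "mmul n A (B + C) = mmul n A B + mmul n A C"
  by (intro ext) (auto simp: mmul_def distrib_left sum.distrib)

lemma mmul_diff_left: "mmul n (A - B) C = mmul n A C - mmul n B C"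
  by (intro ext) (auto simp: mmul_def left_diff_distrib sum_subtractf)

lemma mmul_diff_right: "mmul n A (B - C) = mmul n A B - mmul n A C"
  by (intro ext) (auto simp: mmul_def right_diff_distrib sum_subtractf)

lemma mmul_mscale_left: "mmul n (mscale c A) B = mscale c (mmul n A B)"
  by (intro ext) (auto simp: mmul_def mscale_def sum_distrib_left mult.assoc)

lemma mmul_mscale_right: "mmul n A (mscale c B) = mscale c (mmul n A B)"
  by (intro ext) (auto simp: mmul_def mscale_def sum_distrib_left mult.left_commute)

lemma mscale_apply: "mscale c A a b = c * A a b"
  by (simp add: mscale_def)

lemma mscale_add: "mscale c (A + B) = mscale c A + mscale c (B :: 'a::comm_ring_1 sqm)"
  by (intro ext) (simp add: mscale_def algebra_simps)

lemma mscale_diff: "mscale c (A - B) = mscale c A - mscale c (B :: 'a::comm_ring_1 sqm)"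
  by (intro ext) (simp add: mscale_def algebra_simps)

lemma mtrace_add: "mtrace n (A + B) = mtrace n A + mtrace n B"
  by (simp add: mtrace_def sum.distrib)

lemma mtrace_diff: "mtrace n (A - B) = mtrace n A - mtrace n B"
  by (simp add: mtrace_def sum_subtractf)

lemma mtrace_mscale: "mtrace n (mscale c A) = c * mtrace n A"
  by (simp add: mtrace_def mscale_def sum_distrib_left)

lemma mtrace_mmul: "mtrace n (mmul n A B) = (\<Sum>a\<in>{1..n}. \<Sum>b\<in>{1..n}. A a b * B b a)"
  by (simp add: mtrace_def mmul_def)

lemma mtrace_mmul_comm: "mtrace n (mmul n A B) = mtrace n (mmul n B A)"
  unfolding mtrace_mmul by (subst sum.swap) (simp add: mult.commute)

lemma mtrace_mid: "mtrace n (mid n) = of_nat n"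
  by (simp add: mtrace_def mid_def)

definition mbr :: "nat \<Rightarrow> 'a::comm_ring_1 sqm \<Rightarrow> 'a sqm \<Rightarrow> 'a sqm" where
  "mbr n A B = mmul n A B - mmul n B A"

lemma msupp_mbr [simp]: "msupp n (mbr n A B)"
  by (simp add: mbr_def)

lemma mtrace_mbr [simp]: "mtrace n (mbr n A B) = 0"
  by (simp add: mbr_def mtrace_diff mtrace_mmul_comm)

lemma mbr_in_sl [simp]: "mbr n A B \<in> sl n"
  by (simp add: sl_def)

lemma mbr_add_left: "mbr n (A + B) C = mbr n A C + mbr n B C"
  and mbr_add_right: "mbr n C (A + B) = mbr n C A + mbr n C B"
  and mbr_diff_left: "mbr n (A - B) C = mbr n A C - mbr n B C"
  and mbr_diff_right: "mbr n C (A - B) = mbr n C A - mbr n C B"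
  and mbr_mscale_left: "mbr n (mscale c A) C = mscale c (mbr n A C)"
  and mbr_mscale_right: "mbr n C (mscale c A) = mscale c (mbr n C A)"
  by (simp_all add: mbr_def mmul_add_left mmul_add_right mmul_diff_left mmul_diff_right
      mmul_mscale_left mmul_mscale_right mscale_diff)

lemma mbr_mid_left: "msupp n A \<Longrightarrow> mbr n (mid n) A = 0"
  and mbr_mid_right: "msupp n A \<Longrightarrow> mbr n A (mid n) = 0"
  by (simp_all add: mbr_def)

definition traceless :: "nat \<Rightarrow> 'a::field_char_0 sqm \<Rightarrow> 'a sqm" where
  "traceless n A = A - mscale (mtrace n A / of_nat n) (mid n)"

lemma traceless_in_sl: "0 < n \<Longrightarrow> msupp n A \<Longrightarrow> traceless n A \<in> sl n"
  by (simp add: traceless_def sl_def mtrace_diff mtrace_mscale mtrace_mid)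

lemma sl_msupp: "x \<in> sl n \<Longrightarrow> msupp n x" and sl_mtrace: "x \<in> sl n \<Longrightarrow> mtrace n x = 0"
  by (auto simp: sl_def)

lemma mmul_munit_left:
  assumes "msupp n A"
  shows "mmul n (munit n p q) A = (\<lambda>a b. if a = p \<and> p \<in> {1..n} then (if q \<in> {1..n} then A q b else 0) else 0)"
  using assms
  by (intro ext) (auto simp: mmul_def munit_def msupp_def if_distrib[of "\<lambda>x. x * _"] sum.delta cong: if_cong)

lemma mmul_munit_right:
  assumes "msupp n A"
  shows "mmul n A (munit n p q) = (\<lambda>a b. if b = q \<and> q \<in> {1..n} then (if p \<in> {1..n} then A a p else 0) else 0)"
  using assms
  by (intro ext) (auto simp: mmul_def munit_def msupp_def if_distrib[of "\<lambda>x. _ * x"] sum.delta cong: if_cong)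

section \<open>The operator of a skew tensor\<close>

definition rop :: "nat \<Rightarrow> 'a::field tens2 \<Rightarrow> 'a sqm \<Rightarrow> 'a sqm" where
  "rop n r x = (\<lambda>c d. \<Sum>a\<in>{1..n}. \<Sum>b\<in>{1..n}. x b a * r a b c d)"

lemma rop_diff: "rop n r (x - y) = rop n r x - rop n r y"
  by (intro ext) (simp add: rop_def left_diff_distrib sum_subtractf)

lemma rop_mscale: "rop n r (mscale c x) = mscale c (rop n r x)"
  by (intro ext) (simp add: rop_def mscale_def sum_distrib_left mult.assoc)

lemma W_supp: "r \<in> W n \<Longrightarrow> a \<notin> {1..n} \<or> b \<notin> {1..n} \<or> c \<notin> {1..n} \<or> d \<notin> {1..n} \<Longrightarrow> r a b c d = 0"
  unfolding W_def inR_iff by blast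

lemma W_skew: "r \<in> W n \<Longrightarrow> r a b c d = - r c d a b"
  unfolding W_def by blast

lemma W_trace: "r \<in> W n \<Longrightarrow> (\<Sum>j\<in>{1..n}. r j j c d) = 0"
  unfolding W_def by blast

lemma W_trace2: "r \<in> W n \<Longrightarrow> (\<Sum>j\<in>{1..n}. r a b j j) = 0"
proof -
  assume r: "r \<in> W n"
  have "(\<Sum>j\<in>{1..n}. r a b j j) = (\<Sum>j\<in>{1..n}. - r j j a b)"
    by (intro sum.cong refl W_skew[OF r])
  then show ?thesis using W_trace[OF r] by (simp add: sum_negf)
qed

lemma msupp_rop: "r \<in> W n \<Longrightarrow> msupp n (rop n r x)"
  by (rule msuppI) (auto simp: rop_def W_supp)

lemma mtrace_rop_eq_0: "r \<in> W n \<Longrightarrow> mtrace n (rop n r x) = 0"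
proof -
  assume r: "r \<in> W n"
  have "mtrace n (rop n r x) = (\<Sum>a\<in>{1..n}. \<Sum>b\<in>{1..n}. x b a * (\<Sum>c\<in>{1..n}. r a b c c))"
    unfolding mtrace_def rop_def
    by (subst sum.swap, rule sum.cong[OF refl], subst sum.swap) (simp add: sum_distrib_left)
  then show ?thesis by (simp add: W_trace2[OF r])
qed

lemma rop_in_sl: "r \<in> W n \<Longrightarrow> rop n r x \<in> sl n"
  by (simp add: sl_def msupp_rop mtrace_rop_eq_0)

lemma rop_mid: "r \<in> W n \<Longrightarrow> rop n r (mid n) = 0"
proof (intro ext)
  fix c d
  assume r: "r \<in> W n"
  have "rop n r (mid n) c d = (\<Sum>a\<in>{1..n}. r a a c d)"
    unfolding rop_def mid_def
    by (rule sum.cong) (auto simp: if_distrib[of "\<lambda>x. x * _"] sum.delta cong: if_cong)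
  then show "rop n r (mid n) c d = 0 c d" by (simp add: W_trace[OF r])
qed

lemma rop_munit: "a \<in> {1..n} \<Longrightarrow> b \<in> {1..n} \<Longrightarrow> rop n r (munit n b a) c d = r a b c d"
proof -
  assume ab: "a \<in> {1..n}" "b \<in> {1..n}"
  have "rop n r (munit n b a) c d = (\<Sum>a'\<in>{1..n}. if a' = a then r a b c d else 0)"
    unfolding rop_def munit_def
    by (rule sum.cong) (use ab in \<open>auto simp: if_distrib[of "\<lambda>x. x * _"] sum.delta cong: if_cong\<close>)
  then show ?thesis using ab by simp
qed

lemma sum_swap_pairs:
  "(\<Sum>c\<in>A. \<Sum>d\<in>B. \<Sum>a\<in>C. \<Sum>b\<in>D. F a b c d) = (\<Sum>a\<in>C. \<Sum>b\<in>D. \<Sum>c\<in>A. \<Sum>d\<in>B. F a b c d)"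
proof -
  have "(\<Sum>c\<in>A. \<Sum>d\<in>B. \<Sum>a\<in>C. \<Sum>b\<in>D. F a b c d) = (\<Sum>c\<in>A. \<Sum>a\<in>C. \<Sum>d\<in>B. \<Sum>b\<in>D. F a b c d)"
    by (intro sum.cong refl) (rule sum.swap)
  also have "\<dots> = (\<Sum>c\<in>A. \<Sum>a\<in>C. \<Sum>b\<in>D. \<Sum>d\<in>B. F a b c d)"
    by (intro sum.cong refl) (rule sum.swap)
  also have "\<dots> = (\<Sum>a\<in>C. \<Sum>c\<in>A. \<Sum>b\<in>D. \<Sum>d\<in>B. F a b c d)"
    by (rule sum.swap)
  also have "\<dots> = (\<Sum>a\<in>C. \<Sum>b\<in>D. \<Sum>c\<in>A. \<Sum>d\<in>B. F a b c d)"
    by (intro sum.cong refl) (rule sum.swap)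
  finally show ?thesis .
qed

lemma mtrace_rop:
  "mtrace n (mmul n (rop n r x) y) = (\<Sum>c\<in>{1..n}. \<Sum>d\<in>{1..n}. \<Sum>a\<in>{1..n}. \<Sum>b\<in>{1..n}. x b a * y d c * r a b c d)"
  by (simp add: mtrace_mmul rop_def sum_distrib_right sum_distrib_left mult_ac)

lemma mtrace_rop_skew:
  assumes r: "r \<in> W n"
  shows "mtrace n (mmul n (rop n r x) y) = - mtrace n (mmul n (rop n r y) x)"
proof -
  have "mtrace n (mmul n (rop n r x) y)
      = (\<Sum>a\<in>{1..n}. \<Sum>b\<in>{1..n}. \<Sum>c\<in>{1..n}. \<Sum>d\<in>{1..n}. x b a * y d c * r a b c d)"
    unfolding mtrace_rop by (rule sum_swap_pairs)
  also have "\<dots> = (\<Sum>a\<in>{1..n}. \<Sum>b\<in>{1..n}. \<Sum>c\<in>{1..n}. \<Sum>d\<in>{1..n}. - (y d c * x b a * r c d a b))"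
  proof (intro sum.cong refl)
    fix a b c d
    show "x b a * y d c * r a b c d = - (y d c * x b a * r c d a b)"
      by (subst W_skew[OF r]) (simp add: mult_ac)
  qed
  also have "\<dots> = - mtrace n (mmul n (rop n r y) x)"
    by (simp add: mtrace_rop sum_negf)
  finally show ?thesis .
qed

text \<open>Nondegeneracy of the trace form on traceless matrices. Since A is itself traceless,
  orthogonality extends from traceless z to all z, and matrix units then read off the
  entries.\<close>

lemma traceless_eq_0I:
  fixes A :: "'a::field_char_0 sqm"
  assumes A: "A \<in> sl n" and orth: "\<And>z. z \<in> sl n \<Longrightarrow> mtrace n (mmul n A z) = 0" and n: "0 < n"
  shows "A = 0"
proof (intro ext)
  fix a b
  have all: "mtrace n (mmul n A z) = 0" if z: "msupp n z" for z
  proof -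
    have "mtrace n (mmul n A (traceless n z)) = mtrace n (mmul n A z)"
      using A by (simp add: traceless_def mmul_diff_right mmul_mscale_right mtrace_diff mtrace_mscale sl_def)
    then show ?thesis using orth[OF traceless_in_sl[OF n z]] by simp
  qed
  show "A a b = 0 a b"
  proof (cases "a \<in> {1..n} \<and> b \<in> {1..n}")
    case True
    have "mtrace n (mmul n A (munit n b a)) = A a b"
      using A True by (subst mmul_munit_right) (auto simp: sl_def mtrace_def if_distrib sum.delta cong: if_cong)
    then show ?thesis using all[of "munit n b a"] by simp
  next
    case False
    then show ?thesis using msuppD[OF sl_msupp[OF A], of a b] by auto
  qed
qed

section \<open>Manin pairs and the modified Yang--Baxter equation\<close>

text \<open>The pairs live in the double of gl_n, the sum of two copies with the invariant form tr a
  a' - tr b b'.\<close>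

definition manin :: "nat \<Rightarrow> ('a::field_char_0 sqm \<Rightarrow> 'a sqm \<Rightarrow> bool) \<Rightarrow> bool" where
  "manin n G \<longleftrightarrow> (\<forall>a b a' b'. G a b \<longrightarrow> G a' b' \<longrightarrow>
     G (mbr n a a') (mbr n b b') \<and> mtrace n (mmul n a a') = mtrace n (mmul n b b'))"

text \<open>The maps r + 1/2 and r - 1/2 are those of the factorizable r-matrices r plus or minus
  half the Casimir; the shift 1/2 produces the constant 1/4 of the modified equation.\<close>

definition rgraph :: "nat \<Rightarrow> 'a::field_char_0 tens2 \<Rightarrow> ('a sqm \<Rightarrow> 'a sqm \<Rightarrow> bool) \<Rightarrow> bool" where
  "rgraph n r G \<longleftrightarrow> (\<forall>x\<in>sl n. G (rop n r x + mscale (1/2) x) (rop n r x - mscale (1/2) x))"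

lemma half_forms:
  fixes u v x z :: "'a::field_char_0 sqm"
  shows "mtrace n (mmul n (u + mscale (1/2) x) (v + mscale (1/2) z))
   - mtrace n (mmul n (u - mscale (1/2) x) (v - mscale (1/2) z))
   = mtrace n (mmul n u z) + mtrace n (mmul n x v)"
  by (simp add: mmul_add_left mmul_add_right mmul_diff_left mmul_diff_right mtrace_add mtrace_diff
      mmul_mscale_left mmul_mscale_right mtrace_mscale algebra_simps)

text \<open>Isotropy between a point of one graph and a point of the other gives tr(r x z) + tr(x s
  z) = 0. Skewness of s turns the second term into -tr(s x z), so r x - s x is orthogonal to every
  traceless z.\<close>

lemma rgraph_unique:
  fixes r s :: "'a::field_char_0 tens2"
  assumes G: "manin n G" and r: "r \<in> W n" "rgraph n r G" and s: "s \<in> W n" "rgraph n s G" and n: "0 < n"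
  shows "r = s"
proof -
  have sl_eq: "rop n r x = rop n s x" if x: "x \<in> sl n" for x
  proof -
    have "mtrace n (mmul n (rop n r x - rop n s x) z) = 0" if z: "z \<in> sl n" for z
    proof -
      have "mtrace n (mmul n (rop n r x + mscale (1/2) x) (rop n s z + mscale (1/2) z))
        = mtrace n (mmul n (rop n r x - mscale (1/2) x) (rop n s z - mscale (1/2) z))"
        using G r(2) s(2) x z unfolding manin_def rgraph_def by blast
      then have "mtrace n (mmul n (rop n r x) z) + mtrace n (mmul n x (rop n s z)) = 0"
        using half_forms[of n "rop n r x" x "rop n s z" z] by simp
      moreover have "mtrace n (mmul n x (rop n s z)) = - mtrace n (mmul n (rop n s x) z)"
        using mtrace_rop_skew[OF s(1), of z x] by (simp add: mtrace_mmul_comm)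
      ultimately show ?thesis by (simp add: mmul_diff_left mtrace_diff)
    qed
    moreover have "rop n r x - rop n s x \<in> sl n"
      using rop_in_sl[OF r(1)] rop_in_sl[OF s(1)] by (simp add: sl_def mtrace_diff)
    ultimately have "rop n r x - rop n s x = 0" by (intro traceless_eq_0I[OF _ _ n])
    then show ?thesis by simp
  qed
  \<comment> \<open>Both operators kill scalars, so agreement on traceless matrices extends to the
    matrix units, which recover the coefficients.\<close>
  have all: "rop n r x = rop n s x" if x: "msupp n x" for x
  proof -
    have "rop n t (traceless n x) = rop n t x" if "t \<in> W n" for t :: "'a tens2"
      using rop_mid[OF that] by (simp add: traceless_def rop_diff rop_mscale) (simp add: mscale_def zero_fun_def fun_eq_iff)
    then show ?thesis using sl_eq[OF traceless_in_sl[OF n x]] r s by metis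
  qed
  show ?thesis
  proof (intro ext)
    fix a b c d
    show "r a b c d = s a b c d"
    proof (cases "a \<in> {1..n} \<and> b \<in> {1..n}")
      case True
      then show ?thesis using all[of "munit n b a"] rop_munit[of a n b] by (metis msupp_munit)
    next
      case False
      then show ?thesis using W_supp[OF r(1)] W_supp[OF s(1)] by metis
    qed
  qed
qed

text \<open>The bracket of two graph points is a pair (a, b) in G. Isotropy against all graph points
  forces (a + b)/2 = r(a - b), so the bracket is again a graph point; expanding a + b and a - b
  gives the identity.\<close>

lemma modified_rota_baxter:
  fixes r :: "'a::field_char_0 tens2"
  assumes G: "manin n G" and r: "r \<in> W n" "rgraph n r G" and n: "0 < n"
    and x: "msupp n x" and y: "msupp n y"
  shows "mbr n (rop n r x) (rop n r y) + mscale (1/4) (mbr n x y)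
       = rop n r (mbr n (rop n r x) y + mbr n x (rop n r y))"
proof -
  have sl_case: "mbr n (rop n r x) (rop n r y) + mscale (1/4) (mbr n x y)
       = rop n r (mbr n (rop n r x) y + mbr n x (rop n r y))" if x: "x \<in> sl n" and y: "y \<in> sl n" for x y
  proof -
    let ?P = "\<lambda>x. rop n r x + mscale (1/2) x" and ?M = "\<lambda>x. rop n r x - mscale (1/2) x"
    define a b where "a = mbr n (?P x) (?P y)" and "b = mbr n (?M x) (?M y)"
    have ab: "a - b = mbr n (rop n r x) y + mbr n x (rop n r y)"
      by (intro ext) (simp add: a_def b_def mbr_add_left mbr_add_right mbr_diff_left mbr_diff_right
          mbr_mscale_left mbr_mscale_right mscale_apply field_simps)
    have ab2: "a + b = mscale 2 (mbr n (rop n r x) (rop n r y) + mscale (1/4) (mbr n x y))"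
      by (intro ext) (simp add: a_def b_def mbr_add_left mbr_add_right mbr_diff_left mbr_diff_right
          mbr_mscale_left mbr_mscale_right mscale_apply algebra_simps)
    have sl: "a \<in> sl n" "b \<in> sl n" by (simp_all add: a_def b_def)
    have Gab: "G a b"
      using G r(2) x y unfolding manin_def rgraph_def a_def b_def by blast
    have "mtrace n (mmul n (mscale (1/2) (a + b) - rop n r (a - b)) z) = 0" if z: "z \<in> sl n" for z
    proof -
      have "mtrace n (mmul n a (?P z)) = mtrace n (mmul n b (?M z))"
        using G Gab r(2) z unfolding manin_def rgraph_def by blast
      then have "mtrace n (mmul n (a - b) (rop n r z)) + mtrace n (mmul n (mscale (1/2) (a + b)) z) = 0"
        by (simp add: mmul_add_left mmul_add_right mmul_diff_left mmul_diff_right mtrace_add mtrace_diff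
            mmul_mscale_left mmul_mscale_right mtrace_mscale mscale_add algebra_simps)
      moreover have "mtrace n (mmul n (a - b) (rop n r z)) = - mtrace n (mmul n (rop n r (a - b)) z)"
        using mtrace_rop_skew[OF r(1), of z "a - b"] by (simp add: mtrace_mmul_comm)
      ultimately show ?thesis by (simp add: mmul_diff_left mtrace_diff)
    qed
    moreover have "mscale (1/2) (a + b) - rop n r (a - b) \<in> sl n"
      using sl rop_in_sl[OF r(1), of "a - b"] by (simp add: sl_def mtrace_diff mtrace_mscale mtrace_add)
    ultimately have "mscale (1/2) (a + b) - rop n r (a - b) = 0"
      by (intro traceless_eq_0I[OF _ _ n])
    then have "mscale (1/2) (a + b) = rop n r (a - b)" by simp
    moreover have "mscale (1/2) (mscale 2 z) = z" for z :: "'a sqm"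
      by (simp add: mscale_def)
    ultimately show ?thesis unfolding ab ab2 by simp
  qed
  \<comment> \<open>Both sides of the identity depend on x and y only modulo scalars, which reduces
    general matrices to traceless ones.\<close>
  have T: "rop n r (traceless n x) = rop n r x" for x
    using rop_mid[OF r(1)] by (simp add: traceless_def rop_diff rop_mscale) (simp add: mscale_def zero_fun_def fun_eq_iff)
  have L: "mbr n (traceless n x) z = mbr n x z" "mbr n z (traceless n x) = mbr n z x" if "msupp n z" for x z
    using that by (simp_all add: traceless_def mbr_diff_left mbr_diff_right mbr_mscale_left mbr_mscale_right
        mbr_mid_left mbr_mid_right) (simp_all add: fun_eq_iff mscale_apply)
  have sx: "msupp n (traceless n x)" if "msupp n x" for x :: "'a sqm"
    using that by (simp add: traceless_def)
  show ?thesis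
    using sl_case[OF traceless_in_sl[OF n x] traceless_in_sl[OF n y]]
    by (simp add: T L x y sx msupp_rop[OF r(1)])
qed

text \<open>This is [Omega_12, Omega_23]/4 for the Casimir Omega = sum of e_jk \<otimes> e_kj,
  written in the operator form that sends x, y to -[x, y]/4, as the modified Rota--Baxter identity
  delivers it.\<close>

definition casimir3 :: "nat \<Rightarrow> 'a::field_char_0 tens3" where
  "casimir3 n = (\<lambda>a b c d e f. - (1/4) * mbr n (munit n b a) (munit n d c) e f)"

lemma sum_mid_left: "(\<Sum>z\<in>{1..n}. mid n e z * F z) = (if e \<in> {1..n} then F e else (0::'a::comm_ring_1))"
  by (auto simp: mid_def if_distrib[of "\<lambda>x. x * _"] sum.delta cong: if_cong)

lemma sum_mid_right: "(\<Sum>z\<in>{1..n}. F z * mid n z e) = (if e \<in> {1..n} then F e else (0::'a::comm_ring_1))"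
  by (auto simp: mid_def if_distrib[of "\<lambda>x. _ * x"] sum.delta cong: if_cong)

text \<open>In every product each of the two factors has the identity in one leg, so the triple sums
  collapse to single sums over the leg that both factors share.\<close>

lemma cybe_expand:
  assumes r: "r \<in> W n"
  shows "cybe n r a b c d e f
   = (\<Sum>x\<in>{1..n}. r a x c d * r x b e f - r a x e f * r x b c d)
   + (\<Sum>x\<in>{1..n}. r a b c x * r x d e f - r c x e f * r a b x d)
   + (\<Sum>x\<in>{1..n}. r a b e x * r c d x f - r c d e x * r a b x f)"
proof -
  have R: "(if e \<in> {1..n} then r a b c d else 0) = r a b c d" if "e = a \<or> e = b \<or> e = c \<or> e = d" for e a b c d
    using W_supp[OF r] that by auto
  have 1: "mul3 n (r12 n r) (r13 n r) a b c d e f = (\<Sum>x\<in>{1..n}. r a x c d * r x b e f)"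
  proof -
    have "mul3 n (r12 n r) (r13 n r) a b c d e f
        = (\<Sum>x\<in>{1..n}. \<Sum>y\<in>{1..n}. (r a x c y * (\<Sum>z\<in>{1..n}. mid n e z * r x b z f)) * mid n y d)"
      unfolding mul3_def r12_def r13_def by (simp add: sum_distrib_left sum_distrib_right mult_ac)
    then show ?thesis by (simp only: sum_mid_left sum_mid_right) (auto intro!: sum.cong simp: W_supp[OF r])
  qed
  have 2: "mul3 n (r13 n r) (r12 n r) a b c d e f = (\<Sum>x\<in>{1..n}. r a x e f * r x b c d)"
  proof -
    have "mul3 n (r13 n r) (r12 n r) a b c d e f
        = (\<Sum>x\<in>{1..n}. \<Sum>y\<in>{1..n}. mid n c y * (\<Sum>z\<in>{1..n}. (r a x e z * r x b y d) * mid n z f))"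
      unfolding mul3_def r12_def r13_def by (simp add: sum_distrib_left sum_distrib_right mult_ac)
    then show ?thesis by (simp only: sum_mid_left sum_mid_right) (auto intro!: sum.cong simp: W_supp[OF r])
  qed
  have 3: "mul3 n (r12 n r) (r23 n r) a b c d e f = (\<Sum>x\<in>{1..n}. r a b c x * r x d e f)"
  proof -
    have "mul3 n (r12 n r) (r23 n r) a b c d e f
        = (\<Sum>x\<in>{1..n}. (\<Sum>y\<in>{1..n}. r a x c y * (\<Sum>z\<in>{1..n}. mid n e z * r y d z f)) * mid n x b)"
      unfolding mul3_def r12_def r23_def by (simp add: sum_distrib_left sum_distrib_right mult_ac)
    then show ?thesis by (simp only: sum_mid_left sum_mid_right) (auto intro!: sum.cong simp: W_supp[OF r])
  qed
  have 4: "mul3 n (r23 n r) (r12 n r) a b c d e f = (\<Sum>x\<in>{1..n}. r c x e f * r a b x d)"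
  proof -
    have "mul3 n (r23 n r) (r12 n r) a b c d e f
        = (\<Sum>x\<in>{1..n}. mid n a x * (\<Sum>y\<in>{1..n}. (\<Sum>z\<in>{1..n}. (r c y e z * r x b y d) * mid n z f)))"
      unfolding mul3_def r12_def r23_def by (simp add: sum_distrib_left sum_distrib_right mult_ac)
    then show ?thesis by (simp only: sum_mid_left sum_mid_right) (auto intro!: sum.cong simp: W_supp[OF r])
  qed
  have 5: "mul3 n (r13 n r) (r23 n r) a b c d e f = (\<Sum>x\<in>{1..n}. r a b e x * r c d x f)"
  proof -
    have "mul3 n (r13 n r) (r23 n r) a b c d e f
        = (\<Sum>x\<in>{1..n}. (\<Sum>y\<in>{1..n}. mid n c y * (\<Sum>z\<in>{1..n}. (r a x e z * r y d z f))) * mid n x b)"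
      unfolding mul3_def r13_def r23_def by (simp add: sum_distrib_left sum_distrib_right mult_ac)
    then show ?thesis by (simp only: sum_mid_left sum_mid_right) (auto intro!: sum.cong simp: W_supp[OF r])
  qed
  have 6: "mul3 n (r23 n r) (r13 n r) a b c d e f = (\<Sum>x\<in>{1..n}. r c d e x * r a b x f)"
  proof -
    have "mul3 n (r23 n r) (r13 n r) a b c d e f
        = (\<Sum>x\<in>{1..n}. mid n a x * (\<Sum>y\<in>{1..n}. (\<Sum>z\<in>{1..n}. (r c y e z * r x b z f)) * mid n y d))"
      unfolding mul3_def r13_def r23_def by (simp add: sum_distrib_left sum_distrib_right mult_ac)
    then show ?thesis by (simp only: sum_mid_left sum_mid_right) (auto intro!: sum.cong simp: W_supp[OF r])
  qed
  show ?thesis unfolding cybe_def comm3_def 1 2 3 4 5 6 by (simp add: sum_subtractf)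
qed

text \<open>Take x = e_ba and y = e_dc in the modified Rota--Baxter identity. Then r x and r y are
  the slices \<open>r a b\<close> and \<open>r c d\<close>, and the (e, f) entry of the identity is
  the wanted coefficient after two uses of skewness.\<close>

lemma cybe_eq_casimir3:
  fixes r :: "'a::field_char_0 tens2"
  assumes G: "manin n G" and r: "r \<in> W n" "rgraph n r G" and n: "0 < n"
  shows "cybe n r = casimir3 n"
proof (intro ext)
  fix a b c d e f
  note rW = r(1)
  show "cybe n r a b c d e f = casimir3 n a b c d e f"
  proof (cases "a \<in> {1..n} \<and> b \<in> {1..n} \<and> c \<in> {1..n} \<and> d \<in> {1..n} \<and> e \<in> {1..n} \<and> f \<in> {1..n}")
    case True
    then have R: "a \<in> {1..n}" "b \<in> {1..n}" "c \<in> {1..n}" "d \<in> {1..n}" "e \<in> {1..n}" "f \<in> {1..n}" by auto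
    let ?x = "munit n b a :: 'a sqm" and ?y = "munit n d c :: 'a sqm"
    have rx: "rop n r ?x = r a b" and ry: "rop n r ?y = r c d"
      using R by (auto simp: fun_eq_iff rop_munit)
    have sab: "msupp n (r a b)" "msupp n (r c d)"
      using msupp_rop[OF rW, of ?x] msupp_rop[OF rW, of ?y] rx ry by simp_all
    have z: "mbr n (r a b) ?y + mbr n ?x (r c d)
      = (\<lambda>q p. (if p = c then r a b q d else 0) - (if q = d then r a b c p else 0)
             + (if q = b then r c d a p else 0) - (if p = a then r c d q b else 0))"
      using R sab by (intro ext) (simp add: mbr_def mmul_munit_left mmul_munit_right)
    have "rop n r (mbr n (r a b) ?y + mbr n ?x (r c d)) e f
      = (\<Sum>p\<in>{1..n}. \<Sum>q\<in>{1..n}. (if p = c then r a b q d * r p q e f else 0) - (if q = d then r a b c p * r p q e f else 0)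
             + (if q = b then r c d a p * r p q e f else 0) - (if p = a then r c d q b * r p q e f else 0))"
      unfolding rop_def z by (intro sum.cong refl) (simp add: algebra_simps)
    also have "\<dots> = (\<Sum>q\<in>{1..n}. r a b q d * r c q e f) - (\<Sum>p\<in>{1..n}. r a b c p * r p d e f)
        + (\<Sum>p\<in>{1..n}. r c d a p * r p b e f) - (\<Sum>q\<in>{1..n}. r c d q b * r a q e f)"
    proof -
      have *: "(\<Sum>p\<in>{1..n}. \<Sum>q\<in>{1..n}. if p = k then F q p else 0) = (\<Sum>q\<in>{1..n}. F q k)"
        if "k \<in> {1..n}" for k and F :: "nat \<Rightarrow> nat \<Rightarrow> 'a"
        using that by (subst sum.swap) (simp add: sum.delta)
      show ?thesis using R by (simp add: sum.distrib sum_subtractf * sum.delta)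
    qed
    finally have ro: "rop n r (mbr n (r a b) ?y + mbr n ?x (r c d)) e f = \<dots>" .
    have "(mbr n (r a b) (r c d) + mscale (1/4) (mbr n ?x ?y)) e f
        = rop n r (mbr n (r a b) ?y + mbr n ?x (r c d)) e f"
      using modified_rota_baxter[OF G r n, of ?x ?y] rx ry by simp
    then have key: "(\<Sum>x\<in>{1..n}. r a b e x * r c d x f) - (\<Sum>x\<in>{1..n}. r c d e x * r a b x f)
       + 1/4 * mbr n ?x ?y e f
       = (\<Sum>q\<in>{1..n}. r a b q d * r c q e f) - (\<Sum>p\<in>{1..n}. r a b c p * r p d e f)
        + (\<Sum>p\<in>{1..n}. r c d a p * r p b e f) - (\<Sum>q\<in>{1..n}. r c d q b * r a q e f)"
      unfolding ro using R by (simp add: mscale_apply mbr_def[of n "r a b"] mmul_apply)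
    \<comment> \<open>Skewness exchanges the legs of one factor; \<open>s1\<close> and
      \<open>s2\<close> produce the two halves of [r12, r13].\<close>
    have s1: "(\<Sum>p\<in>{1..n}. r c d a p * r p b e f) = - (\<Sum>x\<in>{1..n}. r a x c d * r x b e f)"
      unfolding sum_negf[symmetric] using W_skew[OF rW, of c d a] by (intro sum.cong refl) (metis minus_mult_left)
    have s2: "(\<Sum>q\<in>{1..n}. r c d q b * r a q e f) = - (\<Sum>x\<in>{1..n}. r a x e f * r x b c d)"
      unfolding sum_negf[symmetric]
      by (intro sum.cong refl) (metis W_skew[OF rW] minus_mult_left mult.commute)
    have s3: "(\<Sum>q\<in>{1..n}. r a b q d * r c q e f) = (\<Sum>x\<in>{1..n}. r c x e f * r a b x d)"
      by (intro sum.cong refl) (simp add: mult.commute)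
    show ?thesis
      using key unfolding cybe_expand[OF rW] casimir3_def s1 s2 s3
      by (simp add: sum_subtractf algebra_simps)
  next
    case False
    have "casimir3 n a b c d e f = 0"
      using False by (auto simp: casimir3_def mbr_def mmul_def munit_def if_distrib[of "\<lambda>x. x * _"] cong: if_cong)
    moreover have "cybe n r a b c d e f = 0"
      unfolding cybe_expand[OF rW] using False W_supp[OF rW] by (auto intro!: sum.neutral)
    ultimately show ?thesis by simp
  qed
qed

lemma casimir3_apply:
  assumes "a \<in> {1..n}" "b \<in> {1..n}" "c \<in> {1..n}" "d \<in> {1..n}" "e \<in> {1..n}" "f \<in> {1..n}"
  shows "(casimir3 n a b c d e f :: 'a::field_char_0)
    = (if b = c \<and> d = e \<and> f = a then 1/4 else 0) - (if b = e \<and> f = c \<and> d = a then 1/4 else 0)"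
proof -
  have "mmul n (munit n b a) (munit n d c) e f = (if b = e \<and> f = c \<and> d = a then 1 else (0::'a))"
       "mmul n (munit n d c) (munit n b a) e f = (if b = c \<and> d = e \<and> f = a then 1 else (0::'a))"
    using assms unfolding mmul_munit_left[OF msupp_munit] by (auto simp: munit_def)
  moreover have "- (1/4) * ((if Q then 1 else 0) - (if P then 1 else 0))
      = (if P then 1/4 else 0) - (if Q then 1/4 else (0::'a))" for P Q
    by (cases P; cases Q) simp_all
  ultimately show ?thesis
    unfolding casimir3_def mbr_def minus_apply by (simp only:)
qed

lemma casimir3_supp:
  assumes "\<not> (a \<in> {1..n} \<and> b \<in> {1..n} \<and> c \<in> {1..n} \<and> d \<in> {1..n} \<and> e \<in> {1..n} \<and> f \<in> {1..n})"
  shows "casimir3 n a b c d e f = 0"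
  using assms unfolding casimir3_def mbr_def minus_apply mmul_munit_left[OF msupp_munit]
  by (auto simp: munit_def simp del: atLeastAtMost_iff)

lemma casimir3_nonzero: "2 \<le> n \<Longrightarrow> (casimir3 n :: 'a::field_char_0 tens3) \<noteq> (\<lambda>_ _ _ _ _ _. 0)"
proof
  assume n: "2 \<le> n" and eq: "(casimir3 n :: 'a tens3) = (\<lambda>_ _ _ _ _ _. 0)"
  have "(casimir3 n :: 'a tens3) 1 2 2 1 1 1 = 1/4"
    using n by (subst casimir3_apply) auto
  then show False using eq by simp
qed

text \<open>Kronecker deltas make the cyclic symmetry of the three legs visible, and every sum in
  the adjoint action then collapses at a delta.\<close>

lemma casimir3_eq_mid:
  "casimir3 n a b c d e f
     = (mid n b c * mid n d e * mid n f a - mid n b e * mid n f c * mid n d a) / (4::'a::field_char_0)"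
proof (cases "a \<in> {1..n} \<and> b \<in> {1..n} \<and> c \<in> {1..n} \<and> d \<in> {1..n} \<and> e \<in> {1..n} \<and> f \<in> {1..n}")
  case True
  then have "mid n b c * mid n d e * mid n f a = (if b = c \<and> d = e \<and> f = a then 1 else (0::'a))"
    "mid n b e * mid n f c * mid n d a = (if b = e \<and> f = c \<and> d = a then 1 else (0::'a))"
    by (simp_all add: mid_def del: atLeastAtMost_iff)
  moreover have "((if P then 1 else 0) - (if Q then 1 else 0)) / 4
      = (if P then 1/4 else 0) - (if Q then 1/4 else (0::'a))" for P Q
    by (cases P; cases Q) simp_all
  ultimately show ?thesis using True by (simp only: casimir3_apply)
next
  case False
  then have z: "mid n b c * mid n d e * mid n f a = (0::'a)" "mid n b e * mid n f c * mid n d a = (0::'a)"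
    by (auto simp: mid_def simp del: atLeastAtMost_iff)
  show ?thesis unfolding z casimir3_supp[OF False] by simp
qed

text \<open>Each commutator replaces one delta by an entry of x. For each of the two cyclic patterns
  this gives six terms, which cancel in pairs.\<close>

lemma casimir3_invariant:
  fixes x :: "'a::field_char_0 sqm"
  assumes x: "msupp n x"
  shows "lie_act3 n x (casimir3 n) = (\<lambda>_ _ _ _ _ _. 0)"
proof (intro ext)
  fix a b c d e f
  have L: "(\<Sum>y\<in>{1..n}. x p y * ((A * mid n q y - B * mid n r y) / 4)) = (A * x p q - B * x p r) / 4" for p q r A B
  proof -
    have "(\<Sum>y\<in>{1..n}. x p y * ((A * mid n q y - B * mid n r y) / 4))
      = (\<Sum>y\<in>{1..n}. mid n q y * (A * x p y / 4)) - (\<Sum>y\<in>{1..n}. mid n r y * (B * x p y / 4))"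
      unfolding sum_subtractf[symmetric] by (intro sum.cong refl) (simp add: field_simps)
    then show ?thesis unfolding sum_mid_left using msuppD[OF x, of p q] msuppD[OF x, of p r]
      by (auto simp: diff_divide_distrib simp del: atLeastAtMost_iff)
  qed
  have R: "(\<Sum>y\<in>{1..n}. ((A * mid n y q - B * mid n y r) / 4) * x y p) = (A * x q p - B * x r p) / 4" for p q r A B
  proof -
    have "(\<Sum>y\<in>{1..n}. ((A * mid n y q - B * mid n y r) / 4) * x y p)
      = (\<Sum>y\<in>{1..n}. (A * x y p / 4) * mid n y q) - (\<Sum>y\<in>{1..n}. (B * x y p / 4) * mid n y r)"
      unfolding sum_subtractf[symmetric] by (intro sum.cong refl) (simp add: field_simps)
    then show ?thesis unfolding sum_mid_right using msuppD[OF x, of q p] msuppD[OF x, of r p]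
      by (auto simp: diff_divide_distrib simp del: atLeastAtMost_iff)
  qed
  have T: "casimir3 n y b c d e f = ((mid n b c * mid n d e) * mid n f y - (mid n b e * mid n f c) * mid n d y) / (4::'a)"
    "casimir3 n a y c d e f = ((mid n d e * mid n f a) * mid n y c - (mid n f c * mid n d a) * mid n y e) / (4::'a)"
    "casimir3 n a b y d e f = ((mid n d e * mid n f a) * mid n b y - (mid n b e * mid n d a) * mid n f y) / (4::'a)"
    "casimir3 n a b c y e f = ((mid n b c * mid n f a) * mid n y e - (mid n b e * mid n f c) * mid n y a) / (4::'a)"
    "casimir3 n a b c d y f = ((mid n b c * mid n f a) * mid n d y - (mid n f c * mid n d a) * mid n b y) / (4::'a)"
    "casimir3 n a b c d e y = ((mid n b c * mid n d e) * mid n y a - (mid n b e * mid n d a) * mid n y c) / (4::'a)" for y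
    unfolding casimir3_eq_mid by (simp_all only: mult_ac)
  show "lie_act3 n x (casimir3 n) a b c d e f = 0"
    unfolding lie_act3_def T sum_subtractf L R by (simp add: field_simps)
qed

section \<open>The Cremmer--Gervais subalgebra\<close>

text \<open>The permutation of basis indices behind \<open>cgT\<close>: addition of i modulo n with
  representatives in 1..n instead of 0..n-1.\<close>

definition cgs :: "nat \<Rightarrow> nat \<Rightarrow> nat \<Rightarrow> nat" where
  "cgs i n c = (if c \<le> n - i then c + i else c + i - n)"

lemma bij_cgs: "i < n \<Longrightarrow> bij_betw (cgs i n) {1..n} {1..n}"
  by (rule bij_betw_byWitness[where f' = "\<lambda>c. if c \<le> i then c + n - i else c - i"])
    (auto simp: cgs_def)

lemma cgs_in: "i < n \<Longrightarrow> c \<in> {1..n} \<Longrightarrow> cgs i n c \<in> {1..n}"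
  by (auto simp: cgs_def)

lemma sum_cgs: "i < n \<Longrightarrow> (\<Sum>x\<in>{1..n}. F (cgs i n x)) = (\<Sum>x\<in>{1..n}. F x)"
  by (rule sum.reindex_bij_betw) (rule bij_cgs)

text \<open>After moving \<open>b\<close> by the cyclic shift \<open>cgs\<close>, the pair \<open>(a, b)\<close> lies in a maximal parabolic
  subalgebra and has equal Levi components.\<close>

definition cgG :: "nat \<Rightarrow> nat \<Rightarrow> 'a::field_char_0 sqm \<Rightarrow> 'a sqm \<Rightarrow> bool" where
  "cgG i n a b \<longleftrightarrow> (\<forall>c\<in>{1..n}. \<forall>d\<in>{1..n}.
      (c \<le> n - i \<longrightarrow> n - i < d \<longrightarrow> a c d = 0 \<and> b (cgs i n c) (cgs i n d) = 0) \<and>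
      ((c \<le> n - i \<longleftrightarrow> d \<le> n - i) \<longrightarrow> a c d = b (cgs i n c) (cgs i n d)))"

text \<open>The set is closed even under products: for c and d in one block, an intermediate index
  from the other block meets the zero block of one of the two factors.\<close>

lemma cgG_mmul:
  assumes i: "i < n" and G: "cgG i n a b" "cgG i n a' b'"
  shows "cgG i n (mmul n a a') (mmul n b b')"
  unfolding cgG_def
proof (intro ballI conjI impI)
  fix c d assume cd: "c \<in> {1..n}" "d \<in> {1..n}"
  have A: "mmul n a a' c d = (\<Sum>x\<in>{1..n}. a c x * a' x d)"
    using cd by (simp add: mmul_apply)
  have B: "mmul n b b' (cgs i n c) (cgs i n d)
      = (\<Sum>x\<in>{1..n}. b (cgs i n c) (cgs i n x) * b' (cgs i n x) (cgs i n d))"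
    using cd i cgs_in[OF i] by (subst mmul_apply) (auto simp: sum_cgs[OF i, of "\<lambda>x. b _ x * b' x _", symmetric])
  { assume "c \<le> n - i" "n - i < d"
    then have "a c x * a' x d = 0" "b (cgs i n c) (cgs i n x) * b' (cgs i n x) (cgs i n d) = 0"
      if "x \<in> {1..n}" for x
      using G cd that unfolding cgG_def by (metis linorder_not_le mult_zero_left mult_zero_right)+
    then show "mmul n a a' c d = 0" "mmul n b b' (cgs i n c) (cgs i n d) = 0"
      unfolding A B by (auto intro: sum.neutral) }
  assume S: "c \<le> n - i \<longleftrightarrow> d \<le> n - i"
  have "a c x * a' x d = b (cgs i n c) (cgs i n x) * b' (cgs i n x) (cgs i n d)"
    if x: "x \<in> {1..n}" for x
  proof (cases "x \<le> n - i \<longleftrightarrow> c \<le> n - i")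
    case True
    with G cd S x show ?thesis unfolding cgG_def by metis
  next
    case False
    with G cd S x show ?thesis unfolding cgG_def
      by (metis linorder_not_le mult_zero_left mult_zero_right)
  qed
  then show "mmul n a a' c d = mmul n b b' (cgs i n c) (cgs i n d)"
    unfolding A B by (intro sum.cong) auto
qed

lemma cgG_diff: "cgG i n a b \<Longrightarrow> cgG i n a' b' \<Longrightarrow> cgG i n (a - a') (b - b')"
  unfolding cgG_def by auto

text \<open>In the product a c d * a' d c with c and d in different blocks, one factor lies in the
  zero block. What remains are the Levi blocks, matched by reindexing along the shift.\<close>

lemma cgG_trace:
  assumes i: "i < n" and G: "cgG i n a b" "cgG i n a' b'"
  shows "mtrace n (mmul n a a') = mtrace n (mmul n b b')"
proof -
  have "a c d * a' d c = b (cgs i n c) (cgs i n d) * b' (cgs i n d) (cgs i n c)"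
    if cd: "c \<in> {1..n}" "d \<in> {1..n}" for c d
  proof (cases "c \<le> n - i \<longleftrightarrow> d \<le> n - i")
    case True
    with G cd show ?thesis unfolding cgG_def by metis
  next
    case False
    with G cd show ?thesis unfolding cgG_def
      by (metis linorder_not_le mult_zero_left mult_zero_right)
  qed
  then have "mtrace n (mmul n a a')
      = (\<Sum>c\<in>{1..n}. \<Sum>d\<in>{1..n}. b (cgs i n c) (cgs i n d) * b' (cgs i n d) (cgs i n c))"
    unfolding mtrace_mmul by (intro sum.cong refl) blast
  also have "\<dots> = mtrace n (mmul n b b')"
    unfolding mtrace_mmul
    using sum_cgs[OF i, of "\<lambda>x. \<Sum>d\<in>{1..n}. b x d * b' d x"]
    by (simp add: sum_cgs[OF i, of "\<lambda>y. b (cgs i n _) y * b' y (cgs i n _)"])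
  finally show ?thesis .
qed

lemma manin_cgG: "i < n \<Longrightarrow> manin n (cgG i n)"
  unfolding manin_def mbr_def by (simp add: cgG_diff cgG_mmul cgG_trace)

section \<open>The graph of the Cremmer--Gervais tensor\<close>

lemma cgT_funpow: "j < n \<Longrightarrow> (cgT i n ^^ s) j = (j + s * i) mod n"
  by (induction s) (auto simp: cgT_def mod_simps algebra_simps)

lemma cgS1_iff: "j \<in> cgS1 i n \<longleftrightarrow> 1 \<le> j \<and> j < n \<and> j \<noteq> n - i"
  by (auto simp: cgS1_def)

lemma cgT_inj:
  assumes "j \<in> cgS1 i n" "l \<in> cgS1 i n" "cgT i n j = cgT i n l"
  shows "j = l"
proof -
  have "[j = l] (mod n)"
    using assms(3) by (simp add: cgT_def cong_def[symmetric] cong_add_rcancel_nat)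
  then show ?thesis using assms by (simp add: cong_def cgS1_iff)
qed

text \<open>Injectivity of T on its domain identifies the predecessor of T l in any chain as
  l.\<close>

lemma cg_prec_step_right:
  assumes "l \<in> cgS1 i n" "j \<in> {1..n-1}"
  shows "cg_prec i n j (cgT i n l) \<longleftrightarrow> j = l \<or> cg_prec i n j l"
proof
  assume "cg_prec i n j (cgT i n l)"
  then obtain N where N: "N \<ge> 1" "\<forall>s<N. (cgT i n ^^ s) j \<in> cgS1 i n" "(cgT i n ^^ N) j = cgT i n l"
    unfolding cg_prec_def by auto
  then obtain M where M: "N = Suc M" by (cases N) auto
  have "(cgT i n ^^ M) j = l"
    using cgT_inj[of "(cgT i n ^^ M) j" i n l] N M assms by auto
  then show "j = l \<or> cg_prec i n j l"
  proof (cases "M = 0")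
    case False
    then show ?thesis unfolding cg_prec_def using N M assms \<open>(cgT i n ^^ M) j = l\<close>
      by (auto intro!: exI[of _ M])
  qed simp
next
  assume "j = l \<or> cg_prec i n j l"
  then show "cg_prec i n j (cgT i n l)"
  proof
    assume "j = l"
    then show ?thesis unfolding cg_prec_def using assms by (auto intro!: exI[of _ "Suc 0"])
  next
    assume "cg_prec i n j l"
    then obtain N where N: "N \<ge> 1" "\<forall>s<N. (cgT i n ^^ s) j \<in> cgS1 i n" "(cgT i n ^^ N) j = l"
      unfolding cg_prec_def by auto
    then show ?thesis unfolding cg_prec_def using assms
      by (auto intro!: exI[of _ "Suc N"] simp: less_Suc_eq)
  qed
qed

text \<open>The first step of a chain is split off; together with the previous lemma this is the
  recursion of the order along T.\<close>

lemma cg_prec_step_left: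
  assumes "j \<in> cgS1 i n" "cgT i n j \<in> {1..n-1}"
  shows "cg_prec i n j m \<longleftrightarrow> cgT i n j = m \<or> cg_prec i n (cgT i n j) m"
proof
  assume "cg_prec i n j m"
  then obtain N where N: "N \<ge> 1" "\<forall>s<N. (cgT i n ^^ s) j \<in> cgS1 i n" "(cgT i n ^^ N) j = m"
    unfolding cg_prec_def by auto
  then obtain M where M: "N = Suc M" by (cases N) auto
  have "\<forall>s<M. (cgT i n ^^ s) (cgT i n j) \<in> cgS1 i n" "(cgT i n ^^ M) (cgT i n j) = m"
    using N(2)[rule_format, of "Suc s" for s] N(3) unfolding M by (auto simp: funpow_swap1)
  then show "cgT i n j = m \<or> cg_prec i n (cgT i n j) m"
    unfolding cg_prec_def using assms by (cases "M = 0") (auto intro!: exI[of _ M])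
next
  assume "cgT i n j = m \<or> cg_prec i n (cgT i n j) m"
  then show "cg_prec i n j m"
  proof
    assume "cgT i n j = m"
    then show ?thesis unfolding cg_prec_def using assms by (auto intro!: exI[of _ "Suc 0"] simp: cgS1_iff)
  next
    assume "cg_prec i n (cgT i n j) m"
    then obtain N where N: "N \<ge> 1" "\<forall>s<N. (cgT i n ^^ s) (cgT i n j) \<in> cgS1 i n" "(cgT i n ^^ N) (cgT i n j) = m"
      unfolding cg_prec_def by auto
    have "(cgT i n ^^ s) j \<in> cgS1 i n" if "s < Suc N" for s
      using N(2) that assms by (cases s) (auto simp: funpow_swap1)
    then show ?thesis unfolding cg_prec_def using assms N
      by (auto intro!: exI[of _ "Suc N"] simp: funpow_swap1 cgS1_iff)
  qed
qed

text \<open>A chain ending in i would have to come from 0, which is no simple root.\<close>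

lemma cg_prec_not_i: "i < n \<Longrightarrow> \<not> cg_prec i n j i"
proof
  assume i: "i < n" and "cg_prec i n j i"
  then obtain N where N: "N \<ge> 1" "\<forall>s<N. (cgT i n ^^ s) j \<in> cgS1 i n" "(cgT i n ^^ N) j = i"
    unfolding cg_prec_def by auto
  then obtain M where M: "N = Suc M" by (cases N) auto
  define l where "l = (cgT i n ^^ M) j"
  have l: "l \<in> cgS1 i n" "(l + i) mod n = i"
    using N M by (auto simp: l_def cgT_def)
  have "[l + i = 0 + i] (mod n)" using l i by (simp add: cong_def)
  then have "[l = 0] (mod n)" using cong_add_rcancel_nat by blast
  then show False using l i by (simp add: cong_def cgS1_iff)
qed

lemma cg_prec_not_last: "\<not> cg_prec i n (n - i) m"
proof
  assume "cg_prec i n (n - i) m"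
  then obtain N where "N \<ge> 1" "\<forall>s<N. (cgT i n ^^ s) (n - i) \<in> cgS1 i n"
    unfolding cg_prec_def by auto
  then show False by (auto dest!: spec[of _ 0] simp: cgS1_iff)
qed

text \<open>A cycle would keep the whole orbit of j in the domain of T, but since i is invertible
  modulo n the orbit of j under adding i meets 0.\<close>

lemma cg_prec_irrefl:
  assumes i: "i < n" and co: "coprime i n"
  shows "\<not> cg_prec i n j j"
proof
  assume P: "cg_prec i n j j"
  then obtain N where N: "N \<ge> 1" "\<forall>s<N. (cgT i n ^^ s) j \<in> cgS1 i n" "(cgT i n ^^ N) j = j"
    unfolding cg_prec_def by auto
  have j: "1 \<le> j" "j < n" using P unfolding cg_prec_def by auto
  obtain x where x: "[i * x = 1] (mod n)" using cong_solve_coprime_nat[OF co] by (auto simp: One_nat_def)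
  \<comment> \<open>As x inverts i modulo n, adding i to j exactly s times gives j + (n - j), which
    is 0 modulo n.\<close>
  define s where "s = x * (n - j)"
  have "(cgT i n ^^ s) j \<in> cgS1 i n"
    using N(1,2) funpow_mod_eq[OF N(3), of s] by (metis mod_less_divisor less_le_trans zero_less_one)
  moreover have "(cgT i n ^^ s) j = 0"
  proof -
    have "[j + s * i = j + 1 * (n - j)] (mod n)"
      unfolding s_def using cong_scalar_right[OF x, of "n - j"]
      by (intro cong_add cong_refl) (simp add: mult_ac)
    also have "j + 1 * (n - j) = n" using j by simp
    finally show ?thesis using j by (simp add: cgT_funpow cong_def)
  qed
  ultimately show False by (simp add: cgS1_iff)
qed

text \<open>If c and d lie in one block, the root e_cd contains neither the omitted simple root n -
  i nor a wrap-around, so T translates its simple roots rigidly.\<close>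

lemma cgs_eq_cgT:
  assumes i: "0 < i" "i < n" and cd: "c \<in> {1..n}" "d \<in> {1..n}" "c < d" "c \<le> n - i \<longleftrightarrow> d \<le> n - i" and s: "s < d - c"
  shows "c + s \<in> cgS1 i n" "cgT i n (c + s) = cgs i n c + s" "cgs i n c + s \<in> {1..n-1}"
proof -
  show 1: "c + s \<in> cgS1 i n" using assms by (auto simp: cgS1_iff)
  show 2: "cgT i n (c + s) = cgs i n c + s"
  proof (cases "c \<le> n - i")
    case True
    then show ?thesis using assms by (auto simp: cgT_def cgs_def)
  next
    case False
    then have "(c + s + i) mod n = (c + s + i - n) mod n" using assms by (simp add: le_mod_geq)
    also have "\<dots> = c + s + i - n" using assms False by auto
    finally show ?thesis using False assms by (auto simp: cgT_def cgs_def)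
  qed
  show "cgs i n c + s \<in> {1..n-1}" using assms by (auto simp: cgs_def)
qed

lemma cgs_less:
  assumes "i < n" "c \<in> {1..n}" "d \<in> {1..n}" "c < d" "c \<le> n - i \<longleftrightarrow> d \<le> n - i"
  shows "cgs i n c < cgs i n d" "cgs i n d - cgs i n c = d - c"
  using assms by (auto simp: cgs_def)

text \<open>The simple-root recursion is applied to every constituent. Its equality alternative a +
  s = d + s does not depend on s, so the alternatives never mix within one root.\<close>

lemma root_prec_step_right:
  assumes i: "0 < i" "i < n" and dc: "d \<in> {1..n}" "c \<in> {1..n}" "d < c" "d \<le> n - i \<longleftrightarrow> c \<le> n - i"
    and a: "1 \<le> a" "a < b" "b \<le> n"
  shows "root_prec i n a b (cgs i n d) (cgs i n c) \<longleftrightarrow> (d = a \<and> c = b) \<or> root_prec i n a b d c"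
proof (cases "c - d = b - a")
  case False
  then show ?thesis using dc a cgs_less[OF i(2) dc] by (auto simp: root_prec_def)
next
  case len: True
  have "cg_prec i n (a + s) (cgs i n d + s) \<longleftrightarrow> a + s = d + s \<or> cg_prec i n (a + s) (d + s)" if "s < b - a" for s
  proof -
    have s: "s < c - d" using that len by simp
    show ?thesis
      using cg_prec_step_right[OF cgs_eq_cgT(1)[OF i dc s], of "a + s"] cgs_eq_cgT(2)[OF i dc s] a that
      by auto
  qed
  then show ?thesis
    using dc a cgs_less[OF i(2) dc] len by (auto simp: root_prec_def)
qed

lemma root_prec_step_left:
  assumes i: "0 < i" "i < n" and cd: "c \<in> {1..n}" "d \<in> {1..n}" "c < d" "c \<le> n - i \<longleftrightarrow> d \<le> n - i"
    and b: "b < a"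
  shows "root_prec i n c d b a \<longleftrightarrow> (cgs i n c = b \<and> cgs i n d = a) \<or> root_prec i n (cgs i n c) (cgs i n d) b a"
proof (cases "a - b = d - c")
  case False
  then show ?thesis using cd b cgs_less[OF i(2) cd] by (auto simp: root_prec_def)
next
  case len: True
  have "cg_prec i n (c + s) (b + s) \<longleftrightarrow> cgs i n c + s = b + s \<or> cg_prec i n (cgs i n c + s) (b + s)" if "s < d - c" for s
    using cg_prec_step_left[OF cgs_eq_cgT(1)[OF i cd that]] cgs_eq_cgT(2,3)[OF i cd that] by auto
  then show ?thesis
    using cd b cgs_less[OF i(2) cd] len by (auto simp: root_prec_def)
qed

lemma root_prec_irrefl: "i < n \<Longrightarrow> coprime i n \<Longrightarrow> \<not> root_prec i n a b a b"
  unfolding root_prec_def using cg_prec_irrefl[of i n a]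
  by (metis add.right_neutral zero_less_diff)

text \<open>A root across i contains the simple root i, which is never a target of T.\<close>

lemma root_prec_not_straddle_right:
  assumes "i < n" "d \<le> i" "i < c"
  shows "\<not> root_prec i n a b d c"
proof
  assume R: "root_prec i n a b d c"
  then have "\<forall>s<c - d. cg_prec i n (a + s) (d + s)"
    unfolding root_prec_def by auto
  then have "cg_prec i n (a + (i - d)) (d + (i - d))"
    using assms by (auto dest!: spec[of _ "i - d"])
  then show False using cg_prec_not_i assms by auto
qed

text \<open>Dually, the simple root n - i is never a source.\<close>

lemma root_prec_not_straddle_left:
  assumes "c \<le> n - i" "n - i < d"
  shows "\<not> root_prec i n c d b a"
proof
  assume R: "root_prec i n c d b a"
  then have "\<forall>s<d - c. cg_prec i n (c + s) (b + s)"
    unfolding root_prec_def by auto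
  then have "cg_prec i n (c + (n - i - c)) (b + (n - i - c))"
    using assms by (auto dest!: spec[of _ "n - i - c"])
  moreover have "c + (n - i - c) = n - i" using assms by simp
  ultimately show False using cg_prec_not_last by metis
qed

section \<open>Coefficients of the Cremmer--Gervais tensor\<close>

lemma sum_delta_conj:
  "finite A \<Longrightarrow> (\<Sum>x\<in>A. if x = k \<and> P x then F x else 0) = (if k \<in> A \<and> P k then F k else (0::'a::comm_monoid_add))"
proof -
  assume "finite A"
  have "(\<Sum>x\<in>A. if x = k \<and> P x then F x else 0) = (\<Sum>x\<in>A. if x = k then (if P x then F x else 0) else 0)"
    by (intro sum.cong) auto
  with \<open>finite A\<close> show ?thesis by simp
qed

lemma sum4_delta:
  assumes "a \<in> A" "b \<in> A" "c \<in> A" "d \<in> A" "finite A"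
  shows "(\<Sum>j\<in>A. \<Sum>k\<in>A. \<Sum>l\<in>A. \<Sum>m\<in>A. if m = d \<and> l = c \<and> k = b \<and> j = a then F j k l m else 0)
    = (F a b c d :: 'a::comm_monoid_add)"
  using assms by (simp add: sum_delta_conj)

lemma wedge_munit:
  assumes "j \<in> {1..n}" "k \<in> {1..n}" "l \<in> {1..n}" "m \<in> {1..n}"
  shows "wedge (munit n j k) (munit n l m) a b c d
     = ((if a = j \<and> b = k \<and> c = l \<and> d = m then 1 else 0) - (if a = l \<and> b = m \<and> c = j \<and> d = k then 1 else 0)) / (2::'a::field_char_0)"
proof -
  have M: "munit n j k p q = (if p = j \<and> q = k then 1 else (0::'a))"
    "munit n l m p q = (if p = l \<and> q = m then 1 else (0::'a))" for p q
    using assms by (simp_all add: munit_def)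
  have I: "(if P then 1 else 0) * (if Q then 1 else 0) = (if P \<and> Q then 1 else (0::'a))" for P Q by simp
  show ?thesis unfolding wedge_def M I by (simp only: conj_assoc)
qed

lemma if_wedge:
  "(if C then x * (((if P then 1 else 0) - (if Q then 1 else 0)) / 2) else 0)
   = (if P then of_bool C * x / 2 else 0) - (if Q then of_bool C * x / (2::'a::field_char_0) else 0)"
  by (cases C; cases P; cases Q) simp_all

lemma cg_alpha_apply:
  assumes R: "a \<in> {1..n}" "b \<in> {1..n}" "c \<in> {1..n}" "d \<in> {1..n}"
  shows "cg_alpha i n a b c d = of_bool (root_prec i n a b d c) - (of_bool (root_prec i n c d b a) :: 'a::field_char_0)"
proof -
  have C: "(a = j \<and> b = k \<and> c = m \<and> d = l) \<longleftrightarrow> (m = c \<and> l = d \<and> k = b \<and> j = a)"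
    "(a = m \<and> b = l \<and> c = j \<and> d = k) \<longleftrightarrow> (m = a \<and> l = b \<and> k = d \<and> j = c)" for j k l m by auto
  have "(if root_prec i n j k l m then wedge (munit n j k) (munit n m l) a b c d else 0)
      = (if m = c \<and> l = d \<and> k = b \<and> j = a then of_bool (root_prec i n j k l m) / 2 else 0)
      - (if m = a \<and> l = b \<and> k = d \<and> j = c then of_bool (root_prec i n j k l m) / 2 else (0::'a))"
    if "j \<in> {1..n}" "k \<in> {1..n}" "l \<in> {1..n}" "m \<in> {1..n}" for j k l m
    using if_wedge[of "root_prec i n j k l m" "1::'a"] that by (simp only: wedge_munit C mult_1 mult_1_right) (simp only: conj_ac)
  then have "cg_alpha i n a b c d = 2 * ((\<Sum>j\<in>{1..n}. \<Sum>k\<in>{1..n}. \<Sum>l\<in>{1..n}. \<Sum>m\<in>{1..n}.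
        if m = c \<and> l = d \<and> k = b \<and> j = a then of_bool (root_prec i n j k l m) / 2 else 0)
      - (\<Sum>j\<in>{1..n}. \<Sum>k\<in>{1..n}. \<Sum>l\<in>{1..n}. \<Sum>m\<in>{1..n}.
        if m = a \<and> l = b \<and> k = d \<and> j = c then of_bool (root_prec i n j k l m) / 2 else (0::'a)))"
    unfolding cg_alpha_def sum_subtractf[symmetric]
    by (intro arg_cong[of _ _ "\<lambda>x. 2 * x"] sum.cong refl) blast
  also have "\<dots> = 2 * (of_bool (root_prec i n a b d c) / 2 - of_bool (root_prec i n c d b a) / 2)"
    using R by (simp only: sum4_delta finite_atLeastAtMost)
  finally show ?thesis by (simp add: right_diff_distrib)
qed

definition cg_co :: "nat \<Rightarrow> nat \<Rightarrow> nat \<Rightarrow> nat \<Rightarrow> 'a::field_char_0" where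
  "cg_co i n j l = -1 + 2 / of_nat n * of_int (((int j - int l) * inv_mod i n) mod int n)"

lemma cg_beta_apply':
  assumes R: "a \<in> {1..n}" "b \<in> {1..n}" "c \<in> {1..n}" "d \<in> {1..n}"
  shows "cg_beta i n a b c d = (if a = b \<and> c = d then (if a < c then cg_co i n a c / 2 else 0) - (if c < a then cg_co i n c a / 2 else (0::'a::field_char_0)) else 0)"
proof -
  have C: "(a = j \<and> b = j \<and> c = l \<and> d = l) \<longleftrightarrow> (l = c \<and> j = a \<and> a = b \<and> c = d)"
    "(a = l \<and> b = l \<and> c = j \<and> d = j) \<longleftrightarrow> (l = a \<and> j = c \<and> a = b \<and> c = d)" for j l by auto
  have "(if j < l then cg_co i n j l * wedge (munit n j j) (munit n l l) a b c d else 0)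
      = (if l = c \<and> j = a \<and> a = b \<and> c = d then of_bool (j < l) * cg_co i n j l / 2 else 0)
      - (if l = a \<and> j = c \<and> a = b \<and> c = d then of_bool (j < l) * cg_co i n j l / 2 else (0::'a))"
    if "j \<in> {1..n}" "l \<in> {1..n}" for j l
    using if_wedge[of "j < l" "cg_co i n j l :: 'a"] that by (simp only: wedge_munit C) (simp only: conj_ac)
  then have "cg_beta i n a b c d
      = (\<Sum>j\<in>{1..n}. \<Sum>l\<in>{1..n}. if l = c \<and> j = a \<and> a = b \<and> c = d then of_bool (j < l) * cg_co i n j l / 2 else 0)
      - (\<Sum>j\<in>{1..n}. \<Sum>l\<in>{1..n}. if l = a \<and> j = c \<and> a = b \<and> c = d then of_bool (j < l) * cg_co i n j l / 2 else (0::'a))"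
    unfolding cg_beta_def cg_co_def[symmetric] sum_subtractf[symmetric]
    by (intro sum.cong refl) blast
  then show ?thesis using R by (simp add: sum_delta_conj del: atLeastAtMost_iff)
qed

lemma cg_gamma_apply:
  assumes R: "a \<in> {1..n}" "b \<in> {1..n}" "c \<in> {1..n}" "d \<in> {1..n}"
  shows "cg_gamma i n a b c d = (if c = b \<and> d = a then (if a < b then 1/2 else 0) - (if b < a then 1/2 else (0::'a::field_char_0)) else 0)"
proof -
  have C: "(a = k \<and> b = l \<and> c = l \<and> d = k) \<longleftrightarrow> (l = b \<and> k = a \<and> c = b \<and> d = a)"
    "(a = l \<and> b = k \<and> c = k \<and> d = l) \<longleftrightarrow> (l = a \<and> k = b \<and> c = b \<and> d = a)" for k l by auto
  have "(if k < l then wedge (munit n k l) (munit n l k) a b c d else 0)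
      = (if l = b \<and> k = a \<and> c = b \<and> d = a then of_bool (k < l) / 2 else 0)
      - (if l = a \<and> k = b \<and> c = b \<and> d = a then of_bool (k < l) / 2 else (0::'a))"
    if "k \<in> {1..n}" "l \<in> {1..n}" for k l
    using if_wedge[of "k < l" "1::'a"] that by (simp only: wedge_munit C mult_1 mult_1_right) (simp only: conj_ac)
  then have "cg_gamma i n a b c d
      = (\<Sum>k\<in>{1..n}. \<Sum>l\<in>{1..n}. if l = b \<and> k = a \<and> c = b \<and> d = a then of_bool (k < l) / 2 else 0)
      - (\<Sum>k\<in>{1..n}. \<Sum>l\<in>{1..n}. if l = a \<and> k = b \<and> c = b \<and> d = a then of_bool (k < l) / 2 else (0::'a))"
    unfolding cg_gamma_def sum_subtractf[symmetric]
    by (intro sum.cong refl) blast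
  then show ?thesis using R by (simp add: sum_delta_conj del: atLeastAtMost_iff)
qed

lemma rCG_supp:
  assumes "a \<notin> {1..n} \<or> b \<notin> {1..n} \<or> c \<notin> {1..n} \<or> d \<notin> {1..n}"
  shows "rCG i n a b c d = (0::'a::field_char_0)"
proof -
  have w: "wedge (munit n j k) (munit n l m) a b c d = (0::'a)" for j k l m
    using assms by (auto simp: wedge_def munit_def simp del: atLeastAtMost_iff)
  show ?thesis
    unfolding rCG_def tadd_def cg_alpha_def cg_beta_def cg_gamma_def w by (simp cong: if_cong)
qed

lemma inv_mod_cong:
  assumes "coprime i n"
  shows "[inv_mod i n * int i = 1] (mod int n)"
proof -
  have "\<exists>u. [int i * u = 1] (mod int n)"
    by (rule cong_solve_coprime_int) (use assms in simp)
  then have "\<exists>u. [u * int i = 1] (mod int n)" by (simp only: mult.commute)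
  then show ?thesis unfolding inv_mod_def by (rule someI_ex)
qed

lemma cg_index_eq_0_iff:
  assumes co: "coprime i n" and R: "a \<in> {1..n}" "c \<in> {1..n}"
  shows "((int a - int c) * inv_mod i n) mod int n = 0 \<longleftrightarrow> a = c"
proof
  assume "((int a - int c) * inv_mod i n) mod int n = 0"
  then have "[(int a - int c) * inv_mod i n * int i = 0] (mod int n)"
    by (intro cong_mult_self_left[THEN cong_trans] | simp add: cong_0_iff mod_eq_0_iff_dvd)+
  moreover have "[(int a - int c) * (inv_mod i n * int i) = (int a - int c) * 1] (mod int n)"
    by (intro cong_mult cong_refl inv_mod_cong co)
  ultimately have "[int a - int c = 0] (mod int n)"
    by (metis cong_sym cong_trans mult.assoc mult_1_right)
  then have "int n dvd int a - int c" by (simp add: cong_0_iff)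
  moreover have "\<bar>int a - int c\<bar> < int n" using R by auto
  ultimately show "a = c" using zdvd_imp_le by (metis abs_of_nonneg abs_zero dvd_abs_iff linorder_not_le of_nat_eq_iff order_le_less right_minus_eq zero_less_abs_iff)
qed simp

text \<open>The residues of k and -k add up to n unless k = 0. Hence the coefficient prescribed for
  j < l is skew, and one formula serves both orders.\<close>

lemma cg_co_swap:
  assumes co: "coprime i n" and R: "a \<in> {1..n}" "c \<in> {1..n}" "a \<noteq> c"
  shows "cg_co i n c a = - (cg_co i n a c :: 'a::field_char_0)"
proof -
  let ?N = "((int a - int c) * inv_mod i n) mod int n"
  have "?N \<noteq> 0" using cg_index_eq_0_iff[OF co R(1,2)] R by simp
  then have N: "((int c - int a) * inv_mod i n) mod int n = int n - ?N"
    using zmod_zminus1_not_zero zmod_zminus1_eq_if[of "(int a - int c) * inv_mod i n" "int n"]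
    by (simp add: left_diff_distrib)
  show ?thesis using R unfolding cg_co_def N by (simp add: right_diff_distrib)
qed

lemma cg_beta_apply:
  assumes "coprime i n" "a \<in> {1..n}" "b \<in> {1..n}" "c \<in> {1..n}" "d \<in> {1..n}"
  shows "cg_beta i n a b c d = (if a = b \<and> c = d \<and> a \<noteq> c then cg_co i n a c / 2 else (0::'a::field_char_0))"
  using assms cg_co_swap[where ?'a='a, OF assms(1), of a c] by (auto simp: cg_beta_apply')

text \<open>Moving c by i lowers the residue of (a - c)/i by one, which accounts for 1/n; the
  wrap-around at a = c adds n and accounts for the summand 1.\<close>

lemma cg_co_cgs:
  assumes i: "i < n" and co: "coprime i n" and R: "a \<in> {1..n}" "c \<in> {1..n}"
  shows "cg_co i n a (cgs i n c) / 2 = cg_co i n a c / 2 + (if a = c then 1 else 0) - 1 / (of_nat n :: 'a::field_char_0)"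
proof -
  let ?u = "inv_mod i n"
  let ?N = "((int a - int c) * ?u) mod int n"
  have n: "int n > 0" using i by simp
  have "[int (cgs i n c) = int c + int i] (mod int n)"
    by (auto simp: cgs_def cong_iff_dvd_diff of_nat_diff)
  then have 1: "[(int a - int (cgs i n c)) * ?u = (int a - (int c + int i)) * ?u] (mod int n)"
    by (intro cong_mult cong_diff cong_refl)
  have 2: "(int a - (int c + int i)) * ?u = (int a - int c) * ?u - ?u * int i" by (simp add: algebra_simps)
  have 3: "[(int a - int c) * ?u - ?u * int i = ?N - 1] (mod int n)"
    by (intro cong_diff inv_mod_cong co) (simp add: cong_def)
  have N: "((int a - int (cgs i n c)) * ?u) mod int n = (?N - 1) mod int n"
    using cong_trans[OF 1[unfolded 2] 3] by (simp add: cong_def)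
  have N0: "?N = 0 \<longleftrightarrow> a = c" by (rule cg_index_eq_0_iff[OF co R])
  have Nb: "0 \<le> ?N" "?N < int n" using n by auto
  have N': "((int a - int (cgs i n c)) * ?u) mod int n = ?N - 1 + (if a = c then int n else 0)"
  proof (cases "a = c")
    case True
    then have "?N = 0" using N0 by blast
    then show ?thesis unfolding N using True n by (simp add: zmod_minus1)
  next
    case False
    then have "?N \<ge> 1" using N0 Nb by linarith
    then show ?thesis unfolding N using False Nb by simp
  qed
  show ?thesis using n unfolding cg_co_def N'
    by (auto simp: right_diff_distrib distrib_left add_divide_distrib diff_divide_distrib)
qed

lemma rCG_eq:
  assumes "coprime i n" "a \<in> {1..n}" "b \<in> {1..n}" "c \<in> {1..n}" "d \<in> {1..n}"
  shows "rCG i n a b c d = of_bool (root_prec i n a b d c) - of_bool (root_prec i n c d b a)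
    + (if a = b \<and> c = d \<and> a \<noteq> c then cg_co i n a c / 2 else 0)
    + (if c = b \<and> d = a then (if a < b then 1/2 else 0) - (if b < a then 1/2 else (0::'a::field_char_0)) else 0)"
  unfolding rCG_def tadd_def cg_alpha_apply[OF assms(2-5)] cg_beta_apply[OF assms] cg_gamma_apply[OF assms(2-5)]
  by simp

lemma rCG_in_W:
  assumes i: "i < n" and co: "coprime i n"
  shows "(rCG i n :: 'a::field_char_0 tens2) \<in> W n"
proof -
  have skew: "rCG i n a b c d = - (rCG i n c d a b :: 'a)" for a b c d
  proof (cases "a \<in> {1..n} \<and> b \<in> {1..n} \<and> c \<in> {1..n} \<and> d \<in> {1..n}")
    case True
    then have R: "a \<in> {1..n}" "b \<in> {1..n}" "c \<in> {1..n}" "d \<in> {1..n}" by auto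
    have "(if a = b \<and> c = d \<and> a \<noteq> c then cg_co i n a c / 2 else 0)
        = - (if c = d \<and> a = b \<and> c \<noteq> a then cg_co i n c a / 2 else (0::'a))"
      using cg_co_swap[where ?'a='a, OF co R(1,3)] by auto
    moreover have "(if c = b \<and> d = a then (if a < b then 1/2 else 0) - (if b < a then 1/2 else 0) else 0)
        = - (if a = d \<and> b = c then (if c < d then 1/2 else 0) - (if d < c then 1/2 else 0) else (0::'a))"
      by auto
    ultimately show ?thesis
      unfolding rCG_eq[OF co R] rCG_eq[OF co R(3,4,1,2)] by simp
  next
    case False
    then have "rCG i n a b c d = (0::'a)" "rCG i n c d a b = (0::'a)"
      using rCG_supp[where ?'a='a] by blast+
    then show ?thesis by simp
  qed
  have tr: "(\<Sum>j\<in>{1..n}. rCG i n j j l m) = (0::'a)" for l m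
  proof (cases "l \<in> {1..n} \<and> m \<in> {1..n} \<and> l = m")
    case False
    have "rCG i n j j l m = (0::'a)" if j: "j \<in> {1..n}" for j
    proof (cases "l \<in> {1..n} \<and> m \<in> {1..n}")
      case True
      with False j show ?thesis by (subst rCG_eq[OF co]) (auto simp: root_prec_def)
    next
      case False
      then show ?thesis using rCG_supp[where ?'a='a] by blast
    qed
    then show ?thesis by simp
  next
    case True
    \<comment> \<open>Multiplication by the inverse of i permutes residues, so as j varies these
      values run once through 0, ..., n - 1.\<close>
    let ?N = "\<lambda>j. ((int j - int l) * inv_mod i n) mod int n"
    have inj: "inj_on ?N {1..n}"
    proof (rule inj_onI)
      fix j k assume jk: "j \<in> {1..n}" "k \<in> {1..n}" "?N j = ?N k"
      then have "int n dvd (int j - int l) * inv_mod i n - (int k - int l) * inv_mod i n"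
        by (simp only: mod_eq_dvd_iff)
      also have "(int j - int l) * inv_mod i n - (int k - int l) * inv_mod i n = (int j - int k) * inv_mod i n"
        by (simp add: algebra_simps)
      finally have "((int j - int k) * inv_mod i n) mod int n = 0" by simp
      then show "j = k" using cg_index_eq_0_iff[OF co jk(1,2)] by simp
    qed
    have "?N ` {1..n} = {0..<int n}"
    proof (rule card_subset_eq)
      show "?N ` {1..n} \<subseteq> {0..<int n}" using i by auto
      show "card (?N ` {1..n}) = card {0..<int n}" using inj by (simp add: card_image)
    qed simp
    then have "(\<Sum>j\<in>{1..n}. of_int (?N j)) = (\<Sum>v\<in>{0..<int n}. of_int v :: 'a)"
      using sum.reindex[OF inj, of "of_int :: int \<Rightarrow> 'a"] by (simp add: o_def)
    also have "\<dots> = (\<Sum>v\<in>{0..<n}. of_nat v)"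
      by (rule sum.reindex_bij_witness[of _ int nat]) (auto simp: of_nat_nat)
    also have "\<dots> = of_nat n * (of_nat n - 1) / 2"
      by (induction n) (auto simp: field_simps)
    finally have S: "(\<Sum>j\<in>{1..n}. of_int (?N j)) = (of_nat n * (of_nat n - 1) / 2 :: 'a)" .
    \<comment> \<open>The summand 1/2 at j = l compensates \<open>cg_co i n l l\<close> = -1,
      because beta has no term with equal indices.\<close>
    have "(\<Sum>j\<in>{1..n}. rCG i n j j l m) = (\<Sum>j\<in>{1..n}. cg_co i n j l / 2 + (if j = l then 1/2 else (0::'a)))"
      using True by (intro sum.cong refl, subst rCG_eq[OF co]) (auto simp: root_prec_def cg_co_def)
    also have "\<dots> = (\<Sum>j\<in>{1..n}. -1/2 + of_int (?N j) / of_nat n) + 1/2"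
    proof -
      have "cg_co i n j l / 2 = -1/2 + (of_int (?N j) / of_nat n :: 'a)" for j
        by (simp add: cg_co_def add_divide_distrib)
      then show ?thesis using True by (simp only: sum.distrib) simp
    qed
    also have "\<dots> = 0"
      unfolding sum.distrib sum_divide_distrib[symmetric] S using i by (simp add: field_simps)
    finally show ?thesis .
  qed
  have supp: "rCG i n a b c d = (0::'a)" if "\<not> (a \<in> {1..n} \<and> b \<in> {1..n} \<and> c \<in> {1..n} \<and> d \<in> {1..n})" for a b c d
    by (rule rCG_supp) (use that in blast)
  show ?thesis unfolding W_def inR_iff
    by (intro CollectI conjI allI impI) (rule supp, assumption, rule skew, rule tr)
qed

text \<open>The conditional summand is half the Casimir. For c different from d it cancels the
  contribution of gamma or doubles it, and of the two order relations in alpha only one fits the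
  sign of d - c.\<close>

lemma rCG_pm:
  assumes co: "coprime i n" and R: "a \<in> {1..n}" "b \<in> {1..n}" "c \<in> {1..n}" "d \<in> {1..n}"
  shows "c < d \<Longrightarrow> rCG i n a b c d + (if a = d \<and> b = c then 1/2 else 0) = - (of_bool (root_prec i n c d b a) :: 'a::field_char_0)"
    "c < d \<Longrightarrow> rCG i n a b c d - (if a = d \<and> b = c then 1/2 else 0)
       = - of_bool (root_prec i n c d b a) - (of_bool (c = b \<and> d = a) :: 'a)"
    "d < c \<Longrightarrow> rCG i n a b c d + (if a = d \<and> b = c then 1/2 else 0)
       = of_bool (root_prec i n a b d c) + (of_bool (c = b \<and> d = a) :: 'a)"
    "d < c \<Longrightarrow> rCG i n a b c d - (if a = d \<and> b = c then 1/2 else 0) = (of_bool (root_prec i n a b d c) :: 'a)"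
proof -
  have F: "c < d \<Longrightarrow> \<not> root_prec i n a b d c" "d < c \<Longrightarrow> \<not> root_prec i n c d b a"
    by (simp_all add: root_prec_def)
  show "c < d \<Longrightarrow> rCG i n a b c d + (if a = d \<and> b = c then 1/2 else 0) = - (of_bool (root_prec i n c d b a) :: 'a)"
    "c < d \<Longrightarrow> rCG i n a b c d - (if a = d \<and> b = c then 1/2 else 0)
       = - of_bool (root_prec i n c d b a) - (of_bool (c = b \<and> d = a) :: 'a)"
    "d < c \<Longrightarrow> rCG i n a b c d + (if a = d \<and> b = c then 1/2 else 0)
       = of_bool (root_prec i n a b d c) + (of_bool (c = b \<and> d = a) :: 'a)"
    "d < c \<Longrightarrow> rCG i n a b c d - (if a = d \<and> b = c then 1/2 else 0) = (of_bool (root_prec i n a b d c) :: 'a)"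
    unfolding rCG_eq[OF co R] using F by (cases "c = b \<and> d = a"; auto)+
qed

text \<open>These are the zero blocks of the two parabolics: e_cd crosses n - i, which is no source,
  and its shift crosses i in the opposite direction, where i is no target.\<close>

lemma rCG_straddle:
  assumes i: "0 < i" "i < n" and co: "coprime i n"
    and R: "a \<in> {1..n}" "b \<in> {1..n}" "c \<in> {1..n}" "d \<in> {1..n}" and cd: "c \<le> n - i" "n - i < d"
  shows "rCG i n a b c d + (if a = d \<and> b = c then 1/2 else 0) = (0::'a::field_char_0)"
    "rCG i n a b (cgs i n c) (cgs i n d) - (if a = cgs i n d \<and> b = cgs i n c then 1/2 else 0) = (0::'a)"
proof -
  show "rCG i n a b c d + (if a = d \<and> b = c then 1/2 else 0) = (0::'a)"
    using rCG_pm(1)[OF co R, where ?'a='a] cd root_prec_not_straddle_left[OF cd] by simp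
  have "cgs i n d \<le> i" "i < cgs i n c" using cd R i by (auto simp: cgs_def)
  then show "rCG i n a b (cgs i n c) (cgs i n d) - (if a = cgs i n d \<and> b = cgs i n c then 1/2 else 0) = (0::'a)"
    using rCG_pm(4)[OF co R(1,2) cgs_in[OF i(2) R(3)] cgs_in[OF i(2) R(4)], where ?'a='a]
      root_prec_not_straddle_right[OF i(2)] by simp
qed

text \<open>Off the diagonal this is the recursion of the order along T, whose equality case comes
  from gamma and half the Casimir; on the diagonal it is the step of the beta coefficients. The 1/n
  term is a multiple of the identity in the first leg.\<close>

lemma rCG_levi:
  assumes i: "0 < i" "i < n" and co: "coprime i n"
    and R: "a \<in> {1..n}" "b \<in> {1..n}" "c \<in> {1..n}" "d \<in> {1..n}" and cd: "c \<le> n - i \<longleftrightarrow> d \<le> n - i"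
  shows "rCG i n a b c d + (if a = d \<and> b = c then 1/2 else 0)
    = rCG i n a b (cgs i n c) (cgs i n d) - (if a = cgs i n d \<and> b = cgs i n c then 1/2 else 0)
      + (if a = b \<and> c = d then 1 / of_nat n else (0::'a::field_char_0))"
proof -
  note R' = R(1,2) cgs_in[OF i(2) R(3)] cgs_in[OF i(2) R(4)]
  consider "c < d" | "d < c" | "c = d" by linarith
  then show ?thesis
  proof cases
    case 1
    note lt = cgs_less[OF i(2) R(3,4) 1 cd]
    have "of_bool (root_prec i n c d b a)
        = of_bool (root_prec i n (cgs i n c) (cgs i n d) b a) + (of_bool (cgs i n c = b \<and> cgs i n d = a) :: 'a)"
    proof (cases "b < a")
      case True
      then show ?thesis
        using root_prec_step_left[OF i R(3,4) 1 cd True] root_prec_irrefl[OF i(2) co, of b a] by auto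
    next
      case False
      then show ?thesis using lt by (auto simp: root_prec_def)
    qed
    then show ?thesis
      using 1 unfolding rCG_pm(1)[OF co R 1] rCG_pm(2)[OF co R' lt(1)] by simp
  next
    case 2
    note lt = cgs_less[OF i(2) R(4,3) 2 cd[symmetric]]
    have "of_bool (root_prec i n a b (cgs i n d) (cgs i n c))
        = of_bool (root_prec i n a b d c) + (of_bool (c = b \<and> d = a) :: 'a)"
    proof (cases "a < b")
      case True
      then show ?thesis
        using root_prec_step_right[OF i R(4,3) 2 cd[symmetric], of a b] root_prec_irrefl[OF i(2) co, of a b] R by auto
    next
      case False
      then show ?thesis using 2 by (auto simp: root_prec_def)
    qed
    then show ?thesis
      using 2 unfolding rCG_pm(3)[OF co R 2] rCG_pm(4)[OF co R' lt(1)] by simp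
  next
    case 3
    have refl: "cg_co i n j j = (-1 :: 'a)" for j by (simp add: cg_co_def)
    show ?thesis
    proof (cases "a = b")
      case True
      have p: "rCG i n a b c d + (if a = d \<and> b = c then 1/2 else 0) = cg_co i n a c / 2 + (if a = c then 1 else (0::'a))"
        unfolding rCG_eq[OF co R] using 3 True by (auto simp: root_prec_def refl)
      have q: "rCG i n a b (cgs i n c) (cgs i n d) - (if a = cgs i n d \<and> b = cgs i n c then 1/2 else 0)
          = (cg_co i n a (cgs i n c) / 2 :: 'a)"
        unfolding rCG_eq[OF co R'] using 3 True by (auto simp: root_prec_def refl)
      show ?thesis unfolding p q cg_co_cgs[OF i(2) co R(1,3)] using 3 True by simp
    next
      case False
      then show ?thesis unfolding rCG_eq[OF co R] rCG_eq[OF co R'] using 3 by (auto simp: root_prec_def)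
    qed
  qed
qed

lemma rop_pm:
  fixes x :: "'a::field_char_0 sqm"
  assumes "c \<in> {1..n}" "d \<in> {1..n}"
  shows "(rop n r x + mscale (1/2) x) c d
      = (\<Sum>a\<in>{1..n}. \<Sum>b\<in>{1..n}. x b a * (r a b c d + (if a = d \<and> b = c then 1/2 else 0)))"
    "(rop n r x - mscale (1/2) x) c d
      = (\<Sum>a\<in>{1..n}. \<Sum>b\<in>{1..n}. x b a * (r a b c d - (if a = d \<and> b = c then 1/2 else 0)))"
proof -
  have "(\<Sum>a\<in>{1..n}. \<Sum>b\<in>{1..n}. x b a * (if a = d \<and> b = c then 1/2 else 0))
      = (\<Sum>a\<in>{1..n}. \<Sum>b\<in>{1..n}. if b = c \<and> a = d then x b a / 2 else 0)"
    by (intro sum.cong refl) simp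
  also have "\<dots> = x c d / 2" using assms by (simp add: sum_delta_conj)
  finally have "(\<Sum>a\<in>{1..n}. \<Sum>b\<in>{1..n}. x b a * (if a = d \<and> b = c then 1/2 else 0)) = x c d / 2" .
  then show "(rop n r x + mscale (1/2) x) c d
      = (\<Sum>a\<in>{1..n}. \<Sum>b\<in>{1..n}. x b a * (r a b c d + (if a = d \<and> b = c then 1/2 else 0)))"
    "(rop n r x - mscale (1/2) x) c d
      = (\<Sum>a\<in>{1..n}. \<Sum>b\<in>{1..n}. x b a * (r a b c d - (if a = d \<and> b = c then 1/2 else 0)))"
    by (simp_all only: distrib_left right_diff_distrib sum.distrib sum_subtractf rop_def plus_fun_apply minus_apply mscale_apply) simp_all
qed

lemma rgraph_rCG:
  assumes i: "0 < i" "i < n" and co: "coprime i n"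
  shows "rgraph n (rCG i n :: 'a::field_char_0 tens2) (cgG i n)"
  unfolding rgraph_def cgG_def
proof (intro ballI conjI impI)
  fix x :: "'a sqm" and c d
  assume x: "x \<in> sl n" and cd: "c \<in> {1..n}" "d \<in> {1..n}"
  note cd' = cgs_in[OF i(2) cd(1)] cgs_in[OF i(2) cd(2)]
  { assume "c \<le> n - i" "n - i < d"
    then show "(rop n (rCG i n) x + mscale (1/2) x) c d = 0"
      "(rop n (rCG i n) x - mscale (1/2) x) (cgs i n c) (cgs i n d) = 0"
      unfolding rop_pm[OF cd] rop_pm[OF cd'] using rCG_straddle[OF i co _ _ cd, where ?'a='a]
      by (intro sum.neutral ballI; simp)+ }
  assume S: "c \<le> n - i \<longleftrightarrow> d \<le> n - i"
  have "(rop n (rCG i n) x + mscale (1/2) x) c d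
      = (rop n (rCG i n) x - mscale (1/2) x) (cgs i n c) (cgs i n d)
       + (\<Sum>a\<in>{1..n}. \<Sum>b\<in>{1..n}. x b a * (if a = b \<and> c = d then 1 / of_nat n else 0))"
    unfolding rop_pm[OF cd] rop_pm[OF cd'] sum.distrib[symmetric]
  proof (intro sum.cong refl)
    fix a b assume ab: "a \<in> {1..n}" "b \<in> {1..n}"
    show "x b a * (rCG i n a b c d + (if a = d \<and> b = c then 1 / 2 else 0)) =
       x b a * (rCG i n a b (cgs i n c) (cgs i n d) - (if a = cgs i n d \<and> b = cgs i n c then 1 / 2 else 0)) +
       x b a * (if a = b \<and> c = d then 1 / of_nat n else 0)"
      unfolding rCG_levi[OF i co ab cd S] by (simp only: distrib_left)
  qed
  \<comment> \<open>Contraction turns the discrepancy 1/n into tr x / n, and x is traceless.\<close>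
  also have "(\<Sum>a\<in>{1..n}. \<Sum>b\<in>{1..n}. x b a * (if a = b \<and> c = d then 1 / of_nat n else 0))
      = (\<Sum>a\<in>{1..n}. \<Sum>b\<in>{1..n}. if b = a \<and> c = d then x b a / of_nat n else 0)"
    by (intro sum.cong refl) auto
  also have "\<dots> = (if c = d then mtrace n x / of_nat n else 0)"
    by (auto simp: sum_delta_conj mtrace_def sum_divide_distrib intro!: sum.cong)
  also have "\<dots> = 0" using x by (simp add: sl_def)
  finally show "(rop n (rCG i n) x + mscale (1/2) x) c d
      = (rop n (rCG i n) x - mscale (1/2) x) (cgs i n c) (cgs i n d)" by simp
qed

section \<open>Conjugation\<close>

text \<open>An explicit two-sided inverse travels with g, since \<open>minv\<close> is a choice term
  that becomes computable only once an inverse is exhibited.\<close>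

definition mutual_inv :: "nat \<Rightarrow> 'a::comm_ring_1 sqm \<Rightarrow> 'a sqm \<Rightarrow> bool" where
  "mutual_inv n g h \<longleftrightarrow> msupp n g \<and> msupp n h \<and> mmul n g h = mid n \<and> mmul n h g = mid n"

lemma minv_eq: "mutual_inv n g h \<Longrightarrow> minv n g = h"
proof -
  assume M: "mutual_inv n g h"
  then have "\<exists>h. msupp n h \<and> mmul n g h = mid n"
    unfolding mutual_inv_def by blast
  then have "msupp n (minv n g) \<and> mmul n g (minv n g) = mid n"
    unfolding minv_def by (rule someI_ex)
  then have s: "msupp n (minv n g)" and e: "mmul n h (mmul n g (minv n g)) = h"
    using M by (simp_all add: mutual_inv_def)
  have "mmul n h (mmul n g (minv n g)) = minv n g"
    using M s by (simp add: mutual_inv_def mmul_assoc[symmetric])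
  with e show ?thesis by simp
qed

lemma mutual_inv_mmul:
  assumes "mutual_inv n g h" "mutual_inv n g' h'"
  shows "mutual_inv n (mmul n g g') (mmul n h' h)"
proof -
  have "mmul n (mmul n g g') (mmul n h' h) = mmul n g (mmul n (mmul n g' h') h)"
    "mmul n (mmul n h' h) (mmul n g g') = mmul n h' (mmul n (mmul n h g) g')"
    by (simp_all only: mmul_assoc)
  then show ?thesis using assms by (simp add: mutual_inv_def)
qed

definition conj_by :: "nat \<Rightarrow> 'a::comm_ring_1 sqm \<Rightarrow> 'a sqm \<Rightarrow> 'a sqm \<Rightarrow> 'a sqm" where
  "conj_by n g h x = mmul n g (mmul n x h)"

lemma msupp_conj_by [simp]: "msupp n (conj_by n g h x)"
  by (simp add: conj_by_def)

lemma conj_by_add: "conj_by n g h (x + y) = conj_by n g h x + conj_by n g h y"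
  and conj_by_diff: "conj_by n g h (x - y) = conj_by n g h x - conj_by n g h y"
  and conj_by_mscale: "conj_by n g h (mscale c x) = mscale c (conj_by n g h x)"
  by (simp_all add: conj_by_def mmul_add_left mmul_add_right mmul_diff_left mmul_diff_right
      mmul_mscale_left mmul_mscale_right)

lemma conj_by_inv:
  "mutual_inv n g h \<Longrightarrow> msupp n x \<Longrightarrow> conj_by n h g (conj_by n g h x) = x"
proof -
  assume "mutual_inv n g h" "msupp n x"
  moreover have "conj_by n h g (conj_by n g h x) = mmul n (mmul n h g) (mmul n x (mmul n h g))"
    by (simp only: conj_by_def mmul_assoc)
  ultimately show ?thesis by (simp add: mutual_inv_def)
qed

lemma conj_by_mmul:
  assumes "mutual_inv n g h" "msupp n x" "msupp n y"
  shows "conj_by n h g (mmul n x y) = mmul n (conj_by n h g x) (conj_by n h g y)"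
proof -
  have "mmul n (conj_by n h g x) (conj_by n h g y) = mmul n h (mmul n x (mmul n (mmul n g h) (mmul n y g)))"
    by (simp only: conj_by_def mmul_assoc)
  also have "\<dots> = conj_by n h g (mmul n x y)"
    using assms by (simp add: mutual_inv_def conj_by_def mmul_assoc)
  finally show ?thesis ..
qed

lemma mtrace_conj_by:
  assumes "mutual_inv n g h" "msupp n x"
  shows "mtrace n (conj_by n h g x) = mtrace n x"
proof -
  have "mtrace n (conj_by n h g x) = mtrace n (mmul n (mmul n x g) h)"
    unfolding conj_by_def by (rule mtrace_mmul_comm)
  also have "mmul n (mmul n x g) h = mmul n x (mmul n g h)" by (simp only: mmul_assoc)
  finally show ?thesis using assms by (simp add: mutual_inv_def)
qed

lemma conj_by_in_sl: "mutual_inv n g h \<Longrightarrow> x \<in> sl n \<Longrightarrow> conj_by n h g x \<in> sl n"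
  by (simp add: sl_def mtrace_conj_by)

lemma act_apply:
  assumes "mutual_inv n g h" "a \<in> {1..n}" "b \<in> {1..n}" "c \<in> {1..n}" "d \<in> {1..n}"
  shows "act n g T a b c d = (\<Sum>j\<in>{1..n}. \<Sum>k\<in>{1..n}. \<Sum>l\<in>{1..n}. \<Sum>m\<in>{1..n}.
          g a j * T j k l m * h k b * g c l * h m d)"
  using assms by (simp add: act_def minv_eq)

lemma act_supp:
  assumes "a \<notin> {1..n} \<or> b \<notin> {1..n} \<or> c \<notin> {1..n} \<or> d \<notin> {1..n}"
  shows "act n g T a b c d = 0"
proof -
  have "\<not> (inR n a \<and> inR n b \<and> inR n c \<and> inR n d)" using assms unfolding inR_iff by blast
  then show ?thesis unfolding act_def Let_def by (simp only: if_False)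
qed

text \<open>Invariance of the trace form under conjugation moves g from the contracted leg onto the
  argument x.\<close>

lemma rop_act:
  assumes M: "mutual_inv n g h"
  shows "rop n (act n g T) x = conj_by n g h (rop n T (conj_by n h g x))"
proof (intro ext)
  fix c d
  show "rop n (act n g T) x c d = conj_by n g h (rop n T (conj_by n h g x)) c d"
  proof (cases "c \<in> {1..n} \<and> d \<in> {1..n}")
    case True
    then have cd: "c \<in> {1..n}" "d \<in> {1..n}" by auto
    let ?F = "\<lambda>a b j k l m. x b a * (g a j * T j k l m * h k b * g c l * h m d)"
    have "rop n (act n g T) x c d
        = (\<Sum>a\<in>{1..n}. \<Sum>b\<in>{1..n}. \<Sum>j\<in>{1..n}. \<Sum>k\<in>{1..n}. \<Sum>l\<in>{1..n}. \<Sum>m\<in>{1..n}. ?F a b j k l m)"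
      unfolding rop_def by (intro sum.cong refl) (simp add: act_apply[OF M _ _ cd] sum_distrib_left)
    also have "\<dots> = (\<Sum>j\<in>{1..n}. \<Sum>k\<in>{1..n}. \<Sum>a\<in>{1..n}. \<Sum>b\<in>{1..n}. \<Sum>l\<in>{1..n}. \<Sum>m\<in>{1..n}. ?F a b j k l m)"
      by (rule sum_swap_pairs)
    also have "\<dots> = (\<Sum>j\<in>{1..n}. \<Sum>k\<in>{1..n}. \<Sum>l\<in>{1..n}. \<Sum>m\<in>{1..n}. \<Sum>a\<in>{1..n}. \<Sum>b\<in>{1..n}. ?F a b j k l m)"
      by (intro sum.cong refl sum_swap_pairs)
    also have "\<dots> = (\<Sum>l\<in>{1..n}. \<Sum>m\<in>{1..n}. \<Sum>j\<in>{1..n}. \<Sum>k\<in>{1..n}. \<Sum>a\<in>{1..n}. \<Sum>b\<in>{1..n}. ?F a b j k l m)"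
      by (rule sum_swap_pairs)
    also have "\<dots> = (\<Sum>l\<in>{1..n}. \<Sum>m\<in>{1..n}. \<Sum>j\<in>{1..n}. \<Sum>k\<in>{1..n}. \<Sum>b\<in>{1..n}. \<Sum>a\<in>{1..n}. ?F a b j k l m)"
      by (rule sum.cong[OF refl], rule sum.cong[OF refl], rule sum.cong[OF refl], rule sum.cong[OF refl], rule sum.swap)
    also have "\<dots> = (\<Sum>l\<in>{1..n}. g c l * (\<Sum>m\<in>{1..n}. (\<Sum>j\<in>{1..n}. \<Sum>k\<in>{1..n}.
        (\<Sum>b\<in>{1..n}. h k b * (\<Sum>a\<in>{1..n}. x b a * g a j)) * T j k l m) * h m d))"
      by (simp add: sum_distrib_left sum_distrib_right mult_ac)
    also have "\<dots> = conj_by n g h (rop n T (conj_by n h g x)) c d"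
      using cd by (simp add: conj_by_def mmul_def rop_def cong: sum.cong_simp)
    finally show ?thesis .
  next
    case False
    have "act n g T a b c d = 0" for a b
      by (rule act_supp) (use False in blast)
    then have "rop n (act n g T) x c d = 0" by (simp add: rop_def)
    moreover have "conj_by n g h (rop n T (conj_by n h g x)) c d = 0"
      using False by (intro msuppD[of n]) auto
    ultimately show ?thesis by simp
  qed
qed

lemma act_in_W:
  assumes M: "mutual_inv n g h" and T: "T \<in> W n"
  shows "act n g T \<in> W n"
proof -
  have supp: "act n g T a b c d = 0" if "\<not> (a \<in> {1..n} \<and> b \<in> {1..n} \<and> c \<in> {1..n} \<and> d \<in> {1..n})" for a b c d
    by (rule act_supp) (use that in blast)
  have skew: "act n g T a b c d = - act n g T c d a b" for a b c d
  proof (cases "a \<in> {1..n} \<and> b \<in> {1..n} \<and> c \<in> {1..n} \<and> d \<in> {1..n}")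
    case True
    then have R: "a \<in> {1..n}" "b \<in> {1..n}" "c \<in> {1..n}" "d \<in> {1..n}" by auto
    have "act n g T a b c d = (\<Sum>l\<in>{1..n}. \<Sum>m\<in>{1..n}. \<Sum>j\<in>{1..n}. \<Sum>k\<in>{1..n}.
          g a j * T j k l m * h k b * g c l * h m d)"
      unfolding act_apply[OF M R] by (rule sum_swap_pairs)
    also have "\<dots> = (\<Sum>l\<in>{1..n}. \<Sum>m\<in>{1..n}. \<Sum>j\<in>{1..n}. \<Sum>k\<in>{1..n}.
          - (g c l * T l m j k * h m d * g a j * h k b))"
    proof (intro sum.cong refl)
      fix j k l m
      show "g a j * T j k l m * h k b * g c l * h m d = - (g c l * T l m j k * h m d * g a j * h k b)"
        by (subst W_skew[OF T]) (simp add: mult_ac)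
    qed
    also have "\<dots> = - act n g T c d a b"
      unfolding act_apply[OF M R(3,4,1,2)] by (simp only: sum_negf)
    finally show ?thesis .
  next
    case False
    then have "act n g T a b c d = 0" "act n g T c d a b = 0" by (blast intro: supp)+
    then show ?thesis by simp
  qed
  have tr: "(\<Sum>j\<in>{1..n}. act n g T j j c d) = 0" for c d
  proof -
    have "(\<Sum>j\<in>{1..n}. act n g T j j c d) = rop n (act n g T) (mid n) c d"
      unfolding rop_def mid_def
      by (rule sum.cong) (auto simp: if_distrib[of "\<lambda>x. x * _"] sum.delta cong: if_cong)
    also have "\<dots> = conj_by n g h (rop n T (mid n)) c d"
      using M by (simp add: rop_act[OF M] conj_by_def[of n h] mutual_inv_def)
    also have "\<dots> = 0" by (simp add: rop_mid[OF T] conj_by_def mmul_def)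
    finally show ?thesis .
  qed
  show ?thesis unfolding W_def inR_iff
    by (intro CollectI conjI allI impI) (rule supp, assumption, rule skew, rule tr)
qed

text \<open>The image of G under simultaneous conjugation by g, expressed through the inverse h. The
  support conditions are added because conjugation sees only the entries with indices in
  1..n.\<close>

definition conjG :: "nat \<Rightarrow> 'a::field_char_0 sqm \<Rightarrow> 'a sqm \<Rightarrow> ('a sqm \<Rightarrow> 'a sqm \<Rightarrow> bool) \<Rightarrow> 'a sqm \<Rightarrow> 'a sqm \<Rightarrow> bool" where
  "conjG n g h G a b \<longleftrightarrow> msupp n a \<and> msupp n b \<and> G (conj_by n h g a) (conj_by n h g b)"

lemma manin_conjG:
  assumes M: "mutual_inv n g h" and G: "manin n G"
  shows "manin n (conjG n g h G)"
  unfolding manin_def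
proof (intro allI impI conjI)
  fix a b a' b' assume 1: "conjG n g h G a b" and 2: "conjG n g h G a' b'"
  have c: "conj_by n h g (mbr n x y) = mbr n (conj_by n h g x) (conj_by n h g y)" if "msupp n x" "msupp n y" for x y
    using that by (simp add: mbr_def conj_by_diff conj_by_mmul[OF M])
  show "conjG n g h G (mbr n a a') (mbr n b b')"
    using 1 2 G unfolding conjG_def manin_def by (simp add: c)
  have t: "mtrace n (mmul n (conj_by n h g x) (conj_by n h g y)) = mtrace n (mmul n x y)" if "msupp n x" "msupp n y" for x y
    using that by (simp add: conj_by_mmul[OF M, symmetric] mtrace_conj_by[OF M])
  have "mtrace n (mmul n (conj_by n h g a) (conj_by n h g a')) = mtrace n (mmul n (conj_by n h g b) (conj_by n h g b'))"
    using 1 2 G unfolding conjG_def manin_def by blast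
  then show "mtrace n (mmul n a a') = mtrace n (mmul n b b')"
    using 1 2 t unfolding conjG_def by simp
qed

lemma rgraph_act:
  assumes M: "mutual_inv n g h" and T: "T \<in> W n" "rgraph n T G"
  shows "rgraph n (act n g T) (conjG n g h G)"
  unfolding rgraph_def
proof
  fix x :: "'a sqm" assume x: "x \<in> sl n"
  have s: "msupp n (rop n T y)" for y by (rule msupp_rop[OF T(1)])
  have "conj_by n h g (rop n (act n g T) x) = rop n T (conj_by n h g x)"
    unfolding rop_act[OF M] by (rule conj_by_inv[OF M s])
  then have "conj_by n h g (rop n (act n g T) x + mscale (1/2) x) = rop n T (conj_by n h g x) + mscale (1/2) (conj_by n h g x)"
    "conj_by n h g (rop n (act n g T) x - mscale (1/2) x) = rop n T (conj_by n h g x) - mscale (1/2) (conj_by n h g x)"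
    by (simp_all add: conj_by_add conj_by_diff conj_by_mscale)
  moreover have "msupp n (rop n (act n g T) x)" by (simp add: rop_act[OF M])
  ultimately show "conjG n g h G (rop n (act n g T) x + mscale (1/2) x) (rop n (act n g T) x - mscale (1/2) x)"
    using T(2) conj_by_in_sl[OF M x] sl_msupp[OF x] unfolding conjG_def rgraph_def by simp
qed

section \<open>The conjugated subalgebra\<close>

text \<open>Matrices that preserve V, the span of the first i basis vectors.\<close>

definition btri :: "nat \<Rightarrow> nat \<Rightarrow> 'a::zero sqm \<Rightarrow> bool" where
  "btri i n A \<longleftrightarrow> (\<forall>c\<in>{i<..n}. \<forall>d\<in>{1..i}. A c d = 0)"

text \<open>Equality of the induced maps from F^n to F^n/V.\<close>

definition eqlow :: "nat \<Rightarrow> nat \<Rightarrow> 'a sqm \<Rightarrow> 'a sqm \<Rightarrow> bool" where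
  "eqlow i n A B \<longleftrightarrow> (\<forall>c\<in>{i<..n}. \<forall>d\<in>{1..n}. A c d = B c d)"

lemma btri_mmul: "btri i n A \<Longrightarrow> btri i n B \<Longrightarrow> btri i n (mmul n A B)"
  unfolding btri_def mmul_def
  by (auto intro!: sum.neutral) (metis atLeastAtMost_iff greaterThanAtMost_iff linorder_not_le mult_zero_left mult_zero_right)

lemma eqlow_trans [trans]: "eqlow i n A B \<Longrightarrow> eqlow i n B C \<Longrightarrow> eqlow i n A C"
  and eqlow_sym: "eqlow i n A B \<Longrightarrow> eqlow i n B A"
  unfolding eqlow_def by auto

lemma eqlow_mmul_right: "eqlow i n A B \<Longrightarrow> eqlow i n (mmul n A C) (mmul n B C)"
  unfolding eqlow_def by (auto simp: mmul_def intro!: sum.cong)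

text \<open>A matrix preserving V descends to F^n/V, so it may be applied on the left of an equality
  modulo V.\<close>

lemma eqlow_mmul_left:
  assumes "btri i n M" "eqlow i n A B"
  shows "eqlow i n (mmul n M A) (mmul n M B)"
  unfolding eqlow_def
proof (intro ballI)
  fix c d assume cd: "c \<in> {i<..n}" "d \<in> {1..n}"
  have "M c x * A x d = M c x * B x d" if "x \<in> {1..n}" for x
    using assms cd that unfolding btri_def eqlow_def by (cases "x \<le> i") auto
  then show "mmul n M A c d = mmul n M B c d"
    using cd by (auto simp: mmul_def intro!: sum.cong)
qed

text \<open>The map N taking e_d to e_(d+i), with kernel U spanned by the last i basis vectors;
  modulo V it gives the isomorphism of F^n/U with F^n/V.\<close>

definition shiftN :: "nat \<Rightarrow> nat \<Rightarrow> 'a::comm_ring_1 sqm" where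
  "shiftN i n = (\<lambda>c d. if c = d + i \<and> c \<in> {1..n} \<and> d \<in> {1..n} then 1 else 0)"

lemma msupp_shiftN [simp]: "msupp n (shiftN i n)"
  by (auto simp: msupp_def shiftN_def)

lemma shiftN_mmul:
  assumes "c \<in> {i<..n}" "d \<in> {1..n}"
  shows "mmul n (shiftN i n) A c d = A (c - i) d"
proof -
  have c: "c \<in> {1..n}" using assms by auto
  have "mmul n (shiftN i n) A c d = (\<Sum>x\<in>{1..n}. if x = c - i then A x d else 0)"
    unfolding mmul_apply[OF c assms(2)]
    by (intro sum.cong refl) (use assms in \<open>auto simp: shiftN_def\<close>)
  also have "\<dots> = A (c - i) d" using assms by (subst sum.delta) auto
  finally show ?thesis .
qed

lemma mmul_shiftN:
  assumes "c \<in> {1..n}" "d \<in> {1..n}"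
  shows "mmul n A (shiftN i n) c d = (if d + i \<le> n then A c (d + i) else 0)"
proof -
  have "mmul n A (shiftN i n) c d = (\<Sum>x\<in>{1..n}. if x = d + i then A c x else 0)"
    unfolding mmul_apply[OF assms]
    by (intro sum.cong refl) (use assms in \<open>auto simp: shiftN_def\<close>)
  also have "\<dots> = (if d + i \<le> n then A c (d + i) else 0)" using assms by (subst sum.delta) auto
  finally show ?thesis .
qed

text \<open>Unit shift minus identity, a forward difference on rows. It is left infinite, since the
  products \<open>mmul i\<close> see only its i x i corner.\<close>

definition opD :: "'a::comm_ring_1 sqm" where
  "opD = (\<lambda>c d. (if d = c + 1 then 1 else 0) - (if d = c then 1 else 0))"

lemma opD_mmul:
  assumes "c \<in> {1..i}" "d \<in> {1..i}"
  shows "mmul i opD A c d = (if c < i then A (c + 1) d else 0) - A c d"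
proof -
  have "mmul i opD A c d = (\<Sum>x\<in>{1..i}. if x = c + 1 then A x d else 0) - (\<Sum>x\<in>{1..i}. if x = c then A x d else 0)"
    using assms unfolding sum_subtractf[symmetric] by (auto simp: mmul_def opD_def intro!: sum.cong)
  then show ?thesis using assms by (simp add: sum.delta)
qed

lemma mmul_opD:
  assumes "c \<in> {1..i}" "d \<in> {1..i}"
  shows "mmul i A opD c d = (if 1 < d then A c (d - 1) else 0) - A c d"
proof -
  have "mmul i A opD c d = (\<Sum>x\<in>{1..i}. if x = d - 1 then A c x else 0) - (\<Sum>x\<in>{1..i}. if x = d then A c x else 0)"
    using assms unfolding sum_subtractf[symmetric] by (auto simp: mmul_def opD_def intro!: sum.cong)
  moreover have "(1 \<le> d - 1 \<and> d - 1 \<le> i) \<longleftrightarrow> 1 < d" using assms by auto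
  ultimately show ?thesis using assms by (simp add: sum.delta)
qed

text \<open>Back substitution starting from row i, where the difference is just -A.\<close>

lemma opD_inj:
  assumes "msupp i A" "mmul i opD A = 0"
  shows "A = 0"
proof -
  have "A (i - k) d = 0" for k d
  proof (cases "d \<in> {1..i}")
    case d: True
    show ?thesis
    proof (induction k)
      case 0
      show ?case
      proof (cases "i = 0")
        case False
        then have "mmul i opD A i d = - A i d" using d by (subst opD_mmul) auto
        then show ?thesis using assms(2) by simp
      qed (use d in auto)
    next
      case (Suc k)
      show ?case
      proof (cases "Suc k < i")
        case True
        then have "mmul i opD A (i - Suc k) d = A (i - Suc k + 1) d - A (i - Suc k) d"
          using d by (subst opD_mmul) auto
        moreover have "i - Suc k + 1 = i - k" using True by simp
        ultimately show ?thesis using assms(2) Suc by simp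
      next
        case False
        then show ?thesis using assms(1) by (intro msuppD[of i]) auto
      qed
    qed
  next
    case False
    then show ?thesis using assms(1) by (intro msuppD[of i]) auto
  qed
  then have "A c d = 0" if "c \<le> i" for c d using that by (metis diff_diff_cancel)
  moreover have "A c d = 0" if "\<not> c \<le> i" for c d using that assms(1) by (intro msuppD[of i]) auto
  ultimately show ?thesis by (intro ext) (metis zero_fun_apply)
qed

definition res :: "nat \<Rightarrow> 'a::zero sqm \<Rightarrow> 'a sqm" where
  "res i A = (\<lambda>c d. if c \<in> {1..i} \<and> d \<in> {1..i} then A c d else 0)"

lemma msupp_res [simp]: "msupp i (res i A)"
  by (auto simp: msupp_def res_def)

lemma mmul_res [simp]: "mmul i (res i A) B = mmul i A B" "mmul i A (res i B) = mmul i A B"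
  by (intro ext; auto simp: mmul_def res_def intro!: sum.cong)+

text \<open>The image of \<open>cgG\<close> under conjugation by \<open>phi_g\<close>: the shift \<open>N\<close> gluing the quotients is
  replaced by \<open>1 + N\<close>, the identification of the subspaces by \<open>opD\<close> or its inverse.\<close>

definition ratG :: "bool \<Rightarrow> nat \<Rightarrow> nat \<Rightarrow> 'a::field_char_0 sqm \<Rightarrow> 'a sqm \<Rightarrow> bool" where
  "ratG pl i n a b \<longleftrightarrow> btri i n b
     \<and> eqlow i n (mmul n (shiftN i n) a + a) (mmul n b (shiftN i n) + b)
     \<and> (\<exists>\<beta>. (\<forall>c\<in>{1..i}. \<forall>d\<in>{1..n}. a c d = \<beta> c d + \<beta> c (d + i)) \<and> (\<forall>c\<in>{1..i}. \<forall>d>n. \<beta> c d = 0)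
          \<and> (if pl then mmul i opD \<beta> = mmul i b opD else mmul i \<beta> opD = mmul i opD b))"

text \<open>What conjugation by g has to achieve: modulo V it intertwines N with 1 + N, and the
  first i rows of its last i columns are tied to its leading block by opD up to a scalar, which
  drops out under conjugation.\<close>

locale gauge =
  fixes pl :: bool and i n :: nat and g h :: "'a::field_char_0 sqm" and lam :: 'a
  assumes i: "0 < i" "i < n"
    and M: "mutual_inv n g h"
    and gtri: "btri i n g" and htri: "btri i n h"
    and gN: "eqlow i n (mmul n (shiftN i n) g + g) (mmul n g (shiftN i n))"
    and lam: "lam \<noteq> 0"
    and gU: "if pl then res i g = mscale lam (mmul i opD (\<lambda>c s. g c (s + (n - i))))
             else mmul i opD g = mscale lam (res i (\<lambda>c s. g c (s + (n - i))))"
begin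

text \<open>Modulo V one has g N a' = (1 + N) g a' = (1 + N) a g = b (1 + N) g = b g N = g b' N, and
  h cancels g because it preserves V. The blocks on U and V are compared through \<beta> and the opD
  condition.\<close>

lemma ratG_conj:
  assumes s: "msupp n a" "msupp n b" and R: "ratG pl i n a b"
  shows "cgG i n (conj_by n h g a) (conj_by n h g b)"
proof -
  define a' b' where "a' = conj_by n h g a" and "b' = conj_by n h g b"
  have sg: "msupp n g" "msupp n h" and gh: "mmul n g h = mid n" "mmul n h g = mid n"
    using M by (auto simp: mutual_inv_def)
  have ga: "mmul n g a' = mmul n a g" and gb: "mmul n g b' = mmul n b g"
    using s by (simp_all add: a'_def b'_def conj_by_def mmul_assoc[symmetric] gh)
  have sa: "msupp n a'" "msupp n b'" by (simp_all add: a'_def b'_def)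
  have bt: "btri i n b" and lowab: "eqlow i n (mmul n (shiftN i n) a + a) (mmul n b (shiftN i n) + b)"
    using R by (auto simp: ratG_def)
  have b't: "btri i n b'"
    unfolding b'_def conj_by_def by (intro btri_mmul htri bt gtri)
  let ?N = "shiftN i n :: 'a sqm"
  have "eqlow i n (mmul n g (mmul n ?N a')) (mmul n (mmul n ?N g + g) a')"
    using eqlow_mmul_right[OF eqlow_sym[OF gN], of a'] by (simp add: mmul_assoc)
  also have "mmul n (mmul n ?N g + g) a' = mmul n (mmul n ?N a + a) g"
    by (simp add: mmul_add_left mmul_assoc ga)
  also have "eqlow i n (mmul n (mmul n ?N a + a) g) (mmul n (mmul n b ?N + b) g)"
    by (rule eqlow_mmul_right[OF lowab])
  also have "mmul n (mmul n b ?N + b) g = mmul n b (mmul n ?N g + g)"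
    by (simp add: mmul_add_left mmul_add_right mmul_assoc)
  also have "eqlow i n (mmul n b (mmul n ?N g + g)) (mmul n b (mmul n g ?N))"
    by (rule eqlow_mmul_left[OF bt gN])
  also have "mmul n b (mmul n g ?N) = mmul n g (mmul n b' ?N)"
    by (simp add: mmul_assoc[symmetric] gb)
  finally have "eqlow i n (mmul n h (mmul n g (mmul n ?N a'))) (mmul n h (mmul n g (mmul n b' ?N)))"
    by (rule eqlow_mmul_left[OF htri])
  moreover have "mmul n h (mmul n g X) = X" if "msupp n X" for X
    using that by (simp add: mmul_assoc[symmetric] gh)
  ultimately have low: "eqlow i n (mmul n ?N a') (mmul n b' ?N)"
    by simp
  \<comment> \<open>Written in entries, N a' = b' N modulo V yields both the zero block of a' and
    the matching of the two quotient blocks.\<close>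
  have shift: "a' (c - i) d = (if d + i \<le> n then b' c (d + i) else 0)" if "c \<in> {i<..n}" "d \<in> {1..n}" for c d
    using low that shiftN_mmul[OF that, of a'] mmul_shiftN[of c n d b' i] unfolding eqlow_def by auto
  have shift': "a' c d = (if d + i \<le> n then b' (c + i) (d + i) else 0)" if "c \<in> {1..n-i}" "d \<in> {1..n}" for c d
    using shift[of "c + i" d] that by auto
  define A where "A = (\<lambda>c s. a' (c + (n - i)) (s + (n - i)))"
  define G1 where "G1 = (\<lambda>c s. g c (s + (n - i)))"
  \<comment> \<open>The first i columns of \<beta> form the matrix of a on ker(1 + N) modulo V. A
    vector of this kernel alternates in sign along each residue class modulo i, hence is given by
    its first i coordinates.\<close>
  obtain \<beta> where \<beta>: "\<And>c d. c \<in> {1..i} \<Longrightarrow> d \<in> {1..n} \<Longrightarrow> a c d = \<beta> c d + \<beta> c (d + i)"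
      "\<And>c d. c \<in> {1..i} \<Longrightarrow> d > n \<Longrightarrow> \<beta> c d = 0"
      "if pl then mmul i opD \<beta> = mmul i b opD else mmul i \<beta> opD = mmul i opD b"
    using R unfolding ratG_def by blast
  have split: "(\<Sum>x\<in>{1..n}. f x) = (\<Sum>x\<in>{1..i}. f x) + (\<Sum>x\<in>{i<..n}. f x)" for f :: "nat \<Rightarrow> 'a"
  proof -
    have "{1..n} = {1..i} \<union> {i<..n}" using i by auto
    moreover have "{1..i} \<inter> {i<..n} = {}" by auto
    ultimately show ?thesis by (simp only: sum.union_disjoint finite_atLeastAtMost finite_greaterThanAtMost)
  qed
  have agU: "mmul i \<beta> G1 = mmul i G1 A"
  proof (intro ext)
    fix c s
    show "mmul i \<beta> G1 c s = mmul i G1 A c s"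
    proof (cases "c \<in> {1..i} \<and> s \<in> {1..i}")
      case True
      define u where "u = s + (n - i)"
      have u: "u \<in> {1..n}" "n < u + i" and c: "c \<in> {1..i}" "c \<in> {1..n}" using True i by (auto simp: u_def)
      \<comment> \<open>N kills e_u for the last i indices u, so column u of g lies in the kernel of
        1 + N modulo V.\<close>
      have gu: "g (x - i) u + g x u = 0" if "x \<in> {i<..n}" for x
      proof -
        have "(mmul n ?N g + g) x u = mmul n g ?N x u" using gN that u unfolding eqlow_def by blast
        moreover have "mmul n g ?N x u = 0" using mmul_shiftN[of x n u g i] that u by auto
        ultimately show ?thesis using shiftN_mmul[OF that u(1), of g] by simp
      qed
      have "mmul n a g c u = (\<Sum>x\<in>{1..n}. \<beta> c x * g x u) + (\<Sum>x\<in>{1..n}. \<beta> c (x + i) * g x u)"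
        using u c by (simp add: mmul_apply \<beta>(1)[OF c(1)] distrib_right sum.distrib[symmetric] cong: sum.cong_simp)
      also have "(\<Sum>x\<in>{1..n}. \<beta> c (x + i) * g x u) = (\<Sum>x\<in>{1..n-i}. \<beta> c (x + i) * g x u)"
        using c \<beta>(2) by (intro sum.mono_neutral_right) auto
      also have "\<dots> = (\<Sum>x\<in>{i<..n}. \<beta> c x * g (x - i) u)"
        by (rule sum.reindex_bij_witness[of _ "\<lambda>x. x - i" "\<lambda>x. x + i"]) auto
      also have "(\<Sum>x\<in>{1..n}. \<beta> c x * g x u) + (\<Sum>x\<in>{i<..n}. \<beta> c x * g (x - i) u)
          = (\<Sum>x\<in>{1..i}. \<beta> c x * g x u) + (\<Sum>x\<in>{i<..n}. \<beta> c x * (g (x - i) u + g x u))"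
        unfolding split by (simp add: distrib_left sum.distrib)
      also have "\<dots> = mmul i \<beta> G1 c s"
        using True gu by (simp add: mmul_apply G1_def u_def)
      finally have 1: "mmul n a g c u = mmul i \<beta> G1 c s" .
      have "mmul n g a' c u = (\<Sum>x\<in>{1..n}. g c x * a' x u)" using u c by (simp add: mmul_apply)
      also have "\<dots> = (\<Sum>x\<in>{n-i<..n}. g c x * a' x u)"
        using shift'[of _ u] u by (intro sum.mono_neutral_right) auto
      also have "\<dots> = (\<Sum>x\<in>{1..i}. g c (x + (n - i)) * a' (x + (n - i)) u)"
        using i by (intro sum.reindex_bij_witness[of _ "\<lambda>x. x + (n - i)" "\<lambda>x. x - (n - i)"]) auto
      also have "\<dots> = mmul i G1 A c s" using True by (simp add: mmul_apply G1_def A_def u_def)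
      finally show ?thesis using 1 ga by simp
    qed (auto simp: mmul_def)
  qed
  have bg: "mmul i b g = mmul i g b'"
  proof (intro ext)
    fix c s
    show "mmul i b g c s = mmul i g b' c s"
    proof (cases "c \<in> {1..i} \<and> s \<in> {1..i}")
      case True
      then have cs: "c \<in> {1..n}" "s \<in> {1..n}" using i by auto
      have "mmul n b g c s = mmul i b g c s"
        using True gtri unfolding mmul_apply[OF cs] split btri_def by (simp add: mmul_apply)
      moreover have "mmul n g b' c s = mmul i g b' c s"
        using True b't unfolding mmul_apply[OF cs] split btri_def by (simp add: mmul_apply)
      ultimately show ?thesis using gb by simp
    qed (auto simp: mmul_def)
  qed
  \<comment> \<open>As g preserves V, the leading block of h g is the product of the leading
    blocks.\<close>
  have hg: "mmul i h g = mid i"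
  proof (intro ext)
    fix c s
    show "mmul i h g c s = mid i c s"
    proof (cases "c \<in> {1..i} \<and> s \<in> {1..i}")
      case True
      then have cs: "c \<in> {1..n}" "s \<in> {1..n}" using i by auto
      have "mmul n h g c s = mmul i h g c s"
        using True gtri unfolding mmul_apply[OF cs] split btri_def by (simp add: mmul_apply)
      then show ?thesis using gh True cs by (simp add: mid_def)
    next
      case False
      have "mmul i h g c s = 0" by (rule msuppD[OF msupp_mmul]) (use False in blast)
      moreover have "mid i c s = (0::'a)" by (rule msuppD[OF msupp_mid]) (use False in blast)
      ultimately show ?thesis by simp
    qed
  qed
  \<comment> \<open>The scalar \<open>lam\<close> is taken out by one use of the gauge condition and
    put back by the next; in the second case opD is cancelled by injectivity.\<close>
  have gA: "mmul i g A = mmul i g b'"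
  proof (cases pl)
    case True
    have "mmul i g b' = mmul i b (res i g)" by (simp only: bg mmul_res)
    also have "\<dots> = mscale lam (mmul i (mmul i b opD) G1)"
      using gU True by (simp only: G1_def if_True mmul_mscale_right mmul_assoc)
    also have "\<dots> = mscale lam (mmul i opD (mmul i \<beta> G1))"
      using \<beta>(3) True by (simp add: mmul_assoc[symmetric])
    also have "\<dots> = mmul i (mscale lam (mmul i opD G1)) A"
      by (simp add: agU mmul_mscale_left mmul_assoc)
    also have "\<dots> = mmul i (res i g) A"
      using gU True by (simp only: G1_def if_True)
    finally show ?thesis by simp
  next
    case False
    have DG: "mmul i opD g = mscale lam (res i G1)" using gU False by (simp add: G1_def)
    have "mmul i opD (mmul i g b') = mmul i (mmul i opD b) g" by (simp add: bg[symmetric] mmul_assoc)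
    also have "\<dots> = mmul i \<beta> (mmul i opD g)" using \<beta>(3) False by (simp add: mmul_assoc[symmetric])
    also have "\<dots> = mmul i (mmul i opD g) A"
      unfolding DG by (simp add: mmul_mscale_left mmul_mscale_right agU)
    finally have "mmul i opD (mmul i g A - mmul i g b') = 0"
      by (simp add: mmul_diff_right mmul_assoc)
    then have "mmul i g A - mmul i g b' = 0" by (rule opD_inj[rotated]) simp
    then show ?thesis by simp
  qed
  have Ab: "res i A = res i b'"
  proof -
    have e: "mmul i (mid i) X = res i X" for X :: "'a sqm"
      using mmul_mid_left[OF msupp_res, of i X] by simp
    have "mmul i (mmul i h g) A = mmul i (mmul i h g) b'"
      by (simp add: mmul_assoc gA)
    then show ?thesis by (simp add: hg e)
  qed
  have A_eq: "a' c d = b' (c + i - n) (d + i - n)" if "c \<in> {n-i<..n}" "d \<in> {n-i<..n}" for c d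
  proof -
    have "res i A (c + i - n) (d + i - n) = res i b' (c + i - n) (d + i - n)" by (simp add: Ab)
    then show ?thesis using that i by (auto simp: res_def A_def split: if_splits)
  qed
  show ?thesis
    unfolding a'_def[symmetric] b'_def[symmetric] cgG_def
  proof (intro ballI conjI impI)
    fix c d assume cd: "c \<in> {1..n}" "d \<in> {1..n}"
    { assume L: "c \<le> n - i" "n - i < d"
      then show "a' c d = 0" using cd shift'[of c d] by auto
      have "c + i \<in> {i<..n}" "d + i - n \<in> {1..i}" using L cd i by auto
      then have "b' (c + i) (d + i - n) = 0" using b't unfolding btri_def by blast
      then show "b' (cgs i n c) (cgs i n d) = 0" using L by (simp add: cgs_def) }
    assume "c \<le> n - i \<longleftrightarrow> d \<le> n - i"
    then show "a' c d = b' (cgs i n c) (cgs i n d)"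
      using cd shift'[of c d] A_eq[of c d] by (auto simp: cgs_def)
  qed
qed

lemma ratG_conjG: "msupp n a \<Longrightarrow> msupp n b \<Longrightarrow> ratG pl i n a b \<Longrightarrow> conjG n g h (cgG i n) a b"
  unfolding conjG_def using ratG_conj by simp

text \<open>This permits guessing the tensor modulo multiples of the identity and correcting its
  operator by a scalar afterwards.\<close>

lemma conjG_diff_mid:
  assumes "conjG n g h (cgG i n) a b"
  shows "conjG n g h (cgG i n) (a - mscale c (mid n)) (b - mscale c (mid n))"
proof -
  have "conj_by n h g (mid n) = mid n" using M by (simp add: conj_by_def mutual_inv_def)
  moreover have "cgG i n (mscale c (mid n)) (mscale c (mid n))"
    unfolding cgG_def
  proof (intro ballI conjI impI)
    fix x y assume xy: "x \<in> {1..n}" "y \<in> {1..n}"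
    have "cgs i n x = cgs i n y \<longleftrightarrow> x = y"
      using inj_on_eq_iff[OF bij_betw_imp_inj_on[OF bij_cgs[OF i(2)]] xy] .
    then have m: "mid n (cgs i n x) (cgs i n y) = (mid n x y :: 'a)"
      using xy cgs_in[OF i(2) xy(1)] by (simp add: mid_def del: atLeastAtMost_iff)
    then show "mscale c (mid n) x y = mscale c (mid n) (cgs i n x) (cgs i n y)" by (simp add: mscale_def)
    assume "x \<le> n - i" "n - i < y"
    then have "mid n x y = (0::'a)" by (simp add: mid_def)
    then show "mscale c (mid n) x y = 0" "mscale c (mid n) (cgs i n x) (cgs i n y) = 0"
      by (simp_all add: mscale_def m)
  qed
  ultimately show ?thesis
    using assms unfolding conjG_def by (simp add: conj_by_diff conj_by_mscale cgG_diff)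
qed

end

section \<open>The limit tensors in block coordinates\<close>

text \<open>An index \<open>j\<close> is encoded by \<open>(q, s)\<close> with \<open>j - 1 = q * i + s\<close> and \<open>s < i\<close>. The tensors below
  are the components of the tensor sought for modulo multiples of the identity in either leg: \<open>pG\<close>
  has weight 0, \<open>pX\<close> and \<open>pZ\<close> have weight 1. The flag \<open>pl\<close> tells \<open>n = m * i + 1\<close> from
  \<open>n = m * i - 1\<close>.\<close>

definition pvalid :: "bool \<Rightarrow> nat \<Rightarrow> nat \<Rightarrow> nat \<Rightarrow> nat \<Rightarrow> bool" where
  "pvalid pl i m q s \<longleftrightarrow> s < i \<and> (if pl then q < m \<or> q = m \<and> s = 0 else q + 1 < m \<or> q + 1 = m \<and> s + 1 < i)"

text \<open>The relation (1 + N) a = b (1 + N) modulo V becomes a recursion in p. \<open>gq\<close>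
  and \<open>gx\<close> are its solutions in weights 0 and 1: step functions of p whose constants
  are fixed at the two ends of the index range.\<close>

definition gq :: "nat \<Rightarrow> nat \<Rightarrow> nat \<Rightarrow> int" where
  "gq q q1 p = of_bool (q \<le> q1 \<and> q \<le> p) - of_bool (q1 < q \<and> p < q)"

definition gx :: "nat \<Rightarrow> nat \<Rightarrow> nat \<Rightarrow> int" where
  "gx q q1 p = of_bool (q < q1 \<and> q < p) - of_bool (q1 \<le> q \<and> p \<le> q)"

text \<open>\<open>hs\<close> and \<open>zs\<close> are the analogous step functions inside a block,
  where the recursion comes from the opD condition.\<close>

definition hs :: "bool \<Rightarrow> nat \<Rightarrow> nat \<Rightarrow> nat \<Rightarrow> int" where
  "hs pl s s1 u = (if pl then of_bool (s < s1 \<and> u < s) - of_bool (s1 \<le> s \<and> s \<le> u)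
                   else of_bool (s < s1 \<and> s < u) - of_bool (s1 \<le> s \<and> u \<le> s))"

definition zs :: "bool \<Rightarrow> nat \<Rightarrow> nat \<Rightarrow> nat \<Rightarrow> int" where
  "zs pl s s1 u = (if pl then of_bool (s1 < s \<and> s \<le> u) - of_bool (s \<le> s1 \<and> u < s)
                   else of_bool (s1 < s \<and> u < s) - of_bool (s \<le> s1 \<and> s \<le> u))"

text \<open>The positive term absorbs the boundary value of \<open>hs\<close> where the unit shift
  leaves the leading block, at u = 0 or at u1 = i - 1; the negative term is its partner under
  exchange of the legs.\<close>

definition cx :: "bool \<Rightarrow> nat \<Rightarrow> nat \<Rightarrow> nat \<Rightarrow> nat \<Rightarrow> nat \<Rightarrow> nat \<Rightarrow> nat \<Rightarrow> int" where
  "cx pl i q s q1 s1 u1 u =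
     (if pl then of_bool (q = q1 \<and> u = 0 \<and> 1 \<le> u1) - of_bool (q1 = q + 1 \<and> s1 = 0 \<and> 1 \<le> s)
      else of_bool (q = q1 \<and> u1 + 1 = i \<and> u + 1 < i) - of_bool (q1 = q + 1 \<and> s + 1 = i \<and> s1 + 1 < i))"

definition pG :: "bool \<Rightarrow> nat \<Rightarrow> nat \<Rightarrow> nat \<Rightarrow> nat \<Rightarrow> nat \<Rightarrow> nat \<Rightarrow> nat \<Rightarrow> nat \<Rightarrow> int" where
  "pG pl q s q1 s1 p1 u1 p u = (if q + p1 = q1 + p \<and> s + u1 = s1 + u then
     (if s = u then gq q q1 p else 0) + (if q = q1 then hs pl s s1 u else 0) else 0)"

definition pX :: "bool \<Rightarrow> nat \<Rightarrow> nat \<Rightarrow> nat \<Rightarrow> nat \<Rightarrow> nat \<Rightarrow> nat \<Rightarrow> nat \<Rightarrow> nat \<Rightarrow> nat \<Rightarrow> int" where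
  "pX pl i q s q1 s1 p1 u1 p u = (if q + p1 + 1 = q1 + p \<and> s + u1 = s1 + u then
     (if s = u then gx q q1 p else 0) + cx pl i q s q1 s1 u1 u else 0)"

definition pZ :: "bool \<Rightarrow> nat \<Rightarrow> nat \<Rightarrow> nat \<Rightarrow> nat \<Rightarrow> nat \<Rightarrow> nat \<Rightarrow> nat \<Rightarrow> nat \<Rightarrow> int" where
  "pZ pl q s q1 s1 p1 u1 p u = (if q = q1 \<and> p1 = p \<and> s + u1 = s1 + u + 1 then zs pl s s1 u else 0)"

section \<open>Exchange of the two legs\<close>

lemma gq_swap: "q + p1 = q1 + p \<Longrightarrow> gq q q1 p + gq p1 p q1 = of_bool (q = q1) + of_bool (q = p)"
  unfolding gq_def by (cases q q1 rule: linorder_cases; cases q p rule: linorder_cases) auto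

lemma gx_swap: "q + p1 + 1 = q1 + p \<Longrightarrow> gx p1 p q1 = - gx q q1 p"
  unfolding gx_def by (cases q q1 rule: linorder_cases; cases q p rule: linorder_cases) auto

lemma hs_swap: "s + u1 = s1 + u \<Longrightarrow> hs pl s s1 u + hs pl u1 u s1 = - of_bool (s = u) - of_bool (s = s1)"
  unfolding hs_def by (cases s s1 rule: linorder_cases; cases s u rule: linorder_cases) auto

lemma zs_swap: "s + u1 = s1 + u + 1 \<Longrightarrow> zs pl u1 u s1 = - zs pl s s1 u"
  unfolding zs_def by (cases s s1 rule: linorder_cases; cases s u rule: linorder_cases) auto

lemma cx_swap: "q + p1 + 1 = q1 + p \<Longrightarrow> cx pl i p1 u1 p u s s1 = - cx pl i q s q1 s1 u1 u"
proof -
  assume "q + p1 + 1 = q1 + p"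
  then have "p = p1 + 1 \<longleftrightarrow> q = q1" "p1 = p \<longleftrightarrow> q1 = q + 1" by auto
  then show ?thesis unfolding cx_def by auto
qed

text \<open>The defect from skewness is the Casimir minus the square of the identity, so half of it
  has to be subtracted to obtain a skew tensor.\<close>

lemma pG_skew:
  "pG pl q s q1 s1 p1 u1 p u + pG pl p1 u1 p u q s q1 s1
   = of_bool (q = p \<and> s = u \<and> q1 = p1 \<and> s1 = u1) - of_bool (q = q1 \<and> s = s1 \<and> p1 = p \<and> u1 = u)"
proof (cases "q + p1 = q1 + p \<and> s + u1 = s1 + u")
  case True
  then have "p1 = p \<longleftrightarrow> q = q1" "u1 = s1 \<longleftrightarrow> s = u" "q1 = p1 \<longleftrightarrow> q = p" "u1 = u \<longleftrightarrow> s = s1" by auto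
  then show ?thesis
    using gq_swap[of q p1 q1 p] hs_swap[of s u1 s1 u pl] True by (auto simp: pG_def)
next
  case False
  then have "\<not> (p1 + q = p + q1 \<and> u1 + s = u + s1)" by (simp add: add.commute)
  moreover have "\<not> (q = p \<and> s = u \<and> q1 = p1 \<and> s1 = u1)" "\<not> (q = q1 \<and> s = s1 \<and> p1 = p \<and> u1 = u)"
    using False by auto
  ultimately show ?thesis using False unfolding pG_def by (simp del: de_Morgan_conj)
qed

lemma pX_skew: "pX pl i p1 u1 p u q s q1 s1 = - pX pl i q s q1 s1 p1 u1 p u"
proof (cases "q + p1 + 1 = q1 + p \<and> s + u1 = s1 + u")
  case True
  then have "u1 = s1 \<longleftrightarrow> s = u" by auto
  then show ?thesis using gx_swap[of q p1 q1 p] cx_swap[of q p1 q1 p pl i u1 u s s1] True by (cases "s = u") (simp_all add: pX_def)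
next
  case False
  then have "\<not> (p1 + q + 1 = p + q1 \<and> u1 + s = u + s1)" by (simp add: add.commute)
  then show ?thesis using False unfolding pX_def by (simp del: de_Morgan_conj)
qed

lemma pZ_skew: "pZ pl p1 u1 p u q s q1 s1 = - pZ pl q s q1 s1 p1 u1 p u"
  using zs_swap[of s u1 s1 u pl] by (auto simp: pZ_def)

section \<open>The lower left block and the shift by one block\<close>

lemma pG_low: "0 < p1 \<Longrightarrow> pG pl q s q1 s1 p1 u1 0 u = of_bool (q = 0 \<and> s = u \<and> q1 = p1 \<and> s1 = u1)"
  unfolding pG_def gq_def by auto

lemma pX_low: "0 < p1 \<Longrightarrow> pX pl i q s q1 s1 p1 u1 0 u = 0"
  unfolding pX_def gx_def cx_def by auto

lemma pZ_low: "0 < p1 \<Longrightarrow> pZ pl q s q1 s1 p1 u1 0 u = 0"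
  unfolding pZ_def by simp

lemma gq_shift: "gq q q1 (p + 1) = gq q q1 p + of_bool (q = p + 1)"
  unfolding gq_def by (cases q q1 rule: linorder_cases; cases q "p + 1" rule: linorder_cases) auto

lemma gx_shift: "gx q q1 (p + 1) = gx q q1 p + of_bool (q = p)"
  unfolding gx_def by (cases q q1 rule: linorder_cases; cases q p rule: linorder_cases) auto

lemma pG_shift:
  "pG pl q s q1 s1 (p1 + 1) u1 (p + 1) u = pG pl q s q1 s1 p1 u1 p u + of_bool (q = p + 1 \<and> s = u \<and> q1 = p1 + 1 \<and> s1 = u1)"
  unfolding pG_def gq_shift by auto

lemma pX_shift:
  "pX pl i q s q1 s1 (p1 + 1) u1 (p + 1) u = pX pl i q s q1 s1 p1 u1 p u + of_bool (q = p \<and> s = u \<and> q1 = p1 + 1 \<and> s1 = u1)"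
  unfolding pX_def gx_shift by auto

lemma pZ_shift: "pZ pl q s q1 s1 (p1 + 1) u1 (p + 1) u = pZ pl q s q1 s1 p1 u1 p u"
  unfolding pZ_def by simp

text \<open>If the next block position of column u is out of range while the row position (p1 + 1,
  u1) is in range, the column sits at the ragged end of the index range. Here the shapes n = m i + 1
  and n = m i - 1 make themselves felt.\<close>

lemma pvalid_top:
  assumes "pvalid pl i m (p1 + 1) u1" "pvalid pl i m p u" "\<not> pvalid pl i m (p + 1) u"
  shows "p \<le> p1 \<Longrightarrow> p1 = p \<and> (if pl then u1 = 0 \<and> 0 < u else u + 1 = i \<and> u1 + 1 < i)"
    and "p = p1 + 1 \<Longrightarrow> if pl then u = 0 \<longrightarrow> u1 = 0 else u1 + 1 = i \<longrightarrow> u + 1 = i"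
    and "pvalid pl i m q u \<Longrightarrow> q \<le> p"
  using assms unfolding pvalid_def by (auto split: if_splits)

text \<open>Once the shifted column has left the range, the shift relation demands that the
  unshifted coefficient vanish; for \<open>pX\<close> it must cancel a Casimir term instead.\<close>

lemma pG_top:
  assumes "pvalid pl i m q s" "pvalid pl i m q1 s1" "pvalid pl i m (p1 + 1) u1" "pvalid pl i m p u" "\<not> pvalid pl i m (p + 1) u"
  shows "pG pl q s q1 s1 p1 u1 p u = 0"
proof (cases "q + p1 = q1 + p \<and> s + u1 = s1 + u")
  case True
  note V = pvalid_top[OF assms(3-5)]
  have s: "s < i" "s1 < i" "u < i" using assms by (auto simp: pvalid_def)
  show ?thesis
  proof (cases "p \<le> p1")
    case le: True
    have "p1 = p" "q = q1" and c: "if pl then u1 = 0 \<and> 0 < u else u + 1 = i \<and> u1 + 1 < i" using V(1)[OF le] True by auto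
    show ?thesis
    proof (cases "s = u")
      case True
      then have "q \<le> p" using V(3) assms(1) by simp
      then show ?thesis using True c \<open>p1 = p\<close> \<open>q = q1\<close> s by (cases pl) (auto simp: pG_def gq_def hs_def)
    next
      case False
      then show ?thesis using True c \<open>p1 = p\<close> \<open>q = q1\<close> s by (cases pl) (auto simp: pG_def hs_def)
    qed
  next
    case False
    then have "q1 < q" using True by auto
    moreover have "s = u \<Longrightarrow> q \<le> p" using V(3) assms(1) by simp
    ultimately show ?thesis by (auto simp: pG_def gq_def)
  qed
qed (auto simp: pG_def)

lemma pX_top:
  assumes "pvalid pl i m q s" "pvalid pl i m q1 s1" "pvalid pl i m (p1 + 1) u1" "pvalid pl i m p u" "\<not> pvalid pl i m (p + 1) u"
  shows "pX pl i q s q1 s1 p1 u1 p u + of_bool (q = p \<and> s = u \<and> q1 = p1 + 1 \<and> s1 = u1) = 0"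
proof (cases "q + p1 + 1 = q1 + p \<and> s + u1 = s1 + u")
  case True
  note V = pvalid_top[OF assms(3-5)]
  have s: "s < i" "s1 < i" "u < i" using assms by (auto simp: pvalid_def)
  have qp: "s = u \<Longrightarrow> q \<le> p" using V(3) assms(1) by simp
  show ?thesis
  proof (cases "p \<le> p1")
    case le: True
    have e: "p1 = p" "q1 = q + 1" and c: "if pl then u1 = 0 \<and> 0 < u else u + 1 = i \<and> u1 + 1 < i" using V(1)[OF le] True by auto
    show ?thesis
      using True c e s qp by (cases "s = u"; cases pl) (auto simp: pX_def gx_def cx_def)
  next
    case False
    then have q: "q1 \<le> q" using True by auto
    have "cx pl i q s q1 s1 u1 u = 0"
      using V(2) True q s unfolding cx_def by (cases pl) auto
    then show ?thesis using True q qp by (auto simp: pX_def gx_def)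
  qed
qed (auto simp: pX_def)

lemma pZ_top:
  assumes "pvalid pl i m q s" "pvalid pl i m q1 s1" "pvalid pl i m (p1 + 1) u1" "pvalid pl i m p u" "\<not> pvalid pl i m (p + 1) u"
  shows "pZ pl q s q1 s1 p1 u1 p u = 0"
proof (cases "q = q1 \<and> p1 = p \<and> s + u1 = s1 + u + 1")
  case True
  have s: "s < i" "s1 < i" "u < i" using assms by (auto simp: pvalid_def)
  show ?thesis
    using pvalid_top(1)[OF assms(3-5)] True s by (cases pl) (auto simp: pZ_def zs_def)
qed (auto simp: pZ_def)

section \<open>Relations in the first block row and the leading block\<close>

lemma pG_eq_pX:
  assumes "pvalid pl i m q s" "0 < p" "pvalid pl i m p u"
  shows "pG pl q s q1 s1 0 u1 p u = (if pvalid pl i m (p + 1) u then pX pl i q s q1 s1 0 u1 (p + 1) u else 0)"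
proof (cases "q = q1 + p \<and> s + u1 = s1 + u")
  case True
  have "s = u \<Longrightarrow> \<not> pvalid pl i m (p + 1) u \<Longrightarrow> q \<le> p"
    using assms unfolding pvalid_def by (auto split: if_splits)
  then show ?thesis using True assms(2) by (auto simp: pG_def pX_def gq_def gx_def cx_def)
next
  case False
  then show ?thesis by (auto simp: pG_def pX_def)
qed

lemma pZ_eq_0: "0 < p \<Longrightarrow> pZ pl q s q1 s1 0 u1 p u = 0"
  unfolding pZ_def by simp

lemma pG_00: "pG pl q s q1 s1 0 u1 0 u
   = (if q = q1 \<and> s + u1 = s1 + u then of_bool (s = u \<and> q = 0) + hs pl s s1 u else 0)"
  unfolding pG_def gq_def by simp

lemma pX_01: "pX pl i q s q1 s1 0 u1 1 u
   = (if q = q1 \<and> s + u1 = s1 + u then - of_bool (s = u \<and> 0 < q)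
       + (if pl then of_bool (u = 0 \<and> 1 \<le> u1) else of_bool (u1 + 1 = i \<and> u + 1 < i)) else 0)"
  unfolding pX_def gx_def cx_def by (simp add: Suc_le_eq One_nat_def)

lemma pX_00: "pX pl i q s q1 s1 0 u1 0 u
   = (if q1 = q + 1 \<and> s + u1 = s1 + u then
       - (if pl then of_bool (s1 = 0 \<and> 1 \<le> s) else of_bool (s + 1 = i \<and> s1 + 1 < i)) else 0)"
  unfolding pX_def gx_def cx_def by simp

lemma pZ_00: "pZ pl q s q1 s1 0 u1 0 u = (if q = q1 \<and> s + u1 = s1 + u + 1 then zs pl s s1 u else 0)"
  unfolding pZ_def by simp

lemma hs_step: "hs True s s1 v - hs True s s1 (v + 1) = of_bool (s = v + 1)"
  "hs False s s1 (v + 1) - hs False s s1 v = of_bool (s = v)"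
  unfolding hs_def by (auto simp: of_bool_def)

lemma pvalid_1:
  assumes "pvalid pl i m q s" "\<not> pvalid pl i m 1 s" shows "q = 0"
  using assms unfolding pvalid_def by (auto split: if_splits)

text \<open>Sorted by bidegree in (q, s), the relation opD \<beta> = b opD splits into three pieces.
  This one is balanced in q and off by one in s; at u = 0 the boundary value of \<open>hs\<close> is
  cancelled by \<open>cx\<close>.\<close>

lemma block_G_plus:
  assumes v: "pvalid True i m q s" "pvalid True i m q1 s1" and m: "1 \<le> m" and u: "u1 < i" "u < i"
  shows "(if u1 + 1 < i then pG True q s q1 s1 0 (u1 + 1) 0 u
            - (if pvalid True i m 1 u then pX True i q s q1 s1 0 (u1 + 1) 1 u else 0) else 0)
       = (if 0 < u then pG True q s q1 s1 0 u1 0 (u - 1) - of_bool (q = 0 \<and> s = u - 1 \<and> q1 = 0 \<and> s1 = u1) else 0)"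
proof (cases "q = q1 \<and> s + u1 + 1 = s1 + u")
  case True
  have s: "s < i" "s1 < i" using v by (auto simp: pvalid_def)
  have v0: "pvalid True i m 1 0" using m u by (auto simp: pvalid_def)
  have q0: "s = u \<Longrightarrow> \<not> pvalid True i m 1 u \<Longrightarrow> q = 0" using pvalid_1 v(1) by blast
  show ?thesis
  proof (cases u)
    case 0
    then show ?thesis using True s v0 unfolding pG_00 pX_01 by (auto simp: hs_def of_bool_def)
  next
    case (Suc v)
    have h: "hs True s s1 u = hs True s s1 v - of_bool (s = u)" using hs_step(1)[of s s1 v] unfolding Suc Suc_eq_plus1 by simp
    show ?thesis
    proof (cases "u1 + 1 < i")
      case t: True
      have "pG True q s q1 s1 0 (u1 + 1) 0 u = of_bool (s = u \<and> q = 0) + hs True s s1 v - of_bool (s = u)"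
        unfolding pG_00 using True Suc h by simp
      moreover have "(if pvalid True i m 1 u then pX True i q s q1 s1 0 (u1 + 1) 1 u else 0) = - of_bool (s = u \<and> 0 < q)"
        unfolding pX_01 using True Suc q0 by auto
      moreover have "pG True q s q1 s1 0 u1 0 v = of_bool (s = v \<and> q = 0) + hs True s s1 v"
        unfolding pG_00 using True Suc by simp
      moreover have "(s = v) = (s1 = u1)" using True Suc by auto
      ultimately show ?thesis using t Suc True by (cases "q = 0") auto
    next
      case False
      then have "hs True s s1 v = 0" "(s = v) = (s1 = u1)" using True Suc s u by (auto simp: hs_def)
      moreover have "pG True q s q1 s1 0 u1 0 v = of_bool (s = v \<and> q = 0) + hs True s s1 v"
        unfolding pG_00 using True Suc by simp
      ultimately show ?thesis using False Suc True by auto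
    qed
  qed
next
  case False
  then have "pG True q s q1 s1 0 (u1 + 1) 0 u = 0" "pX True i q s q1 s1 0 (u1 + 1) 1 u = 0"
    unfolding pG_00 pX_01 by auto
  moreover have "0 < u \<Longrightarrow> pG True q s q1 s1 0 u1 0 (u - 1) = 0" "0 < u \<Longrightarrow> \<not> (q = 0 \<and> s = u - 1 \<and> q1 = 0 \<and> s1 = u1)"
    using False unfolding pG_00 by auto
  ultimately show ?thesis by auto
qed

text \<open>The mirror image for \<beta> opD = opD b, where \<open>cx\<close> enters at u1 = i -
  1.\<close>

lemma block_G_minus:
  assumes v: "pvalid False i m q s" "pvalid False i m q1 s1" and m: "2 \<le> m" and u: "u1 < i" "u < i"
  shows "(if 0 < u then pG False q s q1 s1 0 u1 0 (u - 1)
            - (if pvalid False i m 1 (u - 1) then pX False i q s q1 s1 0 u1 1 (u - 1) else 0) else 0)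
       = (if u1 + 1 < i then pG False q s q1 s1 0 (u1 + 1) 0 u - of_bool (q = 0 \<and> s = u \<and> q1 = 0 \<and> s1 = u1 + 1) else 0)"
proof (cases "q = q1 \<and> s + u1 + 1 = s1 + u")
  case True
  have s: "s < i" "s1 < i" using v by (auto simp: pvalid_def)
  show ?thesis
  proof (cases u)
    case 0
    have "pG False q s q1 s1 0 (u1 + 1) 0 u = of_bool (s = 0 \<and> q = 0) + hs False s s1 0" if "u1 + 1 < i"
      unfolding pG_00 using True 0 by simp
    moreover have "hs False s s1 0 = 0" "(s = 0) = (s1 = u1 + 1)" using True 0 by (auto simp: hs_def)
    ultimately show ?thesis using 0 True by auto
  next
    case (Suc v)
    have q0: "s = v \<Longrightarrow> \<not> pvalid False i m 1 v \<Longrightarrow> q = 0" using pvalid_1 v(1) by blast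
    have h: "hs False s s1 u = hs False s s1 v + of_bool (s = v)" using hs_step(2)[of s s1 v] unfolding Suc Suc_eq_plus1 by simp
    have G: "pG False q s q1 s1 0 u1 0 v = of_bool (s = v \<and> q = 0) + hs False s s1 v"
      unfolding pG_00 using True Suc by simp
    have v1: "pvalid False i m 1 v" if "u1 + 1 = i"
      using m u Suc by (auto simp: pvalid_def)
    have X: "(if pvalid False i m 1 v then pX False i q s q1 s1 0 u1 1 v else 0)
        = - of_bool (s = v \<and> 0 < q) + of_bool (u1 + 1 = i \<and> v + 1 < i)"
      unfolding pX_01 using True Suc q0 v1 by auto
    have L: "(if 0 < u then pG False q s q1 s1 0 u1 0 (u - 1)
            - (if pvalid False i m 1 (u - 1) then pX False i q s q1 s1 0 u1 1 (u - 1) else 0) else 0)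
        = of_bool (s = v) + hs False s s1 v - of_bool (u1 + 1 = i \<and> v + 1 < i)"
      unfolding Suc diff_Suc_1 X G by (cases "q = 0") simp_all
    show ?thesis unfolding L
    proof (cases "u1 + 1 < i")
      case t: True
      have "pG False q s q1 s1 0 (u1 + 1) 0 u = of_bool (s = u \<and> q = 0) + hs False s s1 v + of_bool (s = v)"
        unfolding pG_00 using True Suc h by simp
      moreover have "(s = u) = (s1 = u1 + 1)" using True Suc by auto
      ultimately show "of_bool (s = v) + hs False s s1 v - of_bool (u1 + 1 = i \<and> v + 1 < i)
        = (if u1 + 1 < i then pG False q s q1 s1 0 (u1 + 1) 0 u - of_bool (q = 0 \<and> s = u \<and> q1 = 0 \<and> s1 = u1 + 1) else 0)"
        using t True by auto
    next
      case False
      then have "hs False s s1 v = 1 - of_bool (s = v)" using True Suc s u by (auto simp: hs_def)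
      then show "of_bool (s = v) + hs False s s1 v - of_bool (u1 + 1 = i \<and> v + 1 < i)
        = (if u1 + 1 < i then pG False q s q1 s1 0 (u1 + 1) 0 u - of_bool (q = 0 \<and> s = u \<and> q1 = 0 \<and> s1 = u1 + 1) else 0)"
        using False Suc u by auto
    qed
  qed
next
  case False
  then have "u1 + 1 < i \<Longrightarrow> pG False q s q1 s1 0 (u1 + 1) 0 u = 0" "\<not> (q = 0 \<and> s = u \<and> q1 = 0 \<and> s1 = u1 + 1)"
    unfolding pG_00 by auto
  moreover have "0 < u \<Longrightarrow> pG False q s q1 s1 0 u1 0 (u - 1) = 0" "0 < u \<Longrightarrow> pX False i q s q1 s1 0 u1 1 (u - 1) = 0"
    using False unfolding pG_00 pX_01 by auto
  ultimately show ?thesis by auto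
qed

lemma zs_block_plus:
  assumes "s + u1 = s1 + u" "s < i" "s1 < i" "u1 < i" "u < i"
  shows "of_bool (u1 + 1 < i) * zs True s s1 u - of_bool (0 < u) * zs True s s1 (u - 1) + of_bool (u = 0 \<and> 1 \<le> u1)
     = of_bool (s = u) - of_bool (s = s1 \<and> u = 0 \<and> u1 = 0)"
proof (cases u)
  case 0
  then show ?thesis using assms unfolding zs_def by (cases s s1 rule: linorder_cases; cases "s = 0") auto
next
  case (Suc v)
  then show ?thesis using assms unfolding zs_def
    by (cases s s1 rule: linorder_cases; cases s u rule: linorder_cases) auto
qed

lemma zs_block_minus:
  assumes "s + u1 = s1 + u" "s < i" "s1 < i" "u1 < i" "u < i"
  shows "of_bool (0 < u) * zs False s s1 (u - 1) - of_bool (u1 + 1 < i) * zs False s s1 u + of_bool (u1 + 1 = i \<and> u + 1 < i)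
     = of_bool (s = u) - of_bool (s = s1 \<and> u + 1 = i \<and> u1 + 1 = i)"
proof (cases u)
  case 0
  then show ?thesis using assms unfolding zs_def by (cases s s1 rule: linorder_cases; cases "s = 0") auto
next
  case (Suc v)
  then show ?thesis using assms unfolding zs_def
    by (cases s s1 rule: linorder_cases; cases s u rule: linorder_cases) auto
qed

text \<open>The piece balanced in both q and s. The last term, supported at a corner of the leading
  block, is diagonal in the first leg and dies on traceless matrices.\<close>

lemma block_Z_plus:
  assumes v: "pvalid True i m q s" "pvalid True i m q1 s1" and m: "1 \<le> m" and u: "u1 < i" "u < i"
  shows "(if u1 + 1 < i then pZ True q s q1 s1 0 (u1 + 1) 0 u else 0) - (if 0 < u then pZ True q s q1 s1 0 u1 0 (u - 1) else 0)
     + (if pvalid True i m 1 u then pX True i q s q1 s1 0 u1 1 u else 0)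
     = of_bool (q = 0 \<and> s = u \<and> q1 = 0 \<and> s1 = u1) - of_bool (q = q1 \<and> s = s1 \<and> u = 0 \<and> u1 = 0)"
proof (cases "q = q1 \<and> s + u1 = s1 + u")
  case True
  have s: "s < i" "s1 < i" using v by (auto simp: pvalid_def)
  have v0: "pvalid True i m 1 0" using m u by (auto simp: pvalid_def)
  have q0: "s = u \<Longrightarrow> \<not> pvalid True i m 1 u \<Longrightarrow> q = 0" using pvalid_1 v(1) by blast
  have o: "(if pvalid True i m 1 u then - of_bool (s = u \<and> 0 < q) else 0) = (- of_bool (s = u \<and> 0 < q) :: int)"
    using q0 by auto
  have X: "(if pvalid True i m 1 u then pX True i q s q1 s1 0 u1 1 u else 0) = - of_bool (s = u \<and> 0 < q) + of_bool (u = 0 \<and> 1 \<le> u1)"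
    using True v0 o unfolding pX_01 by auto
  have Z1: "(if u1 + 1 < i then pZ True q s q1 s1 0 (u1 + 1) 0 u else 0) = of_bool (u1 + 1 < i) * zs True s s1 u"
    using True unfolding pZ_00 by simp
  have Z2: "(if 0 < u then pZ True q s q1 s1 0 u1 0 (u - 1) else 0) = of_bool (0 < u) * zs True s s1 (u - 1)"
    using True unfolding pZ_00 by auto
  have "(s = u) = (s1 = u1)" using True by auto
  then show ?thesis unfolding X Z1 Z2 using zs_block_plus[of s u1 s1 u i] True s u by (cases "q = 0") auto
next
  case False
  then have "pX True i q s q1 s1 0 u1 1 u = 0" "pZ True q s q1 s1 0 (u1 + 1) 0 u = 0" "\<not> (q = 0 \<and> s = u \<and> q1 = 0 \<and> s1 = u1)"
     "\<not> (q = q1 \<and> s = s1 \<and> u = u1)" "0 < u \<Longrightarrow> pZ True q s q1 s1 0 u1 0 (u - 1) = 0"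
    unfolding pX_01 pZ_00 by auto
  then show ?thesis by auto
qed

lemma block_Z_minus:
  assumes v: "pvalid False i m q s" "pvalid False i m q1 s1" and m: "2 \<le> m" and u: "u1 < i" "u < i"
  shows "(if 0 < u then pZ False q s q1 s1 0 u1 0 (u - 1) else 0) - (if u1 + 1 < i then pZ False q s q1 s1 0 (u1 + 1) 0 u else 0)
     + (if pvalid False i m 1 u then pX False i q s q1 s1 0 u1 1 u else 0)
     = of_bool (q = 0 \<and> s = u \<and> q1 = 0 \<and> s1 = u1) - of_bool (q = q1 \<and> s = s1 \<and> u + 1 = i \<and> u1 + 1 = i)"
proof (cases "q = q1 \<and> s + u1 = s1 + u")
  case True
  have s: "s < i" "s1 < i" using v by (auto simp: pvalid_def)
  have v0: "u + 1 < i \<Longrightarrow> pvalid False i m 1 u" using m u by (auto simp: pvalid_def)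
  have q0: "s = u \<Longrightarrow> \<not> pvalid False i m 1 u \<Longrightarrow> q = 0" using pvalid_1 v(1) by blast
  have o: "(if pvalid False i m 1 u then - of_bool (s = u \<and> 0 < q) else 0) = (- of_bool (s = u \<and> 0 < q) :: int)"
    using q0 by auto
  have X: "(if pvalid False i m 1 u then pX False i q s q1 s1 0 u1 1 u else 0) = - of_bool (s = u \<and> 0 < q) + of_bool (u1 + 1 = i \<and> u + 1 < i)"
    using True v0 o unfolding pX_01 by auto
  have Z1: "(if u1 + 1 < i then pZ False q s q1 s1 0 (u1 + 1) 0 u else 0) = of_bool (u1 + 1 < i) * zs False s s1 u"
    using True unfolding pZ_00 by simp
  have Z2: "(if 0 < u then pZ False q s q1 s1 0 u1 0 (u - 1) else 0) = of_bool (0 < u) * zs False s s1 (u - 1)"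
    using True unfolding pZ_00 by auto
  have "(s = u) = (s1 = u1)" using True by auto
  then show ?thesis unfolding X Z1 Z2 using zs_block_minus[of s u1 s1 u i] True s u by (cases "q = 0") auto
next
  case False
  then have "pX False i q s q1 s1 0 u1 1 u = 0" "pZ False q s q1 s1 0 (u1 + 1) 0 u = 0" "\<not> (q = 0 \<and> s = u \<and> q1 = 0 \<and> s1 = u1)"
     "\<not> (q = q1 \<and> s = s1 \<and> u = u1)" "0 < u \<Longrightarrow> pZ False q s q1 s1 0 u1 0 (u - 1) = 0"
    unfolding pX_01 pZ_00 by auto
  then show ?thesis by auto
qed

lemma pX_block:
  assumes "s < i" "s1 < i" "u1 < i" "u < i"
  shows "(if u1 + 1 < i then pX pl i q s q1 s1 0 (u1 + 1) 0 u else 0) = (if 0 < u then pX pl i q s q1 s1 0 u1 0 (u - 1) else 0)"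
  using assms unfolding pX_00 by (auto simp: of_bool_def)

section \<open>Block coordinates of an index\<close>

definition Qi :: "nat \<Rightarrow> nat \<Rightarrow> nat" where "Qi i a = (a - 1) div i"
definition Si :: "nat \<Rightarrow> nat \<Rightarrow> nat" where "Si i a = (a - 1) mod i"

lemma QS_eq: "1 \<le> a \<Longrightarrow> a = Qi i a * i + Si i a + 1"
  unfolding Qi_def Si_def by (metis add.commute div_mult_mod_eq le_add_diff_inverse)

lemma QS_inj: "1 \<le> a \<Longrightarrow> 1 \<le> b \<Longrightarrow> a = b \<longleftrightarrow> Qi i a = Qi i b \<and> Si i a = Si i b"
  by (metis QS_eq)

lemma Si_less: "0 < i \<Longrightarrow> Si i a < i"
  by (simp add: Si_def)

lemma QS_add: "0 < i \<Longrightarrow> 1 \<le> a \<Longrightarrow> Qi i (a + i) = Qi i a + 1 \<and> Si i (a + i) = Si i a"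
proof -
  assume "0 < i" "1 \<le> a"
  then have e: "a + i - 1 = (a - 1) + i" by simp
  have "(a - 1 + i) div i = (a - 1) div i + 1" by (rule div_add_self2) (use \<open>0 < i\<close> in simp)
  moreover have "(a - 1 + i) mod i = (a - 1) mod i" by (rule mod_add_self2)
  ultimately show ?thesis unfolding Qi_def Si_def e by (rule conjI)
qed

lemma QS_sub: "0 < i \<Longrightarrow> i < a \<Longrightarrow> Qi i a = Qi i (a - i) + 1 \<and> Si i (a - i) = Si i a"
  using QS_add[of i "a - i"] by simp

lemma QS_first: "a \<in> {1..i} \<Longrightarrow> Qi i a = 0 \<and> Si i a = a - 1"
  by (auto simp: Qi_def Si_def)

lemma Qi_pos: "0 < i \<Longrightarrow> i < a \<Longrightarrow> 0 < Qi i a"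
  using QS_sub[of i a] by simp

definition lift4 :: "nat \<Rightarrow> nat \<Rightarrow> (nat \<Rightarrow> nat \<Rightarrow> nat \<Rightarrow> nat \<Rightarrow> nat \<Rightarrow> nat \<Rightarrow> nat \<Rightarrow> nat \<Rightarrow> int) \<Rightarrow> 'a::field_char_0 tens2" where
  "lift4 i n f = (\<lambda>a b c d. if a \<in> {1..n} \<and> b \<in> {1..n} \<and> c \<in> {1..n} \<and> d \<in> {1..n}
     then of_int (f (Qi i a) (Si i a) (Qi i b) (Si i b) (Qi i c) (Si i c) (Qi i d) (Si i d)) else 0)"

lemma lift4_in: "a \<in> {1..n} \<Longrightarrow> b \<in> {1..n} \<Longrightarrow> c \<in> {1..n} \<Longrightarrow> d \<in> {1..n} \<Longrightarrow> lift4 i n f a b c d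
   = of_int (f (Qi i a) (Si i a) (Qi i b) (Si i b) (Qi i c) (Si i c) (Qi i d) (Si i d))"
  by (simp add: lift4_def)

lemma lift4_out: "a \<notin> {1..n} \<or> b \<notin> {1..n} \<or> c \<notin> {1..n} \<or> d \<notin> {1..n} \<Longrightarrow> lift4 i n f a b c d = 0"
  unfolding lift4_def by (simp only: if_False simp_thms de_Morgan_conj split: if_split) blast

text \<open>Either there are m full blocks and one further index, or the last of m blocks lacks its
  final index.\<close>

locale block_shape =
  fixes pl :: bool and i n m :: nat
  assumes i: "0 < i" "i < n" and nm: "if pl then n = m * i + 1 else n + 1 = m * i"
begin

lemma m_pos: "1 \<le> m" and m_ge: "\<not> pl \<Longrightarrow> 2 \<le> m"
proof -
  show "1 \<le> m" using nm i by (cases "m = 0") (auto split: if_splits)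
  assume "\<not> pl"
  then show "2 \<le> m" using nm i by (cases "m = 0 \<or> m = 1") (auto split: if_splits)
qed

lemma range_iff:
  assumes "1 \<le> a" shows "a \<in> {1..n} \<longleftrightarrow> pvalid pl i m (Qi i a) (Si i a)"
proof -
  let ?q = "Qi i a" and ?s = "Si i a"
  have a: "a = ?q * i + ?s + 1" by (rule QS_eq[OF assms])
  have s: "?s < i" using Si_less i by simp
  have up: "?q * i + i \<le> m * i" if "?q < m"
    using mult_le_mono1[of "?q + 1" m i] that by (simp add: distrib_right)
  have dn: "m * i + i \<le> ?q * i" if "m < ?q"
    using mult_le_mono1[of "m + 1" ?q i] that by (simp add: distrib_right)
  have i1: "1 \<le> i" using i by simp
  show ?thesis
  proof (cases pl)
    case True
    then have n: "n = m * i + 1" using nm by simp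
    consider "?q < m" | "?q = m" | "m < ?q" by linarith
    then show ?thesis
    proof cases
      case 1
      then have "a \<le> n" using up a s n by linarith
      then show ?thesis using 1 True s assms by (simp add: pvalid_def)
    next
      case 2
      have "a \<le> n \<longleftrightarrow> ?s = 0" using a[unfolded 2] n by linarith
      then show ?thesis using 2 True s assms by (simp add: pvalid_def)
    next
      case 3
      then have "\<not> a \<le> n" using dn a n i1 by linarith
      then show ?thesis using 3 True by (simp add: pvalid_def)
    qed
  next
    case False
    then have n: "n + 1 = m * i" using nm by simp
    consider "?q + 1 < m" | "?q + 1 = m" | "?q = m" | "m < ?q" by linarith
    then show ?thesis
    proof cases
      case 1
      then have "?q * i + 2 * i \<le> m * i" using mult_le_mono1[of "?q + 2" m i] by (simp add: distrib_right)
      then have "a \<le> n" using a s n i1 by linarith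
      then show ?thesis using 1 False s assms by (simp add: pvalid_def)
    next
      case 2
      then have "m * i = ?q * i + i" by (metis add_mult_distrib mult_1)
      then have "a \<le> n \<longleftrightarrow> ?s + 1 < i" using a n by linarith
      then show ?thesis using 2 False s assms by (simp add: pvalid_def)
    next
      case 3
      then have "\<not> a \<le> n" using a n by simp
      then show ?thesis using 3 False by (simp add: pvalid_def)
    next
      case 4
      then have "\<not> a \<le> n" using dn a n i1 by linarith
      then show ?thesis using 4 False by (simp add: pvalid_def)
    qed
  qed
qed

abbreviation "tG \<equiv> lift4 i n (pG pl)"
abbreviation "tX \<equiv> lift4 i n (pX pl i)"
abbreviation "tZ \<equiv> lift4 i n (pZ pl)"
text \<open>Coefficients of the Casimir, whose contraction with x returns x.\<close>

definition "om a b c d = (of_bool (a = d \<and> b = c) :: 'b::field_char_0)"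

lemma om_eq:
  assumes "a \<in> {1..n}" "b \<in> {1..n}" "1 \<le> c" "1 \<le> d"
  shows "om a b c d = of_int (of_bool (Qi i a = Qi i d \<and> Si i a = Si i d \<and> Qi i b = Qi i c \<and> Si i b = Si i c))"
  using QS_inj[of a d i] QS_inj[of b c i] assms by (auto simp: om_def)

lemma tG_skew:
  assumes "a \<in> {1..n}" "b \<in> {1..n}" "c \<in> {1..n}" "d \<in> {1..n}"
  shows "tG a b c d + tG c d a b = om a b c d - (of_bool (a = b \<and> c = d) :: 'a::field_char_0)"
proof -
  have "(a = b \<and> c = d) \<longleftrightarrow> Qi i a = Qi i b \<and> Si i a = Si i b \<and> Qi i c = Qi i d \<and> Si i c = Si i d"
    using QS_inj[of a b i] QS_inj[of c d i] assms by auto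
  then show ?thesis
    using assms om_eq[of a b c d] unfolding of_int_of_bool
    by (simp only: lift4_in of_int_add[symmetric] pG_skew) (simp add: om_eq)
qed

lemma tX_skew: "tX a b c d = - (tX c d a b :: 'a::field_char_0)"
proof (cases "a \<in> {1..n} \<and> b \<in> {1..n} \<and> c \<in> {1..n} \<and> d \<in> {1..n}")
  case True
  then show ?thesis using pX_skew[of pl i "Qi i a" "Si i a" "Qi i b" "Si i b" "Qi i c" "Si i c" "Qi i d" "Si i d"]
    by (simp add: lift4_in)
next
  case False
  then have "tX a b c d = (0::'a)" "tX c d a b = (0::'a)" by (blast intro: lift4_out)+
  then show ?thesis by simp
qed

lemma tZ_skew: "tZ a b c d = - (tZ c d a b :: 'a::field_char_0)"
proof (cases "a \<in> {1..n} \<and> b \<in> {1..n} \<and> c \<in> {1..n} \<and> d \<in> {1..n}")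
  case True
  then show ?thesis using pZ_skew[of pl "Qi i a" "Si i a" "Qi i b" "Si i b" "Qi i c" "Si i c" "Qi i d" "Si i d"]
    by (simp add: lift4_in)
next
  case False
  then have "tZ a b c d = (0::'a)" "tZ c d a b = (0::'a)" by (blast intro: lift4_out)+
  then show ?thesis by simp
qed

text \<open>In the block that must vanish for matrices preserving V only the Casimir survives, so
  subtracting x from the contraction clears it.\<close>

lemma low:
  assumes "a \<in> {1..n}" "b \<in> {1..n}" "c \<in> {i<..n}" "d \<in> {1..i}"
  shows "tG a b c d = (om a b c d :: 'a::field_char_0)" "tX a b c d = (0::'a)" "tZ a b c d = (0::'a)"
proof -
  have R: "c \<in> {1..n}" "d \<in> {1..n}" and c: "0 < Qi i c" and d: "Qi i d = 0"
    using assms i Qi_pos[of i c] QS_first[of d i] by auto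
  show "tG a b c d = (om a b c d :: 'a)" "tX a b c d = (0::'a)" "tZ a b c d = (0::'a)"
    using assms R c d by (simp_all add: lift4_in pG_low pX_low pZ_low om_eq)
qed

text \<open>Added up, the three equations say (1 + N) a = b (1 + N) modulo V with b = a - x. The
  Casimir term at column d + i belongs to weight 0, the one at column d to weight 1.\<close>

lemma shift:
  assumes "a \<in> {1..n}" "b \<in> {1..n}" "c \<in> {i<..n}" "d \<in> {1..n}"
  shows "tG a b (c - i) d = tG a b c (d + i) - (om a b c (d + i) :: 'a::field_char_0)"
    "tX a b (c - i) d = tX a b c (d + i) - (om a b c d :: 'a)"
    "tZ a b (c - i) d = (tZ a b c (d + i) :: 'a)"
proof -
  have R: "c \<in> {1..n}" "c - i \<in> {1..n}" using assms by auto
  have c: "Qi i c = Qi i (c - i) + 1" "Si i c = Si i (c - i)" using QS_sub[of i c] i assms by auto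
  have d: "Qi i (d + i) = Qi i d + 1" "Si i (d + i) = Si i d" using QS_add[of i d] i assms by auto
  have va: "pvalid pl i m (Qi i a) (Si i a)" "pvalid pl i m (Qi i b) (Si i b)"
    "pvalid pl i m (Qi i (c - i) + 1) (Si i (c - i))" "pvalid pl i m (Qi i d) (Si i d)"
    using range_iff[of a] range_iff[of b] range_iff[of c] range_iff[of d] assms R c by auto
  show "tG a b (c - i) d = tG a b c (d + i) - (om a b c (d + i) :: 'a)"
    "tX a b (c - i) d = tX a b c (d + i) - (om a b c d :: 'a)"
    "tZ a b (c - i) d = (tZ a b c (d + i) :: 'a)"
  proof (atomize(full), cases "d + i \<le> n")
    case True
    then have "d + i \<in> {1..n}" using assms by auto
    then show "tG a b (c - i) d = tG a b c (d + i) - (om a b c (d + i) :: 'a) \<and>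
      tX a b (c - i) d = tX a b c (d + i) - (om a b c d :: 'a) \<and> tZ a b (c - i) d = (tZ a b c (d + i) :: 'a)"
      using assms R by (simp add: lift4_in om_eq c d pG_shift pX_shift pZ_shift)
  next
    case False
    have o: "om a b c (d + i) = (0::'a)" "tG a b c (d + i) = (0::'a)" "tX a b c (d + i) = (0::'a)" "tZ a b c (d + i) = (0::'a)"
      using False assms by (auto simp: om_def intro!: lift4_out)
    have "\<not> pvalid pl i m (Qi i d + 1) (Si i d)" using range_iff[of "d + i"] False d assms by auto
    note T = pG_top[OF va this] pX_top[OF va this] pZ_top[OF va this]
    have X: "pX pl i (Qi i a) (Si i a) (Qi i b) (Si i b) (Qi i (c - i)) (Si i (c - i)) (Qi i d) (Si i d)
      = - of_bool (Qi i a = Qi i d \<and> Si i a = Si i d \<and> Qi i b = Qi i (c - i) + 1 \<and> Si i b = Si i (c - i))"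
      using T(2) by linarith
    show "tG a b (c - i) d = tG a b c (d + i) - (om a b c (d + i) :: 'a) \<and>
      tX a b (c - i) d = tX a b c (d + i) - (om a b c d :: 'a) \<and> tZ a b (c - i) d = (tZ a b c (d + i) :: 'a)"
      using assms R T(1,3) by (simp add: o lift4_in om_eq c X)
  qed
qed

lemma first_rows:
  assumes "a \<in> {1..n}" "b \<in> {1..n}" "c \<in> {1..i}" "d \<in> {i<..n}"
  shows "tG a b c d = (tX a b c (d + i) :: 'a::field_char_0)" "tZ a b c d = (0::'a)"
proof -
  have R: "c \<in> {1..n}" "d \<in> {1..n}" and c: "Qi i c = 0" and d: "0 < Qi i d"
    using assms i Qi_pos[of i d] QS_first[of c i] by auto
  have d': "Qi i (d + i) = Qi i d + 1" "Si i (d + i) = Si i d" using QS_add[of i d] i assms by auto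
  have v: "pvalid pl i m (Qi i a) (Si i a)" "pvalid pl i m (Qi i d) (Si i d)"
    using range_iff[of a] range_iff[of d] assms R by auto
  have iff: "d + i \<in> {1..n} \<longleftrightarrow> pvalid pl i m (Qi i d + 1) (Si i d)"
    using range_iff[of "d + i"] d' assms by simp
  show "tZ a b c d = (0::'a)" using assms R c d by (simp add: lift4_in pZ_eq_0)
  show "tG a b c d = (tX a b c (d + i) :: 'a)"
  proof (cases "d + i \<in> {1..n}")
    case True
    then show ?thesis using assms R c iff pG_eq_pX[OF v(1) d v(2)] by (simp add: lift4_in d' del: atLeastAtMost_iff)
  next
    case False
    then have "tX a b c (d + i) = (0::'a)" by (blast intro: lift4_out)
    then show ?thesis using False assms R c iff pG_eq_pX[OF v(1) d v(2)] by (simp add: lift4_in del: atLeastAtMost_iff)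
  qed
qed

lemma tX_next:
  assumes "a \<in> {1..n}" "b \<in> {1..n}" "c \<in> {1..i}" "d \<in> {1..i}"
  shows "tX a b c (d + i) = (of_int (if pvalid pl i m 1 (d - 1) then pX pl i (Qi i a) (Si i a) (Qi i b) (Si i b) 0 (c - 1) 1 (d - 1) else 0) :: 'a::field_char_0)"
proof -
  have d': "Qi i (d + i) = 1" "Si i (d + i) = d - 1" using QS_add[of i d] QS_first[of d i] i assms by auto
  have iff: "d + i \<in> {1..n} \<longleftrightarrow> pvalid pl i m 1 (d - 1)" using range_iff[of "d + i"] d' assms by simp
  have c: "c \<in> {1..n}" "Qi i c = 0" "Si i c = c - 1" using QS_first[of c i] assms i by auto
  show ?thesis
  proof (cases "d + i \<in> {1..n}")
    case True
    then show ?thesis using assms(1,2) c iff by (simp add: lift4_in d' del: atLeastAtMost_iff)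
  next
    case False
    then have "tX a b c (d + i) = (0::'a)" by (blast intro: lift4_out)
    then show ?thesis using False iff by (simp del: atLeastAtMost_iff)
  qed
qed

lemma first_block:
  assumes "a \<in> {1..n}" "b \<in> {1..n}" "c \<in> {1..i}" "d \<in> {1..i}"
  shows "lift4 i n F a b c d = (of_int (F (Qi i a) (Si i a) (Qi i b) (Si i b) 0 (c - 1) 0 (d - 1)) :: 'a::field_char_0)"
  using assms i QS_first[of c i] QS_first[of d i] by (simp add: lift4_in)

lemma block_G:
  assumes "a \<in> {1..n}" "b \<in> {1..n}" "c \<in> {1..i}" "d \<in> {1..i}"
  shows "if pl then (if c < i then tG a b (c + 1) d - tX a b (c + 1) (d + i) else 0)
             = (if 1 < d then tG a b c (d - 1) - om a b c (d - 1) else (0::'a::field_char_0))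
         else (if 1 < d then tG a b c (d - 1) - tX a b c (d - 1 + i) else 0)
             = (if c < i then tG a b (c + 1) d - om a b (c + 1) d else (0::'a))"
proof -
  have va: "pvalid pl i m (Qi i a) (Si i a)" "pvalid pl i m (Qi i b) (Si i b)"
    using range_iff[of a] range_iff[of b] assms by auto
  have u: "c - 1 < i" "d - 1 < i" using assms by auto
  have c1: "c - 1 + 1 = c" "c + 1 - 1 = c" and d1: "0 < d - 1 \<longleftrightarrow> 1 < d"
    and c2: "c < i \<Longrightarrow> c + 1 \<in> {1..i}" and d2: "1 < d \<Longrightarrow> d - 1 \<in> {1..i}" using assms by auto
  note fb = first_block[OF assms(1,2), where ?'a = 'a and F = "pG pl"] tX_next[OF assms(1,2), where ?'a = 'a]
  have o: "om a b x y = (of_int (of_bool (Qi i a = 0 \<and> Si i a = y - 1 \<and> Qi i b = 0 \<and> Si i b = x - 1)) :: 'a)"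
    if "x \<in> {1..i}" "y \<in> {1..i}" for x y
    using om_eq[of a b x y] assms(1,2) QS_first[OF that(1)] QS_first[OF that(2)] that by auto
  show ?thesis
  proof (cases pl)
    case True
    have E: "(if c < i then tG a b (c + 1) d - tX a b (c + 1) (d + i) else (0::'a))
       = of_int (if c - 1 + 1 < i then pG pl (Qi i a) (Si i a) (Qi i b) (Si i b) 0 (c - 1 + 1) 0 (d - 1)
            - (if pvalid pl i m 1 (d - 1) then pX pl i (Qi i a) (Si i a) (Qi i b) (Si i b) 0 (c - 1 + 1) 1 (d - 1) else 0) else 0)"
      using assms by (cases "c < i") (simp_all add: c1 fb c2 del: atLeastAtMost_iff)
    have E2: "(if 1 < d then tG a b c (d - 1) - om a b c (d - 1) else (0::'a))
       = of_int (if 0 < d - 1 then pG pl (Qi i a) (Si i a) (Qi i b) (Si i b) 0 (c - 1) 0 (d - 1 - 1)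
            - of_bool (Qi i a = 0 \<and> Si i a = d - 1 - 1 \<and> Qi i b = 0 \<and> Si i b = c - 1) else 0)"
      using assms by (cases "1 < d") (simp_all add: d1 fb d2 o del: atLeastAtMost_iff)
    show ?thesis unfolding if_P[OF True] E E2
      by (simp only: eqTrueI[OF True] block_G_plus[OF va[unfolded eqTrueI[OF True]] m_pos u])
  next
    case False
    then have pl: "pl = False" by simp
    have E: "(if 1 < d then tG a b c (d - 1) - tX a b c (d - 1 + i) else (0::'a))
       = of_int (if 0 < d - 1 then pG pl (Qi i a) (Si i a) (Qi i b) (Si i b) 0 (c - 1) 0 (d - 1 - 1)
            - (if pvalid pl i m 1 (d - 1 - 1) then pX pl i (Qi i a) (Si i a) (Qi i b) (Si i b) 0 (c - 1) 1 (d - 1 - 1) else 0) else 0)"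
      using assms fb(2)[of c "d - 1"] by (cases "1 < d") (simp_all add: d1 fb(1) d2 del: atLeastAtMost_iff)
    have E2: "(if c < i then tG a b (c + 1) d - om a b (c + 1) d else (0::'a))
       = of_int (if c - 1 + 1 < i then pG pl (Qi i a) (Si i a) (Qi i b) (Si i b) 0 (c - 1 + 1) 0 (d - 1)
            - of_bool (Qi i a = 0 \<and> Si i a = d - 1 \<and> Qi i b = 0 \<and> Si i b = c - 1 + 1) else 0)"
      using assms by (cases "c < i") (simp_all add: c1 fb c2 o del: atLeastAtMost_iff)
    show ?thesis unfolding if_not_P[OF False] E E2
      by (simp only: pl block_G_minus[OF va[unfolded pl] m_ge[OF False] u])
  qed
qed

lemma block_Z:
  assumes "a \<in> {1..n}" "b \<in> {1..n}" "c \<in> {1..i}" "d \<in> {1..i}"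
  shows "(if pl then 1 else -1) * ((if c < i then tZ a b (c + 1) d else 0) - (if 1 < d then tZ a b c (d - 1) else 0))
     + tX a b c (d + i) = om a b c d - (of_bool (a = b \<and> c = d \<and> c = (if pl then 1 else i)) :: 'a::field_char_0)"
proof -
  have va: "pvalid pl i m (Qi i a) (Si i a)" "pvalid pl i m (Qi i b) (Si i b)"
    using range_iff[of a] range_iff[of b] assms by auto
  have u: "c - 1 < i" "d - 1 < i" using assms by auto
  have c1: "c - 1 + 1 = c" "c + 1 - 1 = c" and d1: "0 < d - 1 \<longleftrightarrow> 1 < d"
    and c2: "c < i \<Longrightarrow> c + 1 \<in> {1..i}" and d2: "1 < d \<Longrightarrow> d - 1 \<in> {1..i}" using assms by auto
  define A where "A = (if c - 1 + 1 < i then pZ pl (Qi i a) (Si i a) (Qi i b) (Si i b) 0 (c - 1 + 1) 0 (d - 1) else 0)"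
  define B where "B = (if 0 < d - 1 then pZ pl (Qi i a) (Si i a) (Qi i b) (Si i b) 0 (c - 1) 0 (d - 1 - 1) else 0)"
  define X where "X = (if pvalid pl i m 1 (d - 1) then pX pl i (Qi i a) (Si i a) (Qi i b) (Si i b) 0 (c - 1) 1 (d - 1) else 0)"
  define D :: int where "D = of_bool (Qi i a = 0 \<and> Si i a = d - 1 \<and> Qi i b = 0 \<and> Si i b = c - 1)"
  define C :: int where "C = of_bool (a = b \<and> c = d \<and> c = (if pl then 1 else i))"
  note fb = first_block[OF assms(1,2), where ?'a = 'a and F = "pZ pl"]
  have o: "om a b c d = (of_int D :: 'a)"
    using om_eq[of a b c d] assms QS_first[OF assms(3)] QS_first[OF assms(4)] by (auto simp: D_def)
  have ab: "a = b \<longleftrightarrow> Qi i a = Qi i b \<and> Si i a = Si i b" using QS_inj[of a b i] assms by auto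
  have E: "(if c < i then tZ a b (c + 1) d else (0::'a)) = of_int A"
    using assms unfolding A_def by (cases "c < i") (simp_all add: c1 fb c2 del: atLeastAtMost_iff)
  have E2: "(if 1 < d then tZ a b c (d - 1) else (0::'a)) = of_int B"
    using assms unfolding B_def by (cases "1 < d") (simp_all add: d1 fb d2 del: atLeastAtMost_iff)
  have E3: "tX a b c (d + i) = (of_int X :: 'a)" unfolding X_def by (rule tX_next[OF assms])
  have K: "(if pl then 1 else -1) * (A - B) + X = D - C"
  proof (cases pl)
    case True
    have "C = of_bool (Qi i a = Qi i b \<and> Si i a = Si i b \<and> d - 1 = 0 \<and> c - 1 = 0)"
      unfolding C_def using assms ab True by auto
    moreover have "A - B + X = D - of_bool (Qi i a = Qi i b \<and> Si i a = Si i b \<and> d - 1 = 0 \<and> c - 1 = 0)"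
      unfolding A_def B_def X_def D_def eqTrueI[OF True]
      by (rule block_Z_plus[OF va[unfolded eqTrueI[OF True]] m_pos u])
    ultimately show ?thesis using True by simp
  next
    case False
    then have pl: "pl = False" by simp
    have "C = of_bool (Qi i a = Qi i b \<and> Si i a = Si i b \<and> d - 1 + 1 = i \<and> c - 1 + 1 = i)"
      unfolding C_def using assms ab False by auto
    moreover have "B - A + X = D - of_bool (Qi i a = Qi i b \<and> Si i a = Si i b \<and> d - 1 + 1 = i \<and> c - 1 + 1 = i)"
      unfolding A_def B_def X_def D_def pl
      by (rule block_Z_minus[OF va[unfolded pl] m_ge[OF False] u])
    ultimately show ?thesis using False by simp
  qed
  have "(if pl then 1 else -1) * (of_int A - of_int B) + of_int X = (of_int ((if pl then 1 else -1) * (A - B) + X) :: 'a)"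
    by simp
  then show ?thesis unfolding E E2 E3 o K by (simp add: C_def)
qed

lemma block_X:
  assumes "a \<in> {1..n}" "b \<in> {1..n}" "c \<in> {1..i}" "d \<in> {1..i}"
  shows "(if c < i then tX a b (c + 1) d else 0) = (if 1 < d then tX a b c (d - 1) else (0::'a::field_char_0))"
proof -
  have u: "Si i a < i" "Si i b < i" "c - 1 < i" "d - 1 < i" using assms i Si_less by auto
  have c1: "c - 1 + 1 = c" "c + 1 - 1 = c" and d1: "0 < d - 1 \<longleftrightarrow> 1 < d"
    and c2: "c < i \<Longrightarrow> c + 1 \<in> {1..i}" and d2: "1 < d \<Longrightarrow> d - 1 \<in> {1..i}" using assms by auto
  note fb = first_block[OF assms(1,2), where ?'a = 'a and F = "pX pl i"]
  have E: "(if c < i then tX a b (c + 1) d else (0::'a))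
      = of_int (if c - 1 + 1 < i then pX pl i (Qi i a) (Si i a) (Qi i b) (Si i b) 0 (c - 1 + 1) 0 (d - 1) else 0)"
    using assms by (cases "c < i") (simp_all add: c1 fb c2 del: atLeastAtMost_iff)
  have E2: "(if 1 < d then tX a b c (d - 1) else (0::'a))
      = of_int (if 0 < d - 1 then pX pl i (Qi i a) (Si i a) (Qi i b) (Si i b) 0 (c - 1) 0 (d - 1 - 1) else 0)"
    using assms by (cases "1 < d") (simp_all add: d1 fb d2 del: atLeastAtMost_iff)
  show ?thesis unfolding E E2 using pX_block[OF u] by simp
qed

end

section \<open>Pairing the first leg with a matrix\<close>

definition ev :: "nat \<Rightarrow> 'a::field_char_0 sqm \<Rightarrow> (nat \<Rightarrow> nat \<Rightarrow> 'a) \<Rightarrow> 'a" where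
  "ev n x f = (\<Sum>a\<in>{1..n}. \<Sum>b\<in>{1..n}. x b a * f a b)"

lemma rop_ev: "rop n t x c d = ev n x (\<lambda>a b. t a b c d)"
  by (simp add: rop_def ev_def)

lemma ev_add: "ev n x (\<lambda>a b. f a b + g a b) = ev n x f + ev n x g"
  by (simp add: ev_def distrib_left sum.distrib)

lemma ev_diff: "ev n x (\<lambda>a b. f a b - g a b) = ev n x f - ev n x g"
  by (simp add: ev_def right_diff_distrib sum_subtractf)

lemma ev_scale: "ev n x (\<lambda>a b. k * f a b) = k * ev n x f"
  by (simp add: ev_def sum_distrib_left mult.left_commute)

lemma ev_0: "ev n x (\<lambda>a b. 0) = 0"
  by (simp add: ev_def)

lemma ev_cong: "(\<And>a b. a \<in> {1..n} \<Longrightarrow> b \<in> {1..n} \<Longrightarrow> f a b = g a b) \<Longrightarrow> ev n x f = ev n x g"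
  unfolding ev_def by (intro sum.cong refl) simp

lemma ev_if: "(if P then ev n x f else 0) = ev n x (\<lambda>a b. if P then f a b else 0)"
  by (simp add: ev_0)

lemma ev_om:
  assumes "msupp n x"
  shows "ev n x (\<lambda>a b. of_bool (a = d \<and> b = c)) = x c d"
proof -
  have "ev n x (\<lambda>a b. of_bool (a = d \<and> b = c)) = (\<Sum>a\<in>{1..n}. \<Sum>b\<in>{1..n}. if b = c \<and> a = d then x b a else 0)"
    unfolding ev_def by (intro sum.cong refl) auto
  also have "\<dots> = (if d \<in> {1..n} \<and> c \<in> {1..n} then x c d else 0)"
    by (cases "c \<in> {1..n}") (simp_all add: sum_delta_conj sum.delta del: atLeastAtMost_iff)
  also have "\<dots> = x c d" using msuppD[OF assms, of c d] by (auto simp del: atLeastAtMost_iff)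
  finally show ?thesis .
qed

text \<open>The reason why relations between coefficients may be checked modulo the identity in the
  first leg.\<close>

lemma ev_diag:
  assumes "mtrace n x = 0"
  shows "ev n x (\<lambda>a b. of_bool (a = b \<and> P)) = 0"
proof -
  have "ev n x (\<lambda>a b. of_bool (a = b \<and> P)) = (\<Sum>a\<in>{1..n}. \<Sum>b\<in>{1..n}. if b = a then (if P then x b a else 0) else 0)"
    unfolding ev_def by (intro sum.cong refl) auto
  also have "\<dots> = (if P then mtrace n x else 0)" by (simp add: mtrace_def cong: sum.cong_simp)
  finally show ?thesis using assms by simp
qed

text \<open>For skew-symmetric \<open>T\<close> the remaining double-trace term of the projection vanishes.\<close>

definition tproj :: "nat \<Rightarrow> 'a::field_char_0 tens2 \<Rightarrow> 'a tens2" where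
  "tproj n T = (\<lambda>a b c d. T a b c d - mid n a b * (\<Sum>j\<in>{1..n}. T j j c d) / of_nat n
      - mid n c d * (\<Sum>j\<in>{1..n}. T a b j j) / of_nat n)"

definition tsupp :: "nat \<Rightarrow> 'a::zero tens2 \<Rightarrow> bool" where
  "tsupp n T \<longleftrightarrow> (\<forall>a b c d. a \<notin> {1..n} \<or> b \<notin> {1..n} \<or> c \<notin> {1..n} \<or> d \<notin> {1..n} \<longrightarrow> T a b c d = 0)"

lemma tproj_in_W:
  assumes n: "0 < n" and supp: "tsupp n T" and skew: "\<And>a b c d. T a b c d = - T c d a b"
  shows "tproj n T \<in> W n"
proof -
  have s: "T a b c d = 0" if "a \<notin> {1..n} \<or> b \<notin> {1..n} \<or> c \<notin> {1..n} \<or> d \<notin> {1..n}" for a b c d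
    using supp that unfolding tsupp_def by blast
  have m0: "mid n a b = (0::'a)" if "a \<notin> {1..n} \<or> b \<notin> {1..n}" for a b
    using that msuppD[OF msupp_mid] by blast
  have 1: "tproj n T a b c d = 0" if "\<not> (a \<in> {1..n} \<and> b \<in> {1..n} \<and> c \<in> {1..n} \<and> d \<in> {1..n})" for a b c d
  proof -
    have "mid n a b * (\<Sum>j\<in>{1..n}. T j j c d) = 0" "mid n c d * (\<Sum>j\<in>{1..n}. T a b j j) = 0" "T a b c d = 0"
      using that m0[of a b] m0[of c d] s by (auto simp del: atLeastAtMost_iff)
    then show ?thesis by (simp only: tproj_def) simp
  qed
  have 2: "tproj n T a b c d = - tproj n T c d a b" for a b c d
  proof -
    have e: "(\<Sum>j\<in>{1..n}. T j j a b) = - (\<Sum>j\<in>{1..n}. T a b j j)" for a b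
      unfolding sum_negf[symmetric] by (intro sum.cong refl skew)
    show ?thesis unfolding tproj_def e using skew[of a b c d] by simp
  qed
  have 3: "(\<Sum>j\<in>{1..n}. tproj n T j j c d) = 0" for c d
  proof -
    have "(\<Sum>k\<in>{1..n}. \<Sum>j\<in>{1..n}. T k k j j) = (\<Sum>k\<in>{1..n}. \<Sum>j\<in>{1..n}. - T j j k k)"
      by (intro sum.cong refl skew)
    also have "\<dots> = - (\<Sum>j\<in>{1..n}. \<Sum>k\<in>{1..n}. T j j k k)" by (subst sum.swap) (simp add: sum_negf)
    finally have z: "(\<Sum>k\<in>{1..n}. \<Sum>j\<in>{1..n}. T k k j j) = 0" by simp
    have "(\<Sum>j\<in>{1..n}. tproj n T j j c d) = (\<Sum>j\<in>{1..n}. T j j c d)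
        - (\<Sum>j\<in>{1..n}. mid n j j) * (\<Sum>j\<in>{1..n}. T j j c d) / of_nat n
        - mid n c d * (\<Sum>k\<in>{1..n}. \<Sum>j\<in>{1..n}. T k k j j) / of_nat n"
      unfolding tproj_def by (simp only: sum_subtractf sum_divide_distrib[symmetric] sum_distrib_left[symmetric] sum_distrib_right[symmetric])
    also have "(\<Sum>j\<in>{1..n}. mid n j j) = (of_nat n :: 'a)" by (simp add: mid_def)
    finally show ?thesis using n by (simp add: z)
  qed
  show ?thesis unfolding W_def inR_iff
    by (intro CollectI conjI allI impI) (rule 1, assumption, rule 2, rule 3)
qed

lemma rop_tproj:
  assumes x: "x \<in> sl n"
  shows "rop n (tproj n T) x = rop n T x - mscale (mtrace n (rop n T x) / of_nat n) (mid n)"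
proof (intro ext)
  fix c d
  have "ev n x (\<lambda>a b. mid n a b * (\<Sum>j\<in>{1..n}. T j j c d) / of_nat n)
      = ev n x (\<lambda>a b. ((\<Sum>j\<in>{1..n}. T j j c d) / of_nat n) * of_bool (a = b \<and> True))"
    by (rule ev_cong) (simp add: mid_def)
  also have "\<dots> = 0" by (simp only: ev_scale ev_diag[OF sl_mtrace[OF x]] mult_zero_right)
  finally have 1: "ev n x (\<lambda>a b. mid n a b * (\<Sum>j\<in>{1..n}. T j j c d) / of_nat n) = 0" .
  have "mtrace n (rop n T x) = ev n x (\<lambda>a b. \<Sum>j\<in>{1..n}. T a b j j)"
    unfolding mtrace_def rop_def ev_def
    by (subst sum.swap, rule sum.cong[OF refl], subst sum.swap) (simp add: sum_distrib_left)
  then have 2: "ev n x (\<lambda>a b. mid n c d * (\<Sum>j\<in>{1..n}. T a b j j) / of_nat n) = mtrace n (rop n T x) / of_nat n * mid n c d"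
    using ev_scale[of n x "mid n c d / of_nat n" "\<lambda>a b. \<Sum>j\<in>{1..n}. T a b j j"] by (simp add: mult.commute)
  show "rop n (tproj n T) x c d = (rop n T x - mscale (mtrace n (rop n T x) / of_nat n) (mid n)) c d"
    unfolding minus_apply rop_ev tproj_def ev_diff 1 2 by (simp add: mscale_apply)
qed

text \<open>Homogeneity for H acting on both legs. The scalar \<Theta> cancels between the two
  indices of a leg, so the integers \<open>Hbase\<close> suffice.\<close>

definition hweight :: "nat \<Rightarrow> nat \<Rightarrow> int \<Rightarrow> 'a::zero tens2 \<Rightarrow> bool" where
  "hweight i n w T \<longleftrightarrow> (\<forall>a\<in>{1..n}. \<forall>b\<in>{1..n}. \<forall>c\<in>{1..n}. \<forall>d\<in>{1..n}.
     T a b c d \<noteq> 0 \<longrightarrow> Hbase i a + Hbase i c = Hbase i b + Hbase i d + w)"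

lemma hweight_tproj:
  assumes "hweight i n w T"
  shows "hweight i n w (tproj n T)"
  unfolding hweight_def
proof (intro ballI impI)
  fix a b c d assume R: "a \<in> {1..n}" "b \<in> {1..n}" "c \<in> {1..n}" "d \<in> {1..n}" and nz: "tproj n T a b c d \<noteq> 0"
  then have "T a b c d \<noteq> 0 \<or> (a = b \<and> (\<Sum>j\<in>{1..n}. T j j c d) \<noteq> 0) \<or> (c = d \<and> (\<Sum>j\<in>{1..n}. T a b j j) \<noteq> 0)"
    by (auto simp: tproj_def mid_def split: if_splits)
  then show "Hbase i a + Hbase i c = Hbase i b + Hbase i d + w"
  proof (elim disjE conjE)
    assume "(\<Sum>j\<in>{1..n}. T j j c d) \<noteq> 0" "a = b"
    then obtain j where "j \<in> {1..n}" "T j j c d \<noteq> 0" by (meson sum.neutral)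
    then show ?thesis using assms R \<open>a = b\<close> unfolding hweight_def by fastforce
  next
    assume "(\<Sum>j\<in>{1..n}. T a b j j) \<noteq> 0" "c = d"
    then obtain j where "j \<in> {1..n}" "T a b j j \<noteq> 0" by (meson sum.neutral)
    then show ?thesis using assms R \<open>c = d\<close> unfolding hweight_def by fastforce
  qed (use assms R in \<open>auto simp: hweight_def\<close>)
qed

lemma Hbase_QS: "Hbase i a = int (Si i a) - int (Qi i a)"
  by (simp add: Hbase_def Qi_def Si_def)

context block_shape
begin

text \<open>Modulo the identity in either leg, \<open>tT\<close> is the sought tensor plus half the
  Casimir; contraction with x gives a, and subtracting x gives b. \<open>bt\<close> is the matching
  \<beta>, while \<open>tG0\<close> and \<open>tB\<close> are the skew parts of weights 0 and
  1.\<close>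

definition "tT a b c d = tG a b c d + tX a b c d + (tZ a b c d :: 'a::field_char_0)"
definition "bt a b c d = (if d \<le> i then tT a b c d - tX a b c (d + i) else (tX a b c d :: 'a::field_char_0))"
definition "tG0 a b c d = (if a \<in> {1..n} \<and> b \<in> {1..n} \<and> c \<in> {1..n} \<and> d \<in> {1..n}
   then tG a b c d - om a b c d / 2 + of_bool (a = b \<and> c = d) / 2 else (0::'a::field_char_0))"
definition "tB a b c d = tX a b c d + (tZ a b c d :: 'a::field_char_0)"
definition "lim0 = tproj n (tG0 :: 'a::field_char_0 tens2)"
definition "lim1 = tproj n (tB :: 'a::field_char_0 tens2)"

lemma tT_out: "c \<notin> {1..n} \<or> d \<notin> {1..n} \<Longrightarrow> tT a b c d = (0::'a::field_char_0)"
  and tB_out: "a \<notin> {1..n} \<or> b \<notin> {1..n} \<or> c \<notin> {1..n} \<or> d \<notin> {1..n} \<Longrightarrow> tB a b c d = (0::'a)"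
  unfolding tT_def tB_def using lift4_out[where ?'a='a] by (metis add_0)+

lemma lim0_in_W: "(lim0 :: 'a::field_char_0 tens2) \<in> W n"
  unfolding lim0_def
proof (rule tproj_in_W)
  show "0 < n" using i by simp
  show "tsupp n (tG0 :: 'a tens2)" unfolding tsupp_def tG0_def by (auto simp del: atLeastAtMost_iff)
  fix a b c d
  show "tG0 a b c d = - (tG0 c d a b :: 'a)"
  proof (cases "a \<in> {1..n} \<and> b \<in> {1..n} \<and> c \<in> {1..n} \<and> d \<in> {1..n}")
    case True
    then have t: "tG a b c d = om a b c d - of_bool (a = b \<and> c = d) - (tG c d a b :: 'a)"
      using tG_skew[of a b c d, where ?'a='a] by (simp add: algebra_simps)
    have o: "om c d a b = (om a b c d :: 'a)" by (auto simp: om_def)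
    have e: "tG0 a b c d = tG a b c d - om a b c d / 2 + of_bool (a = b \<and> c = d) / (2::'a)"
      "tG0 c d a b = tG c d a b - om a b c d / 2 + of_bool (a = b \<and> c = d) / (2::'a)"
      using True unfolding tG0_def o by (simp_all add: conj_commute del: atLeastAtMost_iff)
    show ?thesis unfolding e t by (simp add: field_simps)
  next
    case False
    then show ?thesis unfolding tG0_def by (auto simp del: atLeastAtMost_iff)
  qed
qed

lemma lim1_in_W: "(lim1 :: 'a::field_char_0 tens2) \<in> W n"
  unfolding lim1_def
proof (rule tproj_in_W)
  show "0 < n" using i by simp
  show "tsupp n (tB :: 'a tens2)" unfolding tsupp_def using tB_out by blast
  show "tB a b c d = - (tB c d a b :: 'a)" for a b c d
    unfolding tB_def using tX_skew[of a b c d, where ?'a='a] tZ_skew[of a b c d, where ?'a='a] by simp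
qed

lemma hweight_lim0: "hweight i n 0 (lim0 :: 'a::field_char_0 tens2)"
  unfolding lim0_def
proof (rule hweight_tproj)
  show "hweight i n 0 (tG0 :: 'a tens2)"
    unfolding hweight_def Hbase_QS
  proof (intro ballI impI)
    fix a b c d assume R: "a \<in> {1..n}" "b \<in> {1..n}" "c \<in> {1..n}" "d \<in> {1..n}" and nz: "tG0 a b c d \<noteq> (0::'a)"
    then have "tG a b c d \<noteq> (0::'a) \<or> (a = d \<and> b = c) \<or> (a = b \<and> c = d)"
      by (auto simp: tG0_def om_def split: if_splits)
    moreover have "Qi i a + Qi i c = Qi i b + Qi i d \<and> Si i a + Si i c = Si i b + Si i d" if "tG a b c d \<noteq> (0::'a)"
      using that R by (auto simp: lift4_in pG_def split: if_splits)
    ultimately show "int (Si i a) - int (Qi i a) + (int (Si i c) - int (Qi i c))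
        = int (Si i b) - int (Qi i b) + (int (Si i d) - int (Qi i d)) + 0" by auto
  qed
qed

lemma hweight_lim1: "hweight i n 1 (lim1 :: 'a::field_char_0 tens2)"
  unfolding lim1_def
proof (rule hweight_tproj)
  show "hweight i n 1 (tB :: 'a tens2)"
    unfolding hweight_def Hbase_QS
  proof (intro ballI impI)
    fix a b c d assume R: "a \<in> {1..n}" "b \<in> {1..n}" "c \<in> {1..n}" "d \<in> {1..n}" and nz: "tB a b c d \<noteq> (0::'a)"
    then have "tX a b c d \<noteq> (0::'a) \<or> tZ a b c d \<noteq> (0::'a)" by (auto simp: tB_def)
    moreover have "Qi i a + Qi i c + 1 = Qi i b + Qi i d \<and> Si i a + Si i c = Si i b + Si i d" if "tX a b c d \<noteq> (0::'a)"
      using that R by (auto simp: lift4_in pX_def split: if_splits)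
    moreover have "Qi i a = Qi i b \<and> Qi i c = Qi i d \<and> Si i a + Si i c = Si i b + Si i d + 1" if "tZ a b c d \<noteq> (0::'a)"
      using that R by (auto simp: lift4_in pZ_def split: if_splits)
    ultimately show "int (Si i a) - int (Qi i a) + (int (Si i c) - int (Qi i c))
        = int (Si i b) - int (Qi i b) + (int (Si i d) - int (Qi i d)) + 1" by auto
  qed
qed

text \<open>Every clause becomes an identity of coefficients paired with x: \<open>low\<close> gives
  triangularity, \<open>shift\<close> the relation modulo V, \<open>first_rows\<close> the shape of
  \<beta>, and the three block identities the opD relation, whose leftover diagonal term pairs to
  the trace of x.\<close>

lemma ratG_tT:
  fixes x :: "'a::field_char_0 sqm"
  assumes x: "x \<in> sl n"
  shows "ratG pl i n (rop n tT x) (rop n tT x - x)"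
proof -
  have s: "msupp n x" and tr: "mtrace n x = 0" using x by (auto simp: sl_def)
  have xo: "x c d = ev n x (\<lambda>a b. om a b c d)" for c d unfolding om_def using ev_om[OF s] by simp
  have B: "(rop n tT x - x) c d = ev n x (\<lambda>a b. tT a b c d - om a b c d)" for c d
    by (simp add: rop_ev xo[of c d] ev_diff)
  have 1: "btri i n (rop n tT x - x)"
    unfolding btri_def
  proof (intro ballI)
    fix c d assume cd: "c \<in> {i<..n}" "d \<in> {1..i}"
    have "ev n x (\<lambda>a b. tT a b c d - om a b c d) = ev n x (\<lambda>a b. 0)"
      by (rule ev_cong) (simp add: tT_def low[OF _ _ cd])
    then show "(rop n tT x - x) c d = 0" unfolding B by (simp add: ev_0)
  qed
  have 2: "eqlow i n (mmul n (shiftN i n) (rop n tT x) + rop n tT x) (mmul n (rop n tT x - x) (shiftN i n) + (rop n tT x - x))"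
    unfolding eqlow_def
  proof (intro ballI)
    fix c d assume cd: "c \<in> {i<..n}" "d \<in> {1..n}"
    then have c: "c \<in> {1..n}" by auto
    have z: "ev n x (\<lambda>a b. tT a b c (d + i) - om a b c (d + i)) = 0" if "\<not> d + i \<le> n"
    proof -
      have "ev n x (\<lambda>a b. tT a b c (d + i) - om a b c (d + i)) = ev n x (\<lambda>a b. 0)"
        by (rule ev_cong) (use that in \<open>auto simp: tT_out om_def\<close>)
      then show ?thesis by (simp add: ev_0)
    qed
    have "(mmul n (rop n tT x - x) (shiftN i n) + (rop n tT x - x)) c d
        = ev n x (\<lambda>a b. tT a b c (d + i) - om a b c (d + i)) + ev n x (\<lambda>a b. tT a b c d - om a b c d)"
      using z by (auto simp: mmul_shiftN[OF c cd(2)] B[symmetric])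
    also have "\<dots> = ev n x (\<lambda>a b. tT a b (c - i) d + tT a b c d)"
      unfolding ev_add[symmetric] by (rule ev_cong) (simp add: tT_def shift[OF _ _ cd])
    also have "\<dots> = (mmul n (shiftN i n) (rop n tT x) + rop n tT x) c d"
      by (simp add: shiftN_mmul[OF cd] rop_ev ev_add)
    finally show "(mmul n (shiftN i n) (rop n tT x) + rop n tT x) c d
      = (mmul n (rop n tT x - x) (shiftN i n) + (rop n tT x - x)) c d" ..
  qed
  define \<beta> where "\<beta> = rop n bt x"
  have 3: "rop n tT x c d = \<beta> c d + \<beta> c (d + i)" if cd: "c \<in> {1..i}" "d \<in> {1..n}" for c d
    unfolding \<beta>_def rop_ev ev_add[symmetric]
  proof (rule ev_cong)
    fix a b assume ab: "a \<in> {1..n}" "b \<in> {1..n}"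
    show "tT a b c d = bt a b c d + (bt a b c (d + i) :: 'a)"
    proof (cases "d \<le> i")
      case False
      then have "d \<in> {i<..n}" using cd by auto
      then show ?thesis using False cd first_rows[OF ab cd(1), where ?'a='a] by (simp add: bt_def tT_def)
    qed (use cd in \<open>simp add: bt_def\<close>)
  qed
  have 4: "\<beta> c d = 0" if "d > n" for c d
  proof -
    have "ev n x (\<lambda>a b. bt a b c d) = ev n x (\<lambda>a b. 0)"
      by (rule ev_cong) (use that i in \<open>auto simp: bt_def intro!: lift4_out\<close>)
    then show ?thesis by (simp add: \<beta>_def rop_ev ev_0)
  qed
  have 5: "if pl then mmul i opD \<beta> = mmul i (rop n tT x - x) opD else mmul i \<beta> opD = mmul i opD (rop n tT x - x)"
  proof (cases pl)
    case True
    have "mmul i opD \<beta> c d = mmul i (rop n tT x - x) opD c d" for c d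
    proof (cases "c \<in> {1..i} \<and> d \<in> {1..i}")
      case R: True
      then have cd: "c \<in> {1..i}" "d \<in> {1..i}" by auto
      have d: "d \<le> i" "d - 1 \<le> i" using cd by auto
      have "mmul i opD \<beta> c d = ev n x (\<lambda>a b. (if c < i then bt a b (c + 1) d else 0) - bt a b c d)"
        unfolding opD_mmul[OF cd] \<beta>_def rop_ev ev_if ev_diff ..
      also have "\<dots> = ev n x (\<lambda>a b. ((if 1 < d then tT a b c (d - 1) - om a b c (d - 1) else 0) - (tT a b c d - om a b c d))
          - of_bool (a = b \<and> (c = d \<and> c = 1)))"
      proof (rule ev_cong)
        fix a b assume ab: "a \<in> {1..n}" "b \<in> {1..n}"
        show "(if c < i then bt a b (c + 1) d else 0) - bt a b c d
          = ((if 1 < d then tT a b c (d - 1) - om a b c (d - 1) else 0) - (tT a b c d - om a b c d)) - (of_bool (a = b \<and> (c = d \<and> c = 1)) :: 'a)"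
          using block_G[OF ab cd, where ?'a='a] block_Z[OF ab cd, where ?'a='a] block_X[OF ab cd, where ?'a='a] True d
          unfolding bt_def tT_def by (cases "c < i"; cases "1 < d") (simp_all add: algebra_simps)
      qed
      also have "\<dots> = mmul i (rop n tT x - x) opD c d"
        unfolding mmul_opD[OF cd] B ev_if ev_diff ev_diag[OF tr] by (simp add: ev_diff ev_0)
      finally show ?thesis .
    qed (auto simp: mmul_def)
    then show ?thesis using True by (simp add: fun_eq_iff)
  next
    case False
    have "mmul i \<beta> opD c d = mmul i opD (rop n tT x - x) c d" for c d
    proof (cases "c \<in> {1..i} \<and> d \<in> {1..i}")
      case R: True
      then have cd: "c \<in> {1..i}" "d \<in> {1..i}" by auto
      have d: "d \<le> i" "d - 1 \<le> i" using cd by auto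
      have "mmul i \<beta> opD c d = ev n x (\<lambda>a b. (if 1 < d then bt a b c (d - 1) else 0) - bt a b c d)"
        unfolding mmul_opD[OF cd] \<beta>_def rop_ev ev_if ev_diff ..
      also have "\<dots> = ev n x (\<lambda>a b. ((if c < i then tT a b (c + 1) d - om a b (c + 1) d else 0) - (tT a b c d - om a b c d))
          - of_bool (a = b \<and> (c = d \<and> c = i)))"
      proof (rule ev_cong)
        fix a b assume ab: "a \<in> {1..n}" "b \<in> {1..n}"
        show "(if 1 < d then bt a b c (d - 1) else 0) - bt a b c d
          = ((if c < i then tT a b (c + 1) d - om a b (c + 1) d else 0) - (tT a b c d - om a b c d)) - (of_bool (a = b \<and> (c = d \<and> c = i)) :: 'a)"
          using block_G[OF ab cd, where ?'a='a] block_Z[OF ab cd, where ?'a='a] block_X[OF ab cd, where ?'a='a] False d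
          unfolding bt_def tT_def by (cases "c < i"; cases "1 < d") (simp_all add: algebra_simps)
      qed
      also have "\<dots> = mmul i opD (rop n tT x - x) c d"
        unfolding opD_mmul[OF cd] B ev_if ev_diff ev_diag[OF tr] by (simp add: ev_diff ev_0)
      finally show ?thesis .
    qed (auto simp: mmul_def)
    then show ?thesis using False by (simp add: fun_eq_iff)
  qed
  show ?thesis unfolding ratG_def using 1 2 3 4 5 by blast
qed

text \<open>Making both legs traceless changes the operator by a scalar matrix, the same one in both
  members of the pair, as a common scalar shift requires.\<close>

lemma rop_lims:
  fixes x :: "'a::field_char_0 sqm"
  assumes x: "x \<in> sl n"
  obtains k where "rop n (tadd lim0 lim1) x + mscale (1/2) x = rop n tT x - mscale k (mid n)"
    "rop n (tadd lim0 lim1) x - mscale (1/2) x = (rop n tT x - x) - mscale k (mid n)"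
proof -
  have s: "msupp n x" and tr: "mtrace n x = 0" using x by (auto simp: sl_def)
  have g: "rop n tG0 x c d + rop n tB x c d = rop n tT x c d - x c d / 2" if "c \<in> {1..n}" "d \<in> {1..n}" for c d
  proof -
    have "rop n tG0 x c d + rop n tB x c d
        = ev n x (\<lambda>a b. tT a b c d - (1/2) * of_bool (a = d \<and> b = c) + (1/2) * of_bool (a = b \<and> c = d))"
      unfolding rop_ev ev_add[symmetric]
      by (rule ev_cong) (use that in \<open>simp add: tG0_def tB_def tT_def om_def\<close>)
    also have "\<dots> = rop n tT x c d - x c d / 2"
      unfolding ev_add ev_diff ev_scale ev_om[OF s] ev_diag[OF tr] by (simp add: rop_ev)
    finally show ?thesis .
  qed
  have o: "rop n tG0 x c d = 0" "rop n tB x c d = 0" "rop n tT x c d = 0" "x c d = 0" if "\<not> (c \<in> {1..n} \<and> d \<in> {1..n})" for c d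
  proof -
    show "x c d = 0" using msuppD[OF s] that by blast
    have "tG0 a b c d = (0::'a)" for a b using that unfolding tG0_def by (auto simp del: atLeastAtMost_iff)
    moreover have "tB a b c d = (0::'a)" for a b using that by (intro tB_out) blast
    moreover have "tT a b c d = (0::'a)" for a b using that by (intro tT_out) blast
    ultimately show "rop n tG0 x c d = 0" "rop n tB x c d = 0" "rop n tT x c d = 0" by (simp_all add: rop_def)
  qed
  define k where "k = mtrace n (rop n tG0 x) / of_nat n + mtrace n (rop n tB x) / of_nat n"
  have "rop n (tadd lim0 lim1) x = rop n lim0 x + rop n lim1 x"
    by (intro ext) (simp add: rop_ev tadd_def ev_add)
  also have "\<dots> = (rop n tG0 x + rop n tB x) - mscale k (mid n)"
    unfolding lim0_def lim1_def rop_tproj[OF x] k_def by (intro ext) (simp add: mscale_def algebra_simps)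
  finally have e: "rop n (tadd lim0 lim1) x c d = rop n tT x c d - x c d / 2 - mscale k (mid n) c d" for c d
    using g[of c d] o[of c d] by (cases "c \<in> {1..n} \<and> d \<in> {1..n}") auto
  show thesis
    by (rule that[of k]; intro ext; simp add: e mscale_apply field_simps)
qed

lemma msupp_rop_tT: "msupp n (rop n tT (x :: 'a::field_char_0 sqm))"
  by (rule msuppI) (auto simp: rop_def tT_out simp del: atLeastAtMost_iff)

lemma rgraph_lims:
  assumes "gauge pl i n g h (lam :: 'a::field_char_0)"
  shows "rgraph n (tadd lim0 lim1 :: 'a tens2) (conjG n g h (cgG i n))"
  unfolding rgraph_def
proof
  fix x :: "'a sqm" assume x: "x \<in> sl n"
  obtain k where k: "rop n (tadd lim0 lim1) x + mscale (1/2) x = rop n tT x - mscale k (mid n)"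
    "rop n (tadd lim0 lim1) x - mscale (1/2) x = (rop n tT x - x) - mscale k (mid n)" by (rule rop_lims[OF x])
  have "conjG n g h (cgG i n) (rop n tT x) (rop n tT x - x)"
    using gauge.ratG_conjG[OF assms _ _ ratG_tT[OF x]] msupp_rop_tT[of x] sl_msupp[OF x] by simp
  then show "conjG n g h (cgG i n) (rop n (tadd lim0 lim1) x + mscale (1/2) x) (rop n (tadd lim0 lim1) x - mscale (1/2) x)"
    unfolding k by (rule gauge.conjG_diff_mid[OF assms])
qed

end

section \<open>The carrier\<close>

text \<open>The weight -1 part of opD, extended by zero to n x n matrices.\<close>

definition upP :: "nat \<Rightarrow> 'a::comm_ring_1 sqm" where
  "upP i = (\<lambda>c d. if d = c + 1 \<and> d \<le> i \<and> 1 \<le> c then 1 else 0)"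

lemma upP_mmul:
  assumes "i < n" "c \<in> {1..n}" "d \<in> {1..n}"
  shows "mmul n (upP i) A c d = (if c < i then A (c + 1) d else 0)"
proof -
  have "mmul n (upP i) A c d = (\<Sum>x\<in>{1..n}. if x = c + 1 then (if c < i then A x d else 0) else 0)"
    unfolding mmul_apply[OF assms(2,3)] by (intro sum.cong refl) (use assms in \<open>auto simp: upP_def\<close>)
  then show ?thesis using assms by simp
qed

lemma mmul_upP:
  assumes "i < n" "c \<in> {1..n}" "d \<in> {1..n}"
  shows "mmul n A (upP i) c d = (if 1 < d \<and> d \<le> i then A c (d - 1) else 0)"
proof -
  have "mmul n A (upP i) c d = (\<Sum>x\<in>{1..n}. if x = d - 1 then (if 1 < d \<and> d \<le> i then A c x else 0) else 0)"
    unfolding mmul_apply[OF assms(2,3)] by (intro sum.cong refl) (use assms in \<open>auto simp: upP_def\<close>)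
  then show ?thesis using assms by (auto simp: sum.delta)
qed

lemma carrier_eq_rop: "carrier n r = range (rop n r)"
proof -
  have "(\<lambda>c d. \<Sum>a\<in>{1..n}. \<Sum>b\<in>{1..n}. f a b * r a b c d) = rop n r (\<lambda>b a. f a b)" for f
    by (simp add: rop_def)
  then have "carrier n r = {rop n r (\<lambda>b a. f a b) | f. True}" unfolding carrier_def by simp
  also have "\<dots> = range (rop n r)"
  proof (intro set_eqI iffI)
    fix M assume "M \<in> range (rop n r)"
    then obtain x where x: "M = rop n r x" by auto
    have "\<exists>f. M = rop n r (\<lambda>b a. f a b)" by (intro exI[of _ "\<lambda>a b. x b a"]) (simp add: x)
    then show "M \<in> {rop n r (\<lambda>b a. f a b) | f. True}" by blast
  qed auto
  finally show ?thesis .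
qed

context block_shape
begin

lemma lim1_low:
  assumes "c \<in> {i<..n}" "d \<in> {1..i}"
  shows "lim1 a b c d = (0::'a::field_char_0)"
proof -
  have z: "tB a b c d = (0::'a)" for a b
  proof (cases "a \<in> {1..n} \<and> b \<in> {1..n}")
    case True
    then show ?thesis using low(2,3)[OF _ _ assms, of a b, where ?'a='a] by (simp add: tB_def)
  next
    case False
    then show ?thesis by (intro tB_out) blast
  qed
  have "mid n c d = (0::'a)" using assms by (simp add: mid_def)
  then show ?thesis unfolding lim1_def tproj_def z by simp
qed

text \<open>F represents a Frobenius functional on the parabolic under the trace form. Rows beyond i
  follow from the shift relations of \<open>tX\<close> and \<open>tZ\<close>, the leading block from
  \<open>block_X\<close> and \<open>block_Z\<close>. The excluded upper right block pairs to zero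
  with the parabolic.\<close>

lemma frobenius:
  fixes z :: "'a::field_char_0 sqm"
  defines "F \<equiv> shiftN i n - mscale (if pl then 1 else -1) (upP i)"
  assumes z: "z \<in> sl n" and c: "c \<in> {1..n}" and d: "d \<in> {1..n}" and cd: "\<not> (c \<le> i \<and> i < d)"
  shows "mbr n F (rop n tB z) c d = - z c d"
proof -
  let ?B = "rop n tB z" and ?k = "(if pl then 1 else -1) :: 'a"
  have s: "msupp n z" and tr: "mtrace n z = 0" using z by (auto simp: sl_def)
  have zo: "z c d = ev n z (\<lambda>a b. om a b c d)" for c d unfolding om_def using ev_om[OF s] by simp
  have out: "?B c d = 0" if "d \<notin> {1..n}" for c d
    using that by (simp add: rop_def tB_out del: atLeastAtMost_iff)
  have "mbr n F ?B c d = mmul n (shiftN i n) ?B c d - mmul n ?B (shiftN i n) c d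
      - ?k * (mmul n (upP i) ?B c d - mmul n ?B (upP i) c d)"
    unfolding mbr_def F_def mmul_diff_left mmul_diff_right mmul_mscale_left mmul_mscale_right
    by (simp add: mscale_apply algebra_simps)
  also have "\<dots> = mmul n (shiftN i n) ?B c d - ?B c (d + i)
      - ?k * ((if c < i then ?B (c + 1) d else 0) - (if 1 < d \<and> d \<le> i then ?B c (d - 1) else 0))"
    unfolding mmul_shiftN[OF c d] upP_mmul[OF i(2) c d] mmul_upP[OF i(2) c d] using out[of "d + i" c] by auto
  also have "\<dots> = - z c d"
  proof (cases "i < c")
    case True
    then have cr: "c \<in> {i<..n}" using c by simp
    have "?B c (d - 1) = 0" if "1 < d" "d \<le> i"
    proof -
      have "d - 1 \<in> {1..i}" using that by auto
      then have "ev n z (\<lambda>a b. tB a b c (d - 1)) = ev n z (\<lambda>a b. 0)"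
        by (intro ev_cong) (simp add: tB_def low(2,3)[OF _ _ cr])
      then show ?thesis by (simp add: rop_ev ev_0)
    qed
    moreover have "?B (c - i) d - ?B c (d + i) = - z c d"
    proof -
      have "?B (c - i) d = ev n z (\<lambda>a b. tB a b c (d + i) - om a b c d)"
        unfolding rop_ev by (rule ev_cong) (simp add: tB_def shift(2,3)[OF _ _ cr d])
      then show ?thesis by (simp add: ev_diff rop_ev zo[of c d])
    qed
    ultimately show ?thesis using True shiftN_mmul[OF cr d, of ?B] by auto
  next
    case False
    then have C: "c \<in> {1..i}" "d \<in> {1..i}" using c d cd by auto
    have N: "mmul n (shiftN i n) ?B c d = 0"
      unfolding mmul_apply[OF c d] using False by (intro sum.neutral) (auto simp: shiftN_def)
    have zz: "tZ a b c (d + i) = (0::'a)" if "a \<in> {1..n}" "b \<in> {1..n}" for a b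
    proof (cases "d + i \<le> n")
      case True
      then show ?thesis using C by (intro first_rows(2)[OF that C(1)]) auto
    qed (auto intro: lift4_out)
    have e: "- ?B c (d + i) - ?k * ((if c < i then ?B (c + 1) d else 0) - (if 1 < d then ?B c (d - 1) else 0))
       = ev n z (\<lambda>a b. (0 - tB a b c (d + i)) - ?k * ((if c < i then tB a b (c + 1) d else 0) - (if 1 < d then tB a b c (d - 1) else 0)))"
      unfolding rop_ev ev_if ev_diff ev_scale ev_0 by simp
    also have "\<dots> = ev n z (\<lambda>a b. (of_bool (a = b \<and> (c = d \<and> c = (if pl then 1 else i))) - om a b c d))"
    proof (rule ev_cong)
      fix a b assume ab: "a \<in> {1..n}" "b \<in> {1..n}"
      show "(0 - tB a b c (d + i)) - ?k * ((if c < i then tB a b (c + 1) d else 0) - (if 1 < d then tB a b c (d - 1) else 0))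
         = (of_bool (a = b \<and> (c = d \<and> c = (if pl then 1 else i))) - om a b c d :: 'a)"
        using block_X[OF ab C, where ?'a='a] block_Z[OF ab C, where ?'a='a] zz[OF ab]
        unfolding tB_def by (cases pl; cases "c < i"; cases "1 < d") (simp_all add: algebra_simps)
    qed
    also have "\<dots> = - z c d" unfolding ev_diff ev_diag[OF tr] zo[symmetric] by simp
    finally show ?thesis using N C by simp
  qed
  finally show ?thesis .
qed

text \<open>For M in the parabolic, tr(b(z) [M, F]) = tr([F, b(z)] M) = -tr(z M) for all traceless
  z. With skewness of b this says b([M, F]) = M, an explicit preimage.\<close>

lemma carrier_lim1: "carrier n (lim1 :: 'a::field_char_0 tens2) = parabolic i n"
proof
  show "carrier n lim1 \<subseteq> (parabolic i n :: 'a sqm set)"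
  proof
    fix M :: "'a sqm" assume "M \<in> carrier n lim1"
    then obtain y where M: "M = rop n lim1 y" unfolding carrier_eq_rop by auto
    have s: "M \<in> sl n" unfolding M by (rule rop_in_sl[OF lim1_in_W])
    have "M j k = 0" if jk: "i < j" "k \<le> i" for j k
    proof (cases "j \<in> {i<..n} \<and> k \<in> {1..i}")
      case True
      then show ?thesis unfolding M rop_def using lim1_low[of j k, where ?'a='a] by simp
    next
      case False
      then show ?thesis using jk by (intro msuppD[OF sl_msupp[OF s]]) auto
    qed
    then show "M \<in> parabolic i n" using s unfolding parabolic_def by auto
  qed
  show "(parabolic i n :: 'a sqm set) \<subseteq> carrier n lim1"
  proof
    fix M :: "'a sqm" assume M: "M \<in> parabolic i n"
    then have sM: "M \<in> sl n" and low: "\<And>j k. i < j \<Longrightarrow> k \<le> i \<Longrightarrow> M j k = 0"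
      by (auto simp: parabolic_def)
    define F :: "'a sqm" where "F = shiftN i n - mscale (if pl then 1 else -1) (upP i)"
    have sF: "msupp n F" unfolding F_def using i by (auto simp: msupp_def shiftN_def upP_def mscale_def)
    define y where "y = mbr n M F"
    have "rop n lim1 y - M = 0"
    proof (rule traceless_eq_0I)
      show "0 < n" using i by simp
      show "rop n lim1 y - M \<in> sl n" using rop_in_sl[OF lim1_in_W, of y] sM by (simp add: sl_def mtrace_diff)
      fix z :: "'a sqm" assume z: "z \<in> sl n"
      let ?b = "rop n lim1 z"
      have "mtrace n (mmul n (rop n lim1 y) z) = - mtrace n (mmul n ?b y)"
        by (rule mtrace_rop_skew[OF lim1_in_W])
      also have "mmul n ?b y = mmul n (mmul n ?b M) F - mmul n (mmul n ?b F) M"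
        by (simp add: y_def mbr_def mmul_diff_right mmul_assoc)
      also have "mtrace n \<dots> = mtrace n (mmul n F (mmul n ?b M)) - mtrace n (mmul n (mmul n ?b F) M)"
        by (simp only: mtrace_diff mtrace_mmul_comm[of n "mmul n ?b M" F])
      also have "\<dots> = mtrace n (mmul n (mbr n F ?b) M)"
        by (simp add: mbr_def mmul_diff_left mtrace_diff mmul_assoc)
      also have "mbr n F ?b = mbr n F (rop n tB z)"
        unfolding lim1_def rop_tproj[OF z] mbr_diff_right mbr_mscale_right mbr_mid_right[OF sF]
        by (simp add: fun_eq_iff mscale_apply)
      also have "mtrace n (mmul n (mbr n F (rop n tB z)) M) = - mtrace n (mmul n z M)"
        unfolding mtrace_mmul sum_negf[symmetric]
      proof (intro sum.cong refl)
        fix c d assume cd: "c \<in> {1..n}" "d \<in> {1..n}"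
        show "mbr n F (rop n tB z) c d * M d c = - (z c d * M d c)"
          using frobenius[OF z cd] low[of d c] unfolding F_def by (cases "c \<le> i \<and> i < d") auto
      qed
      finally show "mtrace n (mmul n (rop n lim1 y - M) z) = 0"
        by (simp add: mmul_diff_left mtrace_diff mtrace_mmul_comm[of n z M])
    qed
    then have "M = rop n lim1 y" by simp
    then show "M \<in> carrier n lim1" unfolding carrier_eq_rop by blast
  qed
qed

end

section \<open>Determinants\<close>

text \<open>The determinant with rows chosen by an arbitrary index function: the coefficient that
  appears when det(A B) is expanded in the rows of B.\<close>

definition mdet_rows :: "nat \<Rightarrow> 'a::comm_ring_1 sqm \<Rightarrow> (nat \<Rightarrow> nat) \<Rightarrow> 'a" where
  "mdet_rows n B f = mdet n (\<lambda>j. B (f j))"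

lemma mdet_rows_permute:
  assumes q: "q permutes {1..n}"
  shows "mdet_rows n B (f \<circ> q) = of_int (sign q) * mdet_rows n B f"
proof -
  let ?P = "{p. p permutes {1..n}}"
  have "mdet_rows n B (f \<circ> q) = (\<Sum>p\<in>?P. of_int (sign (p \<circ> q)) * (\<Prod>j\<in>{1..n}. B (f (q j)) ((p \<circ> q) j)))"
    unfolding mdet_rows_def mdet_def by (subst sum_permutations_compose_right[OF q]) simp
  also have "\<dots> = (\<Sum>p\<in>?P. of_int (sign q) * (of_int (sign p) * (\<Prod>j\<in>{1..n}. B (f j) (p j))))"
  proof (intro sum.cong refl)
    fix p assume "p \<in> ?P"
    then have "sign (p \<circ> q) = sign p * sign q"
      using q by (intro sign_compose) (auto intro: permutes_imp_permutation)
    moreover have "(\<Prod>j\<in>{1..n}. B (f (q j)) ((p \<circ> q) j)) = (\<Prod>j\<in>{1..n}. B (f j) (p j))"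
      by (subst prod.permute[OF q, of "\<lambda>j. B (f j) (p j)"]) (simp add: comp_def)
    ultimately show "of_int (sign (p \<circ> q)) * (\<Prod>j\<in>{1..n}. B (f (q j)) ((p \<circ> q) j))
      = of_int (sign q) * (of_int (sign p) * (\<Prod>j\<in>{1..n}. B (f j) (p j)))" by (simp add: mult_ac)
  qed
  finally show ?thesis by (simp add: mdet_rows_def mdet_def sum_distrib_left)
qed

text \<open>Swapping the equal rows reverses the sign without changing the value; characteristic 0
  permits division by 2.\<close>

lemma mdet_rows_eq_0:
  fixes B :: "'a::field_char_0 sqm"
  assumes "a \<in> {1..n}" "b \<in> {1..n}" "a \<noteq> b" "f a = f b"
  shows "mdet_rows n B f = 0"
proof -
  have "f \<circ> Transposition.transpose a b = f"
    using assms(4) by (intro ext) (auto simp: Transposition.transpose_def)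
  then have "mdet_rows n B f = - mdet_rows n B f"
    using mdet_rows_permute[OF permutes_swap_id[OF assms(1,2)], of B f] assms(3) by (simp add: sign_swap_id)
  then show ?thesis by (simp add: eq_neg_iff_add_eq_0 mult_2[symmetric])
qed

text \<open>Each row of A B is expanded over all index functions. Only injective ones, the
  permutations, survive, and each contributes its sign times det B.\<close>

lemma mdet_mmul:
  fixes A B :: "'a::field_char_0 sqm"
  shows "mdet n (mmul n A B) = mdet n A * mdet n B"
proof -
  let ?S = "{1..n}" and ?F = "{1..n} \<rightarrow>\<^sub>E {1..n}"
  have "mdet n (mmul n A B) = (\<Sum>p | p permutes ?S. of_int (sign p) * (\<Prod>j\<in>?S. \<Sum>x\<in>?S. A j x * B x (p j)))"
    unfolding mdet_def
  proof (intro sum.cong refl arg_cong2[where f = "(*)"] prod.cong)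
    fix p j assume "p \<in> {p. p permutes ?S}" "j \<in> ?S"
    then show "mmul n A B j (p j) = (\<Sum>x\<in>?S. A j x * B x (p j))"
      using permutes_in_image[of p ?S j] by (intro mmul_apply) auto
  qed
  also have "\<dots> = (\<Sum>p | p permutes ?S. \<Sum>f\<in>?F. of_int (sign p) * ((\<Prod>j\<in>?S. A j (f j)) * (\<Prod>j\<in>?S. B (f j) (p j))))"
    by (subst prod_sum_PiE) (simp_all add: prod.distrib sum_distrib_left)
  also have "\<dots> = (\<Sum>f\<in>?F. (\<Prod>j\<in>?S. A j (f j)) * mdet_rows n B f)"
    by (subst sum.swap) (simp add: mdet_rows_def mdet_def sum_distrib_left mult_ac)
  also have "\<dots> = (\<Sum>f\<in>{f \<in> ?F. inj_on f ?S}. (\<Prod>j\<in>?S. A j (f j)) * mdet_rows n B f)"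
  proof (rule sum.mono_neutral_right)
    show "\<forall>f\<in>?F - {f \<in> ?F. inj_on f ?S}. (\<Prod>j\<in>?S. A j (f j)) * mdet_rows n B f = 0"
    proof
      fix f assume "f \<in> ?F - {f \<in> ?F. inj_on f ?S}"
      then obtain a b where "a \<in> ?S" "b \<in> ?S" "a \<noteq> b" "f a = f b" unfolding inj_on_def by blast
      then show "(\<Prod>j\<in>?S. A j (f j)) * mdet_rows n B f = 0" by (simp only: mdet_rows_eq_0 mult_zero_right)
    qed
  qed (auto intro!: finite_PiE)
  also have "\<dots> = (\<Sum>p | p permutes ?S. (\<Prod>j\<in>?S. A j (p j)) * mdet_rows n B p)"
  \<comment> \<open>The two index sets differ outside 1..n: extensional functions are
    \<open>undefined\<close> there, permutations are the identity.\<close>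
  proof (rule sum.reindex_bij_witness[where j = "\<lambda>f x. if x \<in> ?S then f x else x" and i = "\<lambda>p. restrict p ?S"])
    fix f assume f: "f \<in> {f \<in> ?F. inj_on f ?S}"
    then have fF: "f \<in> ?F" and inj: "inj_on f ?S" by auto
    show "restrict (\<lambda>x. if x \<in> ?S then f x else x) ?S = f"
    proof (rule ext)
      fix x show "restrict (\<lambda>x. if x \<in> ?S then f x else x) ?S x = f x"
        using PiE_arb[OF fF, of x] by (cases "x \<in> ?S") (simp_all del: atLeastAtMost_iff)
    qed
    have "f ` ?S \<subseteq> ?S" using fF by blast
    then have "bij_betw f ?S ?S" using inj endo_inj_surj[of ?S f] by (simp add: bij_betw_def)
    then have "bij_betw (\<lambda>x. if x \<in> ?S then f x else x) ?S ?S"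
      using bij_betw_cong[of ?S "\<lambda>x. if x \<in> ?S then f x else x" f ?S] by simp
    then show "(\<lambda>x. if x \<in> ?S then f x else x) \<in> {p. p permutes ?S}"
      by (simp add: bij_imp_permutes del: atLeastAtMost_iff)
    show "(\<Prod>j\<in>?S. A j (if j \<in> ?S then f j else j)) * mdet_rows n B (\<lambda>x. if x \<in> ?S then f x else x)
        = (\<Prod>j\<in>?S. A j (f j)) * mdet_rows n B f"
      unfolding mdet_rows_def mdet_def by (intro arg_cong2[where f = "(*)"] sum.cong prod.cong) simp_all
  next
    fix p assume "p \<in> {p. p permutes ?S}"
    then have p: "p permutes ?S" by simp
    show "(\<lambda>x. if x \<in> ?S then restrict p ?S x else x) = p"
      using permutes_not_in[OF p] by (intro ext) auto
    show "restrict p ?S \<in> {f \<in> ?F. inj_on f ?S}"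
      using permutes_in_image[OF p] permutes_inj_on[OF p, of ?S]
      by (simp add: restrict_PiE_iff inj_on_restrict_eq del: atLeastAtMost_iff)
  qed
  also have "\<dots> = (\<Sum>p | p permutes ?S. (\<Prod>j\<in>?S. A j (p j)) * (of_int (sign p) * mdet n B))"
  proof (intro sum.cong refl arg_cong2[where f = "(*)"])
    fix p assume "p \<in> {p. p permutes ?S}"
    then show "mdet_rows n B p = of_int (sign p) * mdet n B"
      using mdet_rows_permute[of p n B id] by (simp add: mdet_rows_def)
  qed
  also have "\<dots> = mdet n A * mdet n B" by (simp add: mdet_def[of n A] sum_distrib_left[symmetric] mult_ac)
  finally show ?thesis .
qed

text \<open>A permutation that never decreases, or never increases, an index is the identity, so
  every other product contains a zero entry.\<close>

lemma mdet_triangular: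
  fixes A :: "'a::comm_ring_1 sqm"
  assumes "(\<forall>a\<in>{1..n}. \<forall>b\<in>{1..n}. A a b \<noteq> 0 \<longrightarrow> a \<le> b) \<or> (\<forall>a\<in>{1..n}. \<forall>b\<in>{1..n}. A a b \<noteq> 0 \<longrightarrow> b \<le> a)"
  shows "mdet n A = (\<Prod>j\<in>{1..n}. A j j)"
proof -
  have z: "of_int (sign p) * (\<Prod>j\<in>{1..n}. A j (p j)) = 0" if p: "p permutes {1..n}" "p \<noteq> id" for p
  proof -
    have "\<exists>j\<in>{1..n}. A j (p j) = 0"
    proof (rule ccontr)
      assume "\<not> (\<exists>j\<in>{1..n}. A j (p j) = 0)"
      then have "(\<forall>j\<in>{1..n}. j \<le> p j) \<or> (\<forall>j\<in>{1..n}. p j \<le> j)"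
        using assms permutes_in_image[OF p(1)] by blast
      then show False using permutes_natset_le[OF p(1)] permutes_natset_ge[OF p(1)] p(2) by blast
    qed
    then have "(\<Prod>j\<in>{1..n}. A j (p j)) = 0" by (intro prod_zero) auto
    then show ?thesis by simp
  qed
  have "mdet n A = (\<Sum>p\<in>{id}. of_int (sign p) * (\<Prod>j\<in>{1..n}. A j (p j)))"
    unfolding mdet_def using z
    by (intro sum.mono_neutral_right) (auto intro: finite_permutations permutes_id)
  then show ?thesis by (simp add: sign_id)
qed

section \<open>Powers and exponentials of nilpotent matrices\<close>

lemma mpow_0 [simp]: "mpow n A 0 = mid n"
  by (simp add: mpow_def)

lemma mpow_Suc: "mpow n A (Suc k) = mmul n A (mpow n A k)"
  by (simp add: mpow_def)

lemma msupp_mpow [simp]: "msupp n (mpow n A k)"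
  by (cases k) (simp_all add: mpow_Suc)

lemma mpow_add: "mmul n (mpow n A k) (mpow n A l) = mpow n A (k + l)"
  by (induction k) (simp_all add: mpow_Suc mmul_assoc)

lemma mneg_eq_mscale: "mneg A = mscale (- 1) (A :: 'a::comm_ring_1 sqm)"
  by (simp add: mneg_def mscale_def)

lemma mneg_mneg [simp]: "mneg (mneg A) = (A :: 'a::group_add sqm)"
  by (simp add: mneg_def)

lemma msupp_mneg [simp]: "msupp n A \<Longrightarrow> msupp n (mneg A :: 'a::group_add sqm)"
  by (auto simp: msupp_def mneg_def)

lemma mpow_mneg: "mpow n (mneg A) k = mscale ((- 1) ^ k) (mpow n A k)"
proof (induction k)
  case 0
  show ?case by (simp add: mscale_def)
next
  case (Suc k)
  then show ?case
    by (simp add: mpow_Suc mneg_eq_mscale mmul_mscale_left mmul_mscale_right) (simp add: mscale_def mult.assoc)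
qed

lemma msupp_mexp_nil [simp]: "msupp n (mexp_nil n A)"
proof (rule msuppI)
  fix a b assume "a \<notin> {1..n} \<or> b \<notin> {1..n}"
  then have "mpow n A k a b = 0" for k by (rule msuppD[OF msupp_mpow])
  then show "mexp_nil n A a b = 0" by (simp add: mexp_nil_def)
qed

text \<open>The map \<open>f\<close> is the identity for upper and the negation for lower triangular matrices.\<close>

definition strict_tri :: "(nat \<Rightarrow> int) \<Rightarrow> 'a::zero sqm \<Rightarrow> bool" where
  "strict_tri f A \<longleftrightarrow> (\<forall>a b. A a b \<noteq> 0 \<longrightarrow> f a < f b)"

lemma strict_tri_mpow:
  fixes A :: "'a::comm_ring_1 sqm"
  assumes "strict_tri f A" "mpow n A k a b \<noteq> 0"
  shows "f a + int k \<le> f b"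
  using assms(2)
proof (induction k arbitrary: a)
  case 0
  then show ?case by (simp add: mid_def split: if_splits)
next
  case (Suc k)
  have "a \<in> {1..n} \<and> b \<in> {1..n}" using Suc.prems msuppD[OF msupp_mpow] by blast
  then have "(\<Sum>x\<in>{1..n}. A a x * mpow n A k x b) \<noteq> 0"
    using Suc.prems by (simp add: mpow_Suc mmul_apply)
  then obtain x where "A a x * mpow n A k x b \<noteq> 0" by (meson sum.neutral)
  then have "A a x \<noteq> 0" "mpow n A k x b \<noteq> 0" by auto
  then have "f a < f x" "f x + int k \<le> f b" using assms(1) Suc.IH by (auto simp: strict_tri_def)
  then show ?case by simp
qed

text \<open>Every factor raises f by at least one, but f varies by at most n - 1 on 1..n.\<close>

lemma strict_tri_nilpotent:
  fixes A :: "'a::comm_ring_1 sqm"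
  assumes "strict_tri f A" "f = int \<or> f = (\<lambda>j. - int j)" "n \<le> k" "0 < n"
  shows "mpow n A k = 0"
proof (intro ext)
  fix a b
  have "mpow n A k a b = 0"
  proof (rule ccontr)
    assume z: "mpow n A k a b \<noteq> 0"
    then have "a \<in> {1..n} \<and> b \<in> {1..n}" using msuppD[OF msupp_mpow] by blast
    moreover have "f a + int k \<le> f b" using strict_tri_mpow[OF assms(1) z] .
    ultimately show False using assms(2-4) by auto
  qed
  then show "mpow n A k a b = 0 a b" by simp
qed

lemma mexp_nil_diag:
  fixes A :: "'a::field_char_0 sqm"
  assumes "strict_tri f A" "a \<in> {1..n}"
  shows "mexp_nil n A a a = 1"
proof -
  have "mpow n A k a a = 0" if "0 < k" for k
    using strict_tri_mpow[OF assms(1), of n k a a] that by auto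
  then have "mexp_nil n A a a = (\<Sum>k\<in>{0..n}. if k = 0 then 1 else 0)"
    unfolding mexp_nil_def using assms(2) by (intro sum.cong refl) (auto simp: mid_def)
  then show ?thesis by simp
qed

lemma mdet_mexp_nil:
  fixes A :: "'a::field_char_0 sqm"
  assumes "strict_tri f A" "f = int \<or> f = (\<lambda>j. - int j)"
  shows "mdet n (mexp_nil n A) = 1"
proof -
  have *: "f a \<le> f b" if "mexp_nil n A a b \<noteq> 0" for a b
  proof -
    obtain k where "mpow n A k a b / fact k \<noteq> 0"
      using \<open>mexp_nil n A a b \<noteq> 0\<close> unfolding mexp_nil_def by (meson sum.neutral)
    then show ?thesis using strict_tri_mpow[OF assms(1), of n k a b] by auto
  qed
  have "mdet n (mexp_nil n A) = (\<Prod>j\<in>{1..n}. mexp_nil n A j j)"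
  proof (rule mdet_triangular)
    from assms(2) show "(\<forall>a\<in>{1..n}. \<forall>b\<in>{1..n}. mexp_nil n A a b \<noteq> 0 \<longrightarrow> a \<le> b)
      \<or> (\<forall>a\<in>{1..n}. \<forall>b\<in>{1..n}. mexp_nil n A a b \<noteq> 0 \<longrightarrow> b \<le> a)"
    proof
      assume "f = int"
      then show ?thesis using * by fastforce
    next
      assume "f = (\<lambda>j. - int j)"
      then show ?thesis using * by fastforce
    qed
  qed
  also have "\<dots> = 1" using mexp_nil_diag[OF assms(1)] by (intro prod.neutral) auto
  finally show ?thesis .
qed

text \<open>Vanishing of p from n on cuts the square of exponents down to the triangle k + l \<le>
  n; on each antidiagonal the alternating binomial sum is zero except at the origin.\<close>

lemma exp_series_inverse:
  fixes p :: "nat \<Rightarrow> 'a::field_char_0"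
  assumes "\<And>k. n \<le> k \<Longrightarrow> p k = 0"
  shows "(\<Sum>k\<in>{0..n}. \<Sum>l\<in>{0..n}. (- 1) ^ k * p (k + l) / (fact k * fact l)) = p 0"
proof -
  let ?g = "\<lambda>k l. (- 1) ^ k * p (k + l) / (fact k * fact l)"
  have "(\<Sum>k\<in>{0..n}. \<Sum>l\<in>{0..n}. ?g k l) = sum (\<lambda>(k, l). ?g k l) ({0..n} \<times> {0..n})"
    by (simp add: sum.cartesian_product)
  also have "\<dots> = sum (\<lambda>(k, l). ?g k l) {(k, l). k + l \<le> n}"
  proof (intro sum.mono_neutral_right ballI)
    fix x assume x: "x \<in> {0..n} \<times> {0..n} - {(k, l). k + l \<le> n}"
    obtain k l where "x = (k, l)" by (cases x)
    then show "(case x of (k, l) \<Rightarrow> ?g k l) = 0" using x assms[of "k + l"] by simp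
  qed auto
  also have "\<dots> = (\<Sum>k\<le>n. \<Sum>j\<le>k. ?g j (k - j))" by (rule sum.triangle_reindex_eq)
  also have "\<dots> = (\<Sum>k\<le>n. if k = 0 then p 0 else 0)"
  proof (intro sum.cong refl)
    fix k
    have "(\<Sum>j\<le>k. ?g j (k - j)) = (\<Sum>j\<le>k. p k / fact k * ((- 1) ^ j * of_nat (k choose j)))"
      by (intro sum.cong refl) (simp add: binomial_fact)
    also have "\<dots> = p k / fact k * (\<Sum>j\<le>k. (- 1) ^ j * of_nat (k choose j))"
      by (simp add: sum_distrib_left)
    also have "\<dots> = (if k = 0 then p 0 else 0)" using choose_alternating_sum[of k, where ?'a='a] by simp
    finally show "(\<Sum>j\<le>k. ?g j (k - j)) = (if k = 0 then p 0 else 0)" .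
  qed
  also have "\<dots> = p 0" by simp
  finally show ?thesis .
qed

lemma mmul_mexp_nil_neg:
  fixes A :: "'a::field_char_0 sqm"
  assumes "\<And>k. n \<le> k \<Longrightarrow> mpow n A k = 0"
  shows "mmul n (mexp_nil n (mneg A)) (mexp_nil n A) = mid n"
proof (intro ext)
  fix a b
  show "mmul n (mexp_nil n (mneg A)) (mexp_nil n A) a b = mid n a b"
  proof (cases "a \<in> {1..n} \<and> b \<in> {1..n}")
    case True
    then have ab: "a \<in> {1..n}" "b \<in> {1..n}" by auto
    have "mmul n (mexp_nil n (mneg A)) (mexp_nil n A) a b
        = (\<Sum>x\<in>{1..n}. \<Sum>k\<in>{0..n}. \<Sum>l\<in>{0..n}. (- 1) ^ k * (mpow n A k a x * mpow n A l x b) / (fact k * fact l))"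
      unfolding mmul_apply[OF ab] mexp_nil_def mpow_mneg mscale_def
      by (simp add: sum_product mult.assoc)
    also have "\<dots> = (\<Sum>k\<in>{0..n}. \<Sum>l\<in>{0..n}. \<Sum>x\<in>{1..n}. (- 1) ^ k * (mpow n A k a x * mpow n A l x b) / (fact k * fact l))"
      by (subst sum.swap, rule sum.cong[OF refl], rule sum.swap)
    also have "\<dots> = (\<Sum>k\<in>{0..n}. \<Sum>l\<in>{0..n}. (- 1) ^ k * mpow n A (k + l) a b / (fact k * fact l))"
      by (simp add: mpow_add[symmetric] mmul_apply[OF ab] sum_distrib_left sum_divide_distrib)
    also have "\<dots> = mid n a b" using exp_series_inverse[of n "\<lambda>k. mpow n A k a b"] assms by simp
    finally show ?thesis .
  next
    case False
    then have *: "a \<notin> {1..n} \<or> b \<notin> {1..n}" by blast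
    show ?thesis unfolding msuppD[OF msupp_mmul *] msuppD[OF msupp_mid *] ..
  qed
qed

lemma mutual_inv_mexp_nil:
  fixes A :: "'a::field_char_0 sqm"
  assumes "\<And>k. n \<le> k \<Longrightarrow> mpow n A k = 0"
  shows "mutual_inv n (mexp_nil n (mneg A)) (mexp_nil n A)"
proof -
  have "mpow n (mneg A) k = 0" if "n \<le> k" for k
    using assms[OF that] by (simp add: mpow_mneg mscale_def zero_fun_def)
  then show ?thesis
    using mmul_mexp_nil_neg[of n A] mmul_mexp_nil_neg[of n "mneg A"] assms by (simp add: mutual_inv_def)
qed

lemma btri_mpow: "btri i n A \<Longrightarrow> btri i n (mpow n A k)"
  by (induction k) (auto simp: mpow_Suc btri_mmul, auto simp: btri_def mid_def)

lemma btri_mexp_nil: "btri i n A \<Longrightarrow> btri i n (mexp_nil n A)"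
proof -
  assume "btri i n A"
  then have "btri i n (mpow n A k)" for k by (rule btri_mpow)
  then have "mpow n A k c d = 0" if "c \<in> {i<..n}" "d \<in> {1..i}" for k c d using that unfolding btri_def by blast
  then show ?thesis unfolding btri_def mexp_nil_def by simp
qed

section \<open>Commutation of an exponential with the shift\<close>

lemma mpow_commutator:
  fixes A :: "'a::field_char_0 sqm"
  assumes "btri i n A" "msupp n A" "msupp n N" "eqlow i n (mmul n A N) (mmul n N A + mscale \<kappa> (mid n))"
  shows "eqlow i n (mmul n (mpow n A k) N) (mmul n N (mpow n A k) + mscale (\<kappa> * of_nat k) (mpow n A (k - 1)))"
proof (induction k)
  case 0
  show ?case using assms(3) by (simp add: eqlow_def mscale_def)
next
  case (Suc k)
  let ?P = "mpow n A k"
  have "eqlow i n (mmul n A (mmul n ?P N)) (mmul n A (mmul n N ?P + mscale (\<kappa> * of_nat k) (mpow n A (k - 1))))"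
    by (rule eqlow_mmul_left[OF assms(1) Suc])
  also have "mmul n A (mmul n N ?P + mscale (\<kappa> * of_nat k) (mpow n A (k - 1)))
      = mmul n (mmul n A N) ?P + mscale (\<kappa> * of_nat k) ?P"
    unfolding mmul_add_right mmul_mscale_right mmul_assoc by (cases k) (simp_all add: mpow_Suc mscale_def)
  finally have 1: "eqlow i n (mmul n A (mmul n ?P N)) (mmul n (mmul n A N) ?P + mscale (\<kappa> * of_nat k) ?P)" .
  have 2: "eqlow i n (mmul n (mmul n A N) ?P) (mmul n N (mmul n A ?P) + mscale \<kappa> ?P)"
    using eqlow_mmul_right[OF assms(4), of ?P] by (simp add: mmul_add_left mmul_mscale_left mmul_assoc)
  show ?case unfolding eqlow_def
  proof (intro ballI)
    fix c d assume "c \<in> {i<..n}" "d \<in> {1..n}"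
    then show "mmul n (mpow n A (Suc k)) N c d
      = (mmul n N (mpow n A (Suc k)) + mscale (\<kappa> * of_nat (Suc k)) (mpow n A (Suc k - 1))) c d"
      using 1 2 unfolding eqlow_def by (simp add: mpow_Suc mmul_assoc mscale_def algebra_simps)
  qed
qed

text \<open>From [A, N] = \<kappa> modulo V follows [A^k, N] = \<kappa> k A^(k-1), and summation
  moves the exponential series by one place. The truncated series stays complete because its top
  term A^n vanishes. The value \<kappa> = 1 is the origin of 1 + N.\<close>

lemma mexp_nil_commutator:
  fixes A :: "'a::field_char_0 sqm"
  assumes "btri i n A" "msupp n A" "msupp n N" "eqlow i n (mmul n A N) (mmul n N A + mscale \<kappa> (mid n))"
    and nil: "mpow n A n = 0"
  shows "eqlow i n (mmul n (mexp_nil n A) N) (mmul n N (mexp_nil n A) + mscale \<kappa> (mexp_nil n A))"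
  unfolding eqlow_def
proof (intro ballI)
  fix c d assume cd: "c \<in> {i<..n}" "d \<in> {1..n}"
  then have c: "c \<in> {1..n}" by auto
  have "mmul n (mexp_nil n A) N c d = (\<Sum>k\<in>{0..n}. mmul n (mpow n A k) N c d / fact k)"
    unfolding mmul_apply[OF c cd(2)] mexp_nil_def sum_divide_distrib sum_distrib_right
    by (subst sum.swap) simp
  also have "\<dots> = (\<Sum>k\<in>{0..n}. mmul n N (mpow n A k) c d / fact k
      + \<kappa> * (if k = 0 then 0 else mpow n A (k - 1) c d / fact (k - 1)))"
  proof (intro sum.cong refl)
    fix k
    have "\<kappa> * of_nat k * mpow n A (k - 1) c d / fact k = \<kappa> * (if k = 0 then 0 else mpow n A (k - 1) c d / fact (k - 1))"
      by (cases k) (simp_all add: field_simps del: of_nat_Suc)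
    then show "mmul n (mpow n A k) N c d / fact k = mmul n N (mpow n A k) c d / fact k
      + \<kappa> * (if k = 0 then 0 else mpow n A (k - 1) c d / fact (k - 1))"
      using mpow_commutator[OF assms(1-4), of k] cd
      unfolding eqlow_def by (simp add: mscale_def add_divide_distrib)
  qed
  also have "\<dots> = (\<Sum>k\<in>{0..n}. mmul n N (mpow n A k) c d / fact k)
      + \<kappa> * (\<Sum>k\<in>{0..n}. if k = 0 then 0 else mpow n A (k - 1) c d / fact (k - 1))"
    by (simp add: sum.distrib sum_distrib_left)
  also have "(\<Sum>k\<in>{0..n}. mmul n N (mpow n A k) c d / fact k) = mmul n N (mexp_nil n A) c d"
    unfolding mmul_apply[OF c cd(2)] mexp_nil_def sum_divide_distrib sum_distrib_left
    by (subst sum.swap) simp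
  also have "(\<Sum>k\<in>{0..n}. if k = 0 then 0 else mpow n A (k - 1) c d / fact (k - 1)) = mexp_nil n A c d"
  proof -
    have "(\<Sum>k\<in>{0..n}. if k = 0 then 0 else mpow n A (k - 1) c d / fact (k - 1))
        = (\<Sum>k<n. mpow n A k c d / fact k)"
      unfolding atLeast0AtMost lessThan_Suc_atMost[symmetric] sum.lessThan_Suc_shift by simp
    also have "\<dots> = (\<Sum>k<Suc n. mpow n A k c d / fact k)" using nil by simp
    finally show ?thesis unfolding mexp_nil_def atLeast0AtMost lessThan_Suc_atMost .
  qed
  finally show "mmul n (mexp_nil n A) N c d = (mmul n N (mexp_nil n A) + mscale \<kappa> (mexp_nil n A)) c d"
    by (simp add: mscale_def)
qed

lemma mexp_nil_square_0:
  fixes A :: "'a::field_char_0 sqm"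
  assumes "msupp n A" "mmul n A A = 0" "0 < n"
  shows "mexp_nil n A = mid n + A"
proof (intro ext)
  fix a b
  have z: "mpow n A k = 0" if k2: "2 \<le> k" for k
  proof -
    obtain l where "k = 2 + l" using le_Suc_ex[OF k2] by blast
    then have "k = Suc (Suc l)" by simp
    then have "mpow n A k = mmul n (mmul n A A) (mpow n A l)" by (simp add: mpow_Suc mmul_assoc)
    then show ?thesis unfolding assms(2) by (simp add: mmul_def fun_eq_iff)
  qed
  have "mexp_nil n A a b = (\<Sum>k\<in>{0, Suc 0}. mpow n A k a b / fact k)"
    unfolding mexp_nil_def using assms(3)
  proof (intro sum.mono_neutral_right ballI)
    fix k assume "k \<in> {0..n} - {0, Suc 0}"
    then have "2 \<le> k" by auto
    then show "mpow n A k a b / fact k = 0" using z by simp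
  qed auto
  then show "mexp_nil n A a b = (mid n + A) a b" using assms(1) by (simp add: mpow_Suc)
qed

lemma mexp_nil_single:
  fixes A :: "'a::field_char_0 sqm"
  assumes "\<And>j. j \<noteq> k \<Longrightarrow> mpow n A j a b = 0" "k \<le> n"
  shows "mexp_nil n A a b = mpow n A k a b / fact k"
proof -
  have "mexp_nil n A a b = (\<Sum>j\<in>{k}. mpow n A j a b / fact j)"
    unfolding mexp_nil_def using assms by (intro sum.mono_neutral_right) auto
  then show ?thesis by simp
qed

section \<open>The gauge transformation\<close>

lemma choose_pred_absorb: "1 \<le> c \<Longrightarrow> c * ((c - 1) choose k) = Suc k * (c choose Suc k)"
  using Suc_times_binomial_eq[of "c - 1" k] by simp

lemma choose_absorb_comp: "(p - k) * (p choose k) = Suc k * (p choose Suc k)"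
proof (cases "p = 0")
  case False
  then have "p * ((p - 1) choose k) = Suc k * (p choose Suc k)" by (intro choose_pred_absorb) simp
  then show ?thesis using binomial_absorb_comp[of p k] by simp
qed simp

text \<open>Upper negation rewrites (-1)^(c-y) C(i-y, c-y) as C(-(i-c+1), c-y). Vandermonde's
  convolution then gives C(c-1, c-1).\<close>

lemma alternating_choose_sum:
  assumes "c \<in> {1..i}"
  shows "(\<Sum>y\<in>{1..c}. (- 1) ^ (c - y) * of_nat ((i - y) choose (c - y)) * of_nat (i choose (y - 1))) = (1::'a::field_char_0)"
proof -
  have "(\<Sum>y\<in>{1..c}. (- 1) ^ (c - y) * of_nat ((i - y) choose (c - y)) * of_nat (i choose (y - 1)))
      = (\<Sum>k\<in>{0..c-1}. (of_nat i gchoose k) * ((- of_nat (i - c + 1)) gchoose (c - 1 - k)) :: 'a)"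
  proof (rule sum.reindex_bij_witness[where i = "\<lambda>k. k + 1" and j = "\<lambda>y. y - 1"])
    fix y assume y: "y \<in> {1..c}"
    have "of_nat (i - c + 1) + of_nat (c - 1 - (y - 1)) - 1 = (of_nat (i - y) :: 'a)"
      using y assms by (simp add: of_nat_diff)
    then show "(of_nat i gchoose (y - 1)) * ((- of_nat (i - c + 1)) gchoose (c - 1 - (y - 1)))
      = (- 1) ^ (c - y) * of_nat ((i - y) choose (c - y)) * (of_nat (i choose (y - 1)) :: 'a)"
      using y by (simp only: gbinomial_minus binomial_gbinomial) (simp add: mult_ac)
  qed (use assms in auto)
  also have "\<dots> = (of_nat i + - of_nat (i - c + 1)) gchoose (c - 1)" by (rule gbinomial_Vandermonde)
  also have "of_nat i + - of_nat (i - c + 1) = (of_nat (c - 1) :: 'a)" using assms by (simp add: of_nat_diff)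
  also have "of_nat (c - 1) gchoose (c - 1) = (1::'a)" by (simp add: binomial_gbinomial[symmetric])
  finally show ?thesis .
qed

section \<open>Entries of exp(-X)\<close>

lemma phiX_apply:
  "phiX i n a b = (if a \<in> {1..n} \<and> b \<in> {1..n} \<and> b = a + i then of_nat ((n - a) div i) else (0::'a::field_char_0))"
proof -
  have "phiX i n a b = (\<Sum>j\<in>{1..n-i}. if j = a then (if b \<in> {1..n} \<and> b = a + i then of_nat ((n - a) div i) else (0::'a)) else 0)"
    unfolding phiX_def
  proof (intro sum.cong refl)
    fix j assume j: "j \<in> {1..n-i}"
    have "phi_c i n j = int ((n - j) div i)"
      using j of_nat_diff[of j n, where ?'a=int] by (auto simp: phi_c_def zdiv_int)
    then show "of_int (phi_c i n j) * munit n j (j + i) a b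
      = (if j = a then (if b \<in> {1..n} \<and> b = a + i then of_nat ((n - a) div i) else (0::'a)) else 0)"
      using j by (auto simp: munit_def)
  qed
  then show ?thesis by (auto simp: sum.delta)
qed

text \<open>Along a residue class the coefficients of X drop by one at each step, so the product of
  k of them is the falling factorial k! C(c_a, k).\<close>

lemma mpow_phiX:
  assumes "a \<in> {1..n}" "b \<in> {1..n}" "0 < i"
  shows "mpow n (mneg (phiX i n)) k a b
    = (if b = a + k * i then (- 1) ^ k * (fact k * of_nat ((n - a) div i choose k)) else (0::'a::field_char_0))"
  using assms(1)
proof (induction k arbitrary: a)
  case 0
  then show ?case using assms by (auto simp: mid_def)
next
  case (Suc k)
  let ?c = "(n - a) div i"
  have "mpow n (mneg (phiX i n)) (Suc k) a b
      = (\<Sum>x\<in>{1..n}. if x = a + i then - of_nat ?c * mpow n (mneg (phiX i n)) k (a + i) b else (0::'a))"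
    unfolding mpow_Suc mmul_apply[OF Suc.prems assms(2)]
    by (intro sum.cong refl) (use Suc.prems in \<open>auto simp: mneg_def phiX_apply\<close>)
  also have "\<dots> = (if a + i \<le> n then - of_nat ?c * mpow n (mneg (phiX i n)) k (a + i) b else 0)"
    by (subst sum.delta) (use Suc.prems in auto)
  also have "\<dots> = (if b = a + Suc k * i then (- 1) ^ Suc k * (fact (Suc k) * of_nat (?c choose Suc k)) else 0)"
  proof (cases "a + i \<le> n")
    case True
    have c: "(n - (a + i)) div i = ?c - 1" "1 \<le> ?c"
      using True assms(3) le_div_geq[of i "n - a"] by auto
    have "of_nat ?c * (fact k * of_nat ((?c - 1) choose k)) = fact k * (of_nat (?c * ((?c - 1) choose k)) :: 'a)"
      by simp
    also have "\<dots> = fact (Suc k) * of_nat (?c choose Suc k)"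
      unfolding choose_pred_absorb[OF c(2)] by (simp add: algebra_simps)
    finally have e: "of_nat ?c * (fact k * of_nat ((?c - 1) choose k)) = (fact (Suc k) * of_nat (?c choose Suc k) :: 'a)" .
    have "b = a + i + k * i \<longleftrightarrow> b = a + Suc k * i" by auto
    then have "mpow n (mneg (phiX i n)) k (a + i) b
        = (if b = a + Suc k * i then (- 1) ^ k * (fact k * of_nat ((?c - 1) choose k)) else (0::'a))"
      using Suc.IH[of "a + i"] True Suc.prems by (simp add: c(1))
    then have "- of_nat ?c * mpow n (mneg (phiX i n)) k (a + i) b
        = (if b = a + Suc k * i then (- 1) ^ Suc k * (of_nat ?c * (fact k * of_nat ((?c - 1) choose k))) else (0::'a))"
      by simp
    then show ?thesis unfolding e using True by simp
  qed (use assms in auto)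
  finally show ?case .
qed

lemma mexp_phiX:
  assumes "a \<in> {1..n}" "a + k * i \<in> {1..n}" "0 < i"
  shows "mexp_nil n (mneg (phiX i n)) a (a + k * i) = ((- 1) ^ k * of_nat ((n - a) div i choose k) :: 'a::field_char_0)"
proof -
  have "k * 1 \<le> k * i" using assms(3) by (intro mult_le_mono) auto
  moreover have "k * i \<le> n" using assms by simp
  ultimately have k: "k \<le> n" by linarith
  have "mexp_nil n (mneg (phiX i n)) a (a + k * i) = mpow n (mneg (phiX i n)) k a (a + k * i) / (fact k :: 'a)"
    using assms k by (intro mexp_nil_single) (auto simp: mpow_phiX simp del: atLeastAtMost_iff)
  then show ?thesis using assms by (simp add: mpow_phiX)
qed

lemma mexp_phiX_0:
  assumes "a \<in> {1..n}" "b \<in> {1..n}" "0 < i" "\<And>k. b \<noteq> a + k * i"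
  shows "mexp_nil n (mneg (phiX i n)) a b = (0 :: 'a::field_char_0)"
  unfolding mexp_nil_def using assms by (simp add: mpow_phiX)

text \<open>The column is the last one in its residue class, where the exponent equals c_y and the
  binomial is 1, leaving only a sign.\<close>

lemma mexp_phiX_top:
  assumes "y \<in> {1..i}" "z \<in> {1..i}" "z + q * i \<le> n" "n < z + q * i + i" "i < n"
  shows "mexp_nil n (mneg (phiX i n)) y (z + q * i) = (if y = z then (- 1) ^ q else (0 :: 'a::field_char_0))"
proof -
  have r: "y \<in> {1..n}" "z + q * i \<in> {1..n}" "0 < i" using assms by auto
  show ?thesis
  proof (cases "y = z")
    case True
    have "(n - y) div i = q"
      using assms True r(3) by (intro div_nat_eqI) (auto simp: algebra_simps)
    then show ?thesis using mexp_phiX[OF r(1) _ r(3), of q, where ?'a='a] r True by simp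
  next
    case False
    have "z + q * i \<noteq> y + k * i" for k
    proof
      assume *: "z + q * i = y + k * i"
      have "((z - 1) + q * i) mod i = ((y - 1) + k * i) mod i" using * assms by (intro arg_cong[where f = "\<lambda>x. x mod i"]) auto
      moreover have "z - 1 < i" "y - 1 < i" using assms by auto
      ultimately have "z - 1 = y - 1" by simp
      then show False using False assms by auto
    qed
    then show ?thesis using mexp_phiX_0[OF r, where ?'a='a] False by simp
  qed
qed

lemma strict_tri_phiX: "0 < i \<Longrightarrow> strict_tri int (mneg (phiX i n) :: 'a::field_char_0 sqm)"
  by (auto simp: strict_tri_def mneg_def phiX_apply split: if_splits)

lemma msupp_phiX [simp]: "msupp n (phiX i n :: 'a::field_char_0 sqm)"
  by (rule msuppI) (auto simp: phiX_apply)

section \<open>Entries of Z, of the E-terms and of their exponentials\<close>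

definition phiE :: "nat \<Rightarrow> nat \<Rightarrow> 'a::field_char_0 sqm" where
  "phiE i n = (\<lambda>a b. \<Sum>k\<in>{1..<i}. of_nat (i choose k) * bigE i n (int k) (int i) a b)"

text \<open>For i = 1 the residue n mod i is 0, so this case counts as n = -1 modulo i, in agreement
  with the choice of \<open>phi_eps\<close> and \<open>bigE\<close>.\<close>

locale cg_shape = block_shape +
  assumes pl_iff: "pl \<longleftrightarrow> n mod i = 1"
begin

lemma phi_a_eq:
  assumes "j \<in> {1..<i}"
  shows "phi_a i n j = (if pl then int i - int j else - int j)"
proof (cases pl)
  case True
  then have n: "int n = int m * int i + 1" using nm by simp
  have "- (int n * int j) = (int i - int j) + int i * (- (int m * int j) - 1)"
    unfolding n by (simp add: algebra_simps)
  then have "(- (int n * int j)) mod int i = (int i - int j) mod int i" by (metis mod_mult_self2)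
  also have "\<dots> = int i - int j" using assms by (intro mod_pos_pos_trivial) auto
  finally show ?thesis using True pl_iff by (simp add: phi_a_def phi_eps_def)
next
  case False
  have "int n + 1 = int m * int i" using nm False by (metis of_nat_1 of_nat_add of_nat_mult)
  then have n: "int n = int m * int i - 1" by simp
  have "- (int n * int j) = int j + int i * (- (int m * int j))"
    unfolding n by (simp add: algebra_simps)
  then have "(- (int n * int j)) mod int i = int j mod int i" by (metis mod_mult_self2)
  also have "\<dots> = int j" using assms by (intro mod_pos_pos_trivial) auto
  finally show ?thesis using False pl_iff by (simp add: phi_a_def phi_eps_def)
qed

text \<open>The translates in \<open>xi\<close> merge into a formula by residues. The excluded
  residue 0 stops Z at block boundaries, which makes it preserve V.\<close>

lemma phiZ_apply:
  "phiZ i n a b = (if a \<in> {1..n} \<and> b \<in> {1..n} \<and> a = b + 1 \<and> b mod i \<noteq> 0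
     then (if pl then of_nat (i - b mod i) else - of_nat (b mod i)) else (0::'a::field_char_0))"
proof -
  let ?v = "\<lambda>j. if pl then of_nat (i - j) else - of_nat j :: 'a"
  have "phiZ i n a b = (\<Sum>j\<in>{1..<i}. if j = b mod i then (if a \<in> {1..n} \<and> b \<in> {1..n} \<and> a = b + 1 then ?v (b mod i) else 0) else 0)"
    unfolding phiZ_def
  proof (intro sum.cong refl)
    fix j assume j: "j \<in> {1..<i}"
    have x: "(\<exists>p::int. int a = int j + 1 + int i * p \<and> int b = int j + int i * p) \<longleftrightarrow> a = b + 1 \<and> j = b mod i"
    proof
      assume "\<exists>p::int. int a = int j + 1 + int i * p \<and> int b = int j + int i * p"
      then obtain p where p: "int a = int j + 1 + int i * p" "int b = int j + int i * p" by blast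
      have "int (b mod i) = int j" using j by (simp add: p(2) zmod_int)
      then show "a = b + 1 \<and> j = b mod i" using p by simp
    next
      assume *: "a = b + 1 \<and> j = b mod i"
      have "int b = int (b mod i) + int i * int (b div i)"
        unfolding of_nat_mult[symmetric] of_nat_add[symmetric] by simp
      then show "\<exists>p::int. int a = int j + 1 + int i * p \<and> int b = int j + int i * p"
        using * by (intro exI[of _ "int (b div i)"]) simp
    qed
    have "of_int (phi_a i n j) = ?v j" unfolding phi_a_eq[OF j] using j by (simp add: of_nat_diff)
    then show "of_int (phi_a i n j) * xi i n (int j + 1) (int j) a b
      = (if j = b mod i then (if a \<in> {1..n} \<and> b \<in> {1..n} \<and> a = b + 1 then ?v (b mod i) else 0) else 0)"
      unfolding xi_def x inR_iff by (cases "j = b mod i"; cases "a \<in> {1..n}"; cases "b \<in> {1..n}"; cases "a = b + 1") (simp_all only: simp_thms if_True if_False mult_zero_right mult_1_right)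
  qed
  then show ?thesis using i by (simp add: sum.delta del: atLeastAtMost_iff) auto
qed

lemma phiE_apply:
  "phiE i n a b = (if a \<in> {1..n} \<and> b \<in> {1..n} \<and> a < b \<and> b < a + i \<and> (if pl then b mod i = 1 else a mod i = 0)
     then (if pl then 1 else - 1) * of_nat (i choose (b - a)) else (0::'a::field_char_0))"
proof -
  let ?P = "a \<in> {1..n} \<and> b \<in> {1..n}" and ?Q = "if pl then b mod i = 1 else a mod i = 0"
  have "phiE i n a b = (\<Sum>k\<in>{1..<i}. if k = a + i - b then (if ?P \<and> a < b \<and> ?Q
      then (if pl then 1 else - 1) * of_nat (i choose (b - a)) else (0::'a)) else 0)"
    unfolding phiE_def
  proof (intro sum.cong refl)
    fix k assume k: "k \<in> {1..<i}"
    \<comment> \<open>The summation index is i minus the distance from the diagonal; symmetry of the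
      binomial replaces it by the distance itself.\<close>
    have ch: "i choose k = i choose (b - a)" if "k = a + i - b" "a < b"
    proof -
      have "i - k = b - a" using that k by auto
      then show ?thesis using binomial_symmetric[of k i] k by simp
    qed
    show "of_nat (i choose k) * bigE i n (int k) (int i) a b = (if k = a + i - b then (if ?P \<and> a < b \<and> ?Q
      then (if pl then 1 else - 1) * of_nat (i choose (b - a)) else (0::'a)) else 0)"
    proof (cases pl)
      case True
      have i2: "2 \<le> i" using k by simp
      have "(\<exists>p::int. int a = int k + 1 + int i * p \<and> int b = int i + 1 + int i * p) \<longleftrightarrow> k = a + i - b \<and> a < b \<and> b mod i = 1"
        if ab: "1 \<le> a"
      proof
        assume "\<exists>p::int. int a = int k + 1 + int i * p \<and> int b = int i + 1 + int i * p"
        then obtain p where p: "int a = int k + 1 + int i * p" "int b = int i + 1 + int i * p" by blast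
        have "int b = 1 + int i * (p + 1)" using p by (simp add: algebra_simps)
        then have "int (b mod i) = 1" using i2 by (simp add: zmod_int)
        then show "k = a + i - b \<and> a < b \<and> b mod i = 1" using p k by auto
      next
        assume *: "k = a + i - b \<and> a < b \<and> b mod i = 1"
        have "int b = int (b mod i) + int i * int (b div i)"
          unfolding of_nat_mult[symmetric] of_nat_add[symmetric] by simp
        then have "int b = 1 + int i * int (b div i)" using * by simp
        moreover have "int a = int k + int b - int i" using * k by auto
        ultimately show "\<exists>p::int. int a = int k + 1 + int i * p \<and> int b = int i + 1 + int i * p"
          by (intro exI[of _ "int (b div i) - 1"]) (simp add: algebra_simps)
      qed
      then show ?thesis using True pl_iff ch by (auto simp: bigE_def xi_def)
    next
      case False
      have "(\<exists>p::int. int a = int i - int i + int i * p \<and> int b = int i - int k + int i * p) \<longleftrightarrow> k = a + i - b \<and> a < b \<and> a mod i = 0"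
      proof
        assume "\<exists>p::int. int a = int i - int i + int i * p \<and> int b = int i - int k + int i * p"
        then obtain p where p: "int a = int i * p" "int b = int i - int k + int i * p" by auto
        have "int (a mod i) = 0" by (simp add: zmod_int p)
        then show "k = a + i - b \<and> a < b \<and> a mod i = 0" using p k by auto
      next
        assume *: "k = a + i - b \<and> a < b \<and> a mod i = 0"
        have "int a = int (a mod i) + int i * int (a div i)"
          unfolding of_nat_mult[symmetric] of_nat_add[symmetric] by simp
        then have "int a = int i * int (a div i)" using * by simp
        moreover have "int b = int i - int k + int a" using * k by auto
        ultimately show "\<exists>p::int. int a = int i - int i + int i * p \<and> int b = int i - int k + int i * p"
          by (intro exI[of _ "int (a div i)"]) simp
      qed
      then show ?thesis using False pl_iff ch by (auto simp: bigE_def xi_def mneg_def)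
    qed
  qed
  then show ?thesis by (simp add: sum.delta del: atLeastAtMost_iff) auto
qed

lemma msupp_phiZ [simp]: "msupp n (phiZ i n :: 'a::field_char_0 sqm)"
  and msupp_phiE [simp]: "msupp n (phiE i n :: 'a::field_char_0 sqm)"
  by (rule msuppI; auto simp: phiZ_apply phiE_apply)+

lemma strict_tri_phiZ: "strict_tri (\<lambda>j. - int j) (mneg (phiZ i n) :: 'a::field_char_0 sqm)"
  and strict_tri_phiE: "strict_tri int (mneg (phiE i n) :: 'a::field_char_0 sqm)"
  by (auto simp: strict_tri_def mneg_def phiZ_apply phiE_apply split: if_splits)

text \<open>A nonzero product would connect two columns of residue 1, or two rows of residue 0, at a
  distance strictly between 0 and i.\<close>

lemma phiE_square: "mmul n (mneg (phiE i n)) (mneg (phiE i n)) = (0 :: 'a::field_char_0 sqm)"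
proof (intro ext)
  fix a b
  have "mneg (phiE i n) a x * mneg (phiE i n) x b = (0::'a)" for x
  proof (rule ccontr)
    assume "mneg (phiE i n) a x * mneg (phiE i n) x b \<noteq> (0::'a)"
    then have nz: "phiE i n a x \<noteq> (0::'a)" "phiE i n x b \<noteq> (0::'a)" by (auto simp: mneg_def)
    have lt: "a < x" "x < a + i" "x < b" "b < x + i" using nz by (auto simp: phiE_apply split: if_splits)
    have "(x mod i = 1 \<and> b mod i = 1) \<or> (a mod i = 0 \<and> x mod i = 0)"
      using nz by (auto simp: phiE_apply split: if_splits)
    then have "i dvd (b - x) \<or> i dvd (x - a)"
      using lt by (metis less_imp_le mod_eq_dvd_iff_nat)
    then show False using lt by (auto dest!: dvd_imp_le)
  qed
  then show "mmul n (mneg (phiE i n)) (mneg (phiE i n)) a b = (0 :: 'a sqm) a b"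
    unfolding mmul_def by (simp only: sum.neutral_const if_cancel zero_fun_apply)
qed

lemma mexp_phiE: "mexp_nil n (mneg (phiE i n)) = mid n + (mneg (phiE i n) :: 'a::field_char_0 sqm)"
  using i by (intro mexp_nil_square_0 phiE_square) auto

text \<open>In the first i rows residues are the indices themselves, and products of consecutive
  coefficients are again falling factorials, starting from i - b or from a - 1 according to the sign
  of n modulo i.\<close>

lemma mpow_phiZ:
  assumes "a \<in> {1..i}" "b \<in> {1..n}"
  shows "mpow n (mneg (phiZ i n)) k a b = (if a = b + k then
     (if pl then (- 1) ^ k * (fact k * of_nat ((i - b) choose k)) else fact k * of_nat ((a - 1) choose k)) else (0::'a::field_char_0))"
  using assms(1)
proof (induction k arbitrary: a)
  case 0
  then show ?case using assms i by (auto simp: mid_def)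
next
  case (Suc k)
  have a: "a \<in> {1..n}" using Suc.prems i by auto
  let ?z = "if pl then - of_nat (i - (a - 1)) else of_nat (a - 1) :: 'a"
  have "mpow n (mneg (phiZ i n)) (Suc k) a b
      = (\<Sum>x\<in>{1..n}. if x = a - 1 then ?z * mpow n (mneg (phiZ i n)) k x b else 0)"
    unfolding mpow_Suc mmul_apply[OF a assms(2)]
  proof (intro sum.cong refl)
    fix x assume x: "x \<in> {1..n}"
    show "mneg (phiZ i n) a x * mpow n (mneg (phiZ i n)) k x b = (if x = a - 1 then ?z * mpow n (mneg (phiZ i n)) k x b else 0)"
    proof (cases "x = a - 1")
      case True
      then have ax: "a = x + 1" using x by auto
      then have "x mod i = x" "x \<noteq> 0" using x Suc.prems by auto
      then have "phiZ i n a x = - ?z" using x a unfolding phiZ_apply ax by simp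
      then show ?thesis using True by (simp add: mneg_def)
    next
      case False
      then have "phiZ i n a x = (0::'a)" by (auto simp: phiZ_apply)
      then show ?thesis using False by (simp add: mneg_def)
    qed
  qed
  also have "\<dots> = (if 2 \<le> a then ?z * mpow n (mneg (phiZ i n)) k (a - 1) b else 0)"
    by (subst sum.delta) (use a in auto)
  also have "\<dots> = (if a = b + Suc k then (if pl then (- 1) ^ Suc k * (fact (Suc k) * of_nat ((i - b) choose Suc k))
      else fact (Suc k) * of_nat ((a - 1) choose Suc k)) else 0)"
  proof (cases "2 \<le> a \<and> a = b + Suc k")
    case True
    then have a1: "a - 1 \<in> {1..i}" "a - 1 = b + k" using Suc.prems by auto
    note IH = Suc.IH[OF a1(1)]
    show ?thesis
    proof (cases pl)
      case pl: True
      have "of_nat (i - (b + k)) * (fact k * of_nat ((i - b) choose k)) = fact k * (of_nat ((i - b - k) * ((i - b) choose k)) :: 'a)"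
        by (simp add: diff_diff_add)
      also have "\<dots> = fact (Suc k) * of_nat ((i - b) choose Suc k)"
        unfolding choose_absorb_comp by (simp add: algebra_simps)
      finally have e: "of_nat (i - (b + k)) * (fact k * of_nat ((i - b) choose k)) = (fact (Suc k) * of_nat ((i - b) choose Suc k) :: 'a)" .
      have "?z * mpow n (mneg (phiZ i n)) k (a - 1) b = (- 1) ^ Suc k * (of_nat (i - (b + k)) * (fact k * of_nat ((i - b) choose k)))"
        using pl IH a1(2) by simp
      then show ?thesis unfolding e using True pl by simp
    next
      case False
      have "1 \<le> a - 1" using a1(1) by auto
      then have "of_nat (a - 1) * (fact k * of_nat ((a - 1 - 1) choose k)) = (fact (Suc k) * of_nat ((a - 1) choose Suc k) :: 'a)"
        using choose_pred_absorb[of "a - 1" k] by (metis (no_types, lifting) fact_Suc mult.assoc mult.left_commute of_nat_mult)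
      then show ?thesis using True False IH a1(2) by simp
    qed
  next
    case False
    have "a - 1 \<in> {1..i}" if "2 \<le> a" using that Suc.prems by auto
    then show ?thesis using False Suc.IH[of "a - 1"] assms(2) by auto
  qed
  finally show ?case .
qed

lemma mexp_phiZ:
  assumes "a \<in> {1..i}" "b \<in> {1..n}"
  shows "mexp_nil n (mneg (phiZ i n)) a b = (if b \<le> a then
     (if pl then (- 1) ^ (a - b) * of_nat ((i - b) choose (a - b)) else of_nat ((a - 1) choose (b - 1))) else (0::'a::field_char_0))"
proof (cases "b \<le> a")
  case True
  have "(a - 1) choose (a - b) = (a - 1) choose (b - 1)"
    using True assms binomial_symmetric[of "b - 1" "a - 1"] by simp
  moreover have "mexp_nil n (mneg (phiZ i n)) a b = mpow n (mneg (phiZ i n)) (a - b) a b / (fact (a - b) :: 'a)"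
    using True by (intro mexp_nil_single) (use assms i in \<open>auto simp: mpow_phiZ\<close>)
  ultimately show ?thesis using True by (simp add: mpow_phiZ[OF assms])
next
  case False
  then show ?thesis by (simp add: mexp_nil_def mpow_phiZ[OF assms])
qed

lemma btri_phi: "btri i n (phiX i n :: 'a::field_char_0 sqm)" "btri i n (phiZ i n :: 'a sqm)" "btri i n (phiE i n :: 'a sqm)"
proof -
  show "btri i n (phiX i n :: 'a sqm)" by (auto simp: btri_def phiX_apply)
  show "btri i n (phiE i n :: 'a sqm)" by (auto simp: btri_def phiE_apply)
  have "b = i" if "b + 1 \<in> {i<..n}" "b \<in> {1..i}" for b using that by auto
  then have "b mod i = 0" if "b + 1 \<in> {i<..n}" "b \<in> {1..i}" for b using that by fastforce
  then have "phiZ i n a b = (0::'a)" if "a \<in> {i<..n}" "b \<in> {1..i}" for a b using that unfolding phiZ_apply by metis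
  then show "btri i n (phiZ i n :: 'a sqm)" by (simp add: btri_def)
qed

end

context cg_shape
begin

abbreviation (input) "expX \<equiv> mexp_nil n (mneg (phiX i n))"
abbreviation (input) "expZ \<equiv> mexp_nil n (mneg (phiZ i n))"
abbreviation (input) "expE \<equiv> mexp_nil n (mneg (phiE i n))"

lemma nil_phi:
  "n \<le> k \<Longrightarrow> mpow n (phiX i n :: 'a::field_char_0 sqm) k = 0"
  "n \<le> k \<Longrightarrow> mpow n (phiZ i n :: 'a sqm) k = 0"
  "n \<le> k \<Longrightarrow> mpow n (phiE i n :: 'a sqm) k = 0"
proof -
  have "strict_tri int (phiX i n :: 'a sqm)" "strict_tri (\<lambda>j. - int j) (phiZ i n :: 'a sqm)" "strict_tri int (phiE i n :: 'a sqm)"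
    using strict_tri_phiX[OF i(1), of n, where ?'a='a] strict_tri_phiZ[where ?'a='a] strict_tri_phiE[where ?'a='a]
    by (simp_all add: strict_tri_def mneg_def)
  moreover assume "n \<le> k"
  ultimately show "mpow n (phiX i n :: 'a sqm) k = 0" "mpow n (phiZ i n :: 'a sqm) k = 0" "mpow n (phiE i n :: 'a sqm) k = 0"
    using i by (auto intro: strict_tri_nilpotent)
qed

lemma nil_neg_phi:
  "n \<le> k \<Longrightarrow> mpow n (mneg (phiX i n :: 'a::field_char_0 sqm)) k = 0"
  "n \<le> k \<Longrightarrow> mpow n (mneg (phiZ i n :: 'a sqm)) k = 0"
  "n \<le> k \<Longrightarrow> mpow n (mneg (phiE i n :: 'a sqm)) k = 0"
  using nil_phi[of k, where ?'a='a] by (simp_all add: mpow_mneg mscale_def fun_eq_iff)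

lemma phi_g_eq: "phi_g i n = mmul n expZ (mmul n expX (expE :: 'a::field_char_0 sqm))"
  by (simp add: phi_g_def phiE_def)

definition "phi_h = mmul n (mmul n (mexp_nil n (phiE i n)) (mexp_nil n (phiX i n))) (mexp_nil n (phiZ i n) :: 'a::field_char_0 sqm)"

lemma mutual_inv_phi: "mutual_inv n (phi_g i n) (phi_h :: 'a::field_char_0 sqm)"
  unfolding phi_g_eq phi_h_def
  by (intro mutual_inv_mmul mutual_inv_mexp_nil nil_phi)

lemma btri_mneg: "btri i n A \<Longrightarrow> btri i n (mneg A :: 'b::group_add sqm)"
  by (simp add: btri_def mneg_def)

lemma btri_phi_g: "btri i n (phi_g i n :: 'a::field_char_0 sqm)"
  and btri_phi_h: "btri i n (phi_h :: 'a::field_char_0 sqm)"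
  unfolding phi_g_eq phi_h_def by (intro btri_mmul btri_mexp_nil btri_mneg btri_phi)+

lemma mdet_phi_g: "mdet n (phi_g i n :: 'a::field_char_0 sqm) = 1"
  unfolding phi_g_eq mdet_mmul
  using i by (simp add: mdet_mexp_nil[OF strict_tri_phiX] mdet_mexp_nil[OF strict_tri_phiZ] mdet_mexp_nil[OF strict_tri_phiE])

text \<open>The integers c_k drop by one when k grows by i, which is [-X, N] = 1 modulo V. At the
  end of a residue class the relation holds because c_k = 0 there.\<close>

lemma phiX_shift:
  "eqlow i n (mmul n (mneg (phiX i n)) (shiftN i n)) (mmul n (shiftN i n) (mneg (phiX i n)) + mscale 1 (mid n :: 'a::field_char_0 sqm))"
  unfolding eqlow_def
proof (intro ballI)
  fix c d assume cd: "c \<in> {i<..n}" "d \<in> {1..n}"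
  have c: "c \<in> {1..n}" using cd by auto
  have "i \<le> n - (c - i)" "n - (c - i) - i = n - c" using cd by auto
  then have "(n - (c - i)) div i = (n - c) div i + 1"
    using i le_div_geq[of i "n - (c - i)"] by simp
  moreover have "(n - c) div i = 0" if "n < c + i" using that cd by (intro div_less) auto
  ultimately show "mmul n (mneg (phiX i n)) (shiftN i n) c d
    = (mmul n (shiftN i n) (mneg (phiX i n)) + mscale 1 (mid n :: 'a sqm)) c d"
    using cd by (auto simp: shiftN_mmul mmul_shiftN[OF c cd(2)] mneg_def phiX_apply mid_def mscale_def)
qed

lemma phiZ_shift:
  "eqlow i n (mmul n (mneg (phiZ i n)) (shiftN i n)) (mmul n (shiftN i n) (mneg (phiZ i n)) + mscale 0 (mid n :: 'a::field_char_0 sqm))"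
  unfolding eqlow_def
proof (intro ballI)
  fix c d assume cd: "c \<in> {i<..n}" "d \<in> {1..n}"
  have c: "c \<in> {1..n}" using cd by auto
  have "phiZ i n (c - i) d = (if d + i \<le> n then phiZ i n c (d + i) else (0::'a))"
    using cd by (auto simp: phiZ_apply)
  then show "mmul n (mneg (phiZ i n)) (shiftN i n) c d
    = (mmul n (shiftN i n) (mneg (phiZ i n)) + mscale 0 (mid n :: 'a sqm)) c d"
    using cd by (simp add: shiftN_mmul mmul_shiftN[OF c cd(2)] mneg_def mscale_def)
qed

text \<open>The entries depend only on residues and on the distance from the diagonal, so the
  relation could fail only where d + i exceeds n. There n = 1 or -1 modulo i would force a multiple
  of i strictly between 0 and i.\<close>

lemma phiE_shift:
  "eqlow i n (mmul n (mneg (phiE i n)) (shiftN i n)) (mmul n (shiftN i n) (mneg (phiE i n)) + mscale 0 (mid n :: 'a::field_char_0 sqm))"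
  unfolding eqlow_def
proof (intro ballI)
  fix c d assume cd: "c \<in> {i<..n}" "d \<in> {1..n}"
  have c: "c \<in> {1..n}" using cd by auto
  have "phiE i n (c - i) d = (if d + i \<le> n then phiE i n c (d + i) else (0::'a))"
  proof (cases "d + i \<le> n")
    case True
    have m1: "(d + i) mod i = d mod i" by simp
    have m2: "(c - i) mod i = c mod i" using cd by (simp add: le_mod_geq[symmetric])
    have "c < d + i \<longleftrightarrow> c - i < d" "d + i < c + i \<longleftrightarrow> d < c - i + i" "d + i - c = d - (c - i)" using cd by auto
    then show ?thesis using True cd m1 m2 unfolding phiE_apply by auto
  next
    case False
    have "phiE i n (c - i) d = (0::'a)"
    proof (rule ccontr)
      assume "phiE i n (c - i) d \<noteq> (0::'a)"
      then have *: "c - i < d" "d < c" "if pl then d mod i = 1 else (c - i) mod i = 0"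
        using cd by (auto simp: phiE_apply split: if_splits)
      show False
      proof (cases pl)
        case True
        have "i dvd (n - d)" using True * pl_iff cd by (metis c atLeastAtMost_iff mod_eq_dvd_iff_nat)
        moreover have "0 < n - d" "n - d < i" using * cd False by auto
        ultimately show False by (auto dest!: dvd_imp_le)
      next
        case npl: False
        have "i dvd c" using npl * cd by (simp add: le_mod_geq[symmetric] dvd_eq_mod_eq_0)
        moreover have "i dvd n + 1" using nm npl by simp
        ultimately have "i dvd n + 1 - c" by (rule dvd_diff_nat[rotated])
        moreover have "0 < n + 1 - c" "n + 1 - c < i" using * cd False by auto
        ultimately show False by (auto dest!: dvd_imp_le)
      qed
    qed
    then show ?thesis using False by simp
  qed
  then show "mmul n (mneg (phiE i n)) (shiftN i n) c d
    = (mmul n (shiftN i n) (mneg (phiE i n)) + mscale 0 (mid n :: 'a sqm)) c d"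
    using cd by (simp add: shiftN_mmul mmul_shiftN[OF c cd(2)] mneg_def mscale_def)
qed

text \<open>N is moved past the three factors one at a time, each preserving V; only exp(-X) leaves
  an additional summand.\<close>

lemma phi_g_shift:
  "eqlow i n (mmul n (shiftN i n) (phi_g i n) + phi_g i n) (mmul n (phi_g i n) (shiftN i n :: 'a::field_char_0 sqm))"
proof -
  let ?N = "shiftN i n :: 'a sqm"
  have z: "mscale 0 A = 0" "mscale 1 A = A" for A :: "'a sqm" by (simp_all add: mscale_def fun_eq_iff)
  have X: "eqlow i n (mmul n expX ?N) (mmul n ?N expX + expX)"
    using mexp_nil_commutator[OF btri_mneg[OF btri_phi(1)] _ msupp_shiftN phiX_shift nil_neg_phi(1), where ?'a='a] by (simp add: z)
  have Z: "eqlow i n (mmul n expZ ?N) (mmul n ?N expZ)"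
    using mexp_nil_commutator[OF btri_mneg[OF btri_phi(2)] _ msupp_shiftN phiZ_shift nil_neg_phi(2), where ?'a='a] by (simp add: z)
  have E: "eqlow i n (mmul n expE ?N) (mmul n ?N expE)"
    using mexp_nil_commutator[OF btri_mneg[OF btri_phi(3)] _ msupp_shiftN phiE_shift nil_neg_phi(3), where ?'a='a] by (simp add: z)
  have bX: "btri i n (expX :: 'a sqm)" and bZ: "btri i n (expZ :: 'a sqm)"
    by (intro btri_mexp_nil btri_mneg btri_phi)+
  have "eqlow i n (mmul n (mmul n expX expE) ?N) (mmul n (mmul n expX ?N) expE)"
    using eqlow_mmul_left[OF bX E] by (simp add: mmul_assoc)
  also have "eqlow i n \<dots> (mmul n ?N (mmul n expX expE) + mmul n expX expE)"
    using eqlow_mmul_right[OF X, of expE] by (simp add: mmul_assoc mmul_add_left)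
  finally have XE: "eqlow i n (mmul n (mmul n expX expE) ?N) (mmul n ?N (mmul n expX expE) + mmul n expX expE)" .
  have "eqlow i n (mmul n (phi_g i n) ?N) (mmul n (mmul n expZ ?N) (mmul n expX expE) + phi_g i n)"
    using eqlow_mmul_left[OF bZ XE] by (simp add: mmul_assoc mmul_add_right phi_g_eq)
  moreover have "eqlow i n (mmul n (mmul n expZ ?N) (mmul n expX expE)) (mmul n ?N (phi_g i n))"
    using eqlow_mmul_right[OF Z, of "mmul n expX expE"] by (simp add: mmul_assoc phi_g_eq)
  ultimately show ?thesis unfolding eqlow_def by simp
qed

section \<open>The first i rows of g\<close>

lemma expXE_apply:
  assumes "y \<in> {1..i}" "u \<in> {1..n}"
  shows "mmul n expX expE y u = expX y u - (\<Sum>w\<in>{1..n}. expX y w * phiE i n w u :: 'a::field_char_0)"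
proof -
  have "y \<in> {1..n}" using assms i by auto
  then have "mmul n expX (mneg (phiE i n)) y u = - (\<Sum>w\<in>{1..n}. expX y w * phiE i n w u :: 'a)"
    using assms(2) by (simp only: mmul_apply) (simp add: mneg_def[of "phiE i n"] sum_negf)
  then show ?thesis by (simp add: mexp_phiE mmul_add_right)
qed

lemma phi_g_apply:
  assumes "c \<in> {1..i}" "u \<in> {1..n}"
  shows "phi_g i n c u = (\<Sum>y\<in>{1..i}. expZ c y * mmul n expX expE y u :: 'a::field_char_0)"
proof -
  have c: "c \<in> {1..n}" using assms i by auto
  have "phi_g i n c u = (\<Sum>y\<in>{1..n}. expZ c y * mmul n expX expE y u :: 'a)"
    unfolding phi_g_eq mmul_apply[OF c assms(2)] ..
  also have "\<dots> = (\<Sum>y\<in>{1..i}. expZ c y * mmul n expX expE y u)"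
    using assms i by (intro sum.mono_neutral_right) (auto simp: mexp_phiZ)
  finally show ?thesis .
qed

text \<open>In the leading block the other two factors act as the identity: X moves columns by i,
  and no E-term has an entry in the first i columns.\<close>

lemma phi_g_first:
  assumes "c \<in> {1..i}" "d \<in> {1..i}"
  shows "phi_g i n c d = (expZ c d :: 'a::field_char_0)"
proof -
  have dn: "d \<in> {1..n}" using assms i by auto
  have E: "phiE i n w d = (0::'a)" for w
  proof (rule ccontr)
    assume "phiE i n w d \<noteq> (0::'a)"
    then have "1 \<le> w" "w < d" "if pl then d mod i = 1 else w mod i = 0" by (auto simp: phiE_apply split: if_splits)
    moreover have "d mod i = (if d = i then 0 else d)" "w < i" using assms \<open>w < d\<close> by auto
    ultimately show False by (auto split: if_splits)
  qed
  have X: "expX y d = (if y = d then 1 else (0::'a))" if y: "y \<in> {1..i}" for y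
  proof (cases "y = d")
    case True
    then show ?thesis using mexp_phiX[of y n 0 i, where ?'a='a] dn i by simp
  next
    case False
    have "d \<noteq> y + k * i" for k using y assms False by (cases k) auto
    moreover have "y \<in> {1..n}" using y i by auto
    ultimately show ?thesis using mexp_phiX_0[OF _ dn i(1), of y, where ?'a='a] False by simp
  qed
  have "phi_g i n c d = (\<Sum>y\<in>{1..i}. if y = d then expZ c y else (0::'a))"
    unfolding phi_g_apply[OF assms(1) dn] using dn by (intro sum.cong refl) (simp add: expXE_apply X E)
  then show ?thesis using assms by (simp add: sum.delta)
qed

text \<open>Among the last i columns only column n has residue 1 and meets the E-terms; there the
  alternating binomial sum makes all entries of the first i rows equal. The other columns are
  shifted columns of exp(-Z) up to sign.\<close>

lemma phi_g_last_plus: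
  assumes pl and c: "c \<in> {1..i}" and d: "d \<in> {1..i}"
  shows "phi_g i n c (d + (n - i)) = (if d < i then (- 1) ^ (m - 1) * expZ c (d + 1) else (- 1) ^ m :: 'a::field_char_0)"
proof -
  obtain m' where m': "m = Suc m'" using m_pos by (cases m) auto
  have n: "n = i + m' * i + 1" using nm \<open>pl\<close> m' by simp
  have un: "d + (n - i) \<in> {1..n}" using d i by auto
  show ?thesis
  proof (cases "d < i")
    case True
    have u: "d + (n - i) = (d + 1) + m' * i" using n by simp
    have i2: "1 < i" using True d by auto
    have "((d + 1) + m' * i) mod i = (d + 1) mod i" by simp
    moreover have "(d + 1) mod i \<noteq> 1" using True d by (cases "d + 1 = i") auto
    ultimately have E: "phiE i n w (d + (n - i)) = (0::'a)" for w
      unfolding phiE_apply u using \<open>pl\<close> by simp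
    have "phi_g i n c (d + (n - i)) = (\<Sum>y\<in>{1..i}. if y = d + 1 then expZ c y * (- 1) ^ m' else (0::'a))"
      unfolding phi_g_apply[OF c un]
    proof (intro sum.cong refl)
      fix y assume y: "y \<in> {1..i}"
      have "expX y (d + (n - i)) = (if y = d + 1 then (- 1) ^ m' else (0::'a))"
        unfolding u by (rule mexp_phiX_top) (use y d True n i in auto)
      then show "expZ c y * mmul n expX expE y (d + (n - i)) = (if y = d + 1 then expZ c y * (- 1) ^ m' else (0::'a))"
        unfolding expXE_apply[OF y un] E by simp
    qed
    also have "\<dots> = expZ c (d + 1) * (- 1) ^ m'" using True d by (subst sum.delta) auto
    finally show ?thesis using True m' by simp
  next
    case False
    then have di: "d = i" using d by auto
    have u: "d + (n - i) = n" using di i by simp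
    have nn: "n \<in> {1..n}" using i by auto
    \<comment> \<open>For y = 1 the value comes from exp(-X), for y > 1 from the E-terms; C(i, 0) =
      1 lets one formula cover both.\<close>
    have K: "mmul n expX expE y n = (- 1) ^ m * (of_nat (i choose (y - 1)) :: 'a)" if y: "y \<in> {1..i}" for y
    proof -
      have "expX y (1 + m * i) = (if y = 1 then (- 1) ^ m else (0::'a))"
        by (rule mexp_phiX_top) (use y i n m' in auto)
      then have Xn: "expX y n = (if y = 1 then (- 1) ^ m else (0::'a))" using n m' by (simp add: add.commute add.left_commute)
      have "(\<Sum>w\<in>{1..n}. expX y w * phiE i n w n)
          = (\<Sum>w\<in>{1..n}. if w = y + m' * i then (if y = 1 then 0 else (- 1) ^ m' * (of_nat (i choose (y - 1)) :: 'a)) else 0)"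
      proof (intro sum.cong refl)
        fix w assume w: "w \<in> {1..n}"
        show "expX y w * phiE i n w n = (if w = y + m' * i then (if y = 1 then 0 else (- 1) ^ m' * (of_nat (i choose (y - 1)) :: 'a)) else 0)"
        proof (cases "w < n \<and> n < w + i")
          case True
          define z where "z = w - m' * i"
          have z: "z \<in> {1..i}" "w = z + m' * i" "2 \<le> z" using True n unfolding z_def by auto
          have "expX y w = (if y = z then (- 1) ^ m' else (0::'a))"
            unfolding z(2) by (rule mexp_phiX_top) (use y z n i in auto)
          moreover have "phiE i n w n = (of_nat (i choose (z - 1)) :: 'a)"
          proof -
            have "n - w = i - (z - 1)" using z n by auto
            moreover have "i choose (i - (z - 1)) = i choose (z - 1)" using binomial_symmetric[of "z - 1" i] z by auto
            ultimately show ?thesis using True w nn \<open>pl\<close> pl_iff by (simp add: phiE_apply)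
          qed
          ultimately show ?thesis using z by auto
        next
          case False
          then have "phiE i n w n = (0::'a)" by (auto simp: phiE_apply)
          moreover have "w = y + m' * i \<longrightarrow> y = 1" using False y n by auto
          ultimately show ?thesis by simp
        qed
      qed
      also have "\<dots> = (if y = 1 then 0 else (- 1) ^ m' * of_nat (i choose (y - 1)))"
        using y n by (subst sum.delta) auto
      finally show ?thesis unfolding expXE_apply[OF y nn] Xn by (simp add: m')
    qed
    have "phi_g i n c n = (\<Sum>y\<in>{1..i}. expZ c y * ((- 1) ^ m * (of_nat (i choose (y - 1)) :: 'a)))"
      unfolding phi_g_apply[OF c nn] by (intro sum.cong refl) (simp only: K)
    also have "\<dots> = (\<Sum>y\<in>{1..c}. (- 1) ^ m * ((- 1) ^ (c - y) * of_nat ((i - y) choose (c - y)) * of_nat (i choose (y - 1))))"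
    proof (rule sum.mono_neutral_cong_right)
      show "\<forall>y\<in>{1..i} - {1..c}. expZ c y * ((- 1) ^ m * (of_nat (i choose (y - 1)) :: 'a)) = 0"
        using c i by (auto simp: mexp_phiZ)
      fix y assume y: "y \<in> {1..c}"
      then have "y \<in> {1..n}" using c i by auto
      then show "expZ c y * ((- 1) ^ m * (of_nat (i choose (y - 1)) :: 'a))
        = (- 1) ^ m * ((- 1) ^ (c - y) * of_nat ((i - y) choose (c - y)) * of_nat (i choose (y - 1)))"
        using y \<open>pl\<close> by (simp add: mexp_phiZ[OF c])
    qed (use c in auto)
    also have "\<dots> = (- 1) ^ m" unfolding sum_distrib_left[symmetric] alternating_choose_sum[OF c] by simp
    finally show ?thesis unfolding u using False by simp
  qed
qed

text \<open>The only multiple of i whose row of E-terms reaches these columns is (m - 1) i. It is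
  met through y = i alone, hence corrects only the row c = i.\<close>

lemma phi_g_last_minus:
  assumes "\<not> pl" and c: "c \<in> {1..i}" and d: "d \<in> {1..i}"
  shows "phi_g i n c (d + (n - i)) = (- 1) ^ (m - 1) * ((if 2 \<le> d then expZ c (d - 1) else 0)
      - (if c = i then of_nat (i choose (d - 1)) else 0) :: 'a::field_char_0)"
proof -
  obtain q where q: "m = Suc (Suc q)" using m_ge[OF \<open>\<not> pl\<close>] le_Suc_ex[of 2 m] by auto
  have n: "n + 1 = i + (i + q * i)" using nm \<open>\<not> pl\<close> q by simp
  have un: "d + (n - i) \<in> {1..n}" using d i by auto
  have u: "d + (n - i) = d - 1 + i + q * i" using n d i by auto
  let ?w = "i + q * i"
  have wn: "?w \<in> {1..n}" using n i by auto
  have Xw: "expX y ?w = (if y = i then (- 1) ^ q else (0::'a))" if "y \<in> {1..i}" for y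
    by (rule mexp_phiX_top) (use that n i in auto)
  have K: "mmul n expX expE y (d + (n - i)) = (if y = d - 1 then - ((- 1) ^ q) else 0)
      + (if y = i then (- 1) ^ q * of_nat (i choose (d - 1)) else (0::'a))" if y: "y \<in> {1..i}" for y
  proof -
    have "expX y w * phiE i n w (d + (n - i)) = (if w = ?w then (if y = i \<and> 2 \<le> d then - ((- 1) ^ q * of_nat (i choose (d - 1))) else (0::'a)) else 0)"
      if w: "w \<in> {1..n}" for w
    proof (cases "w = ?w")
      case True
      have "w mod i = 0" unfolding True by simp
      moreover have "d + (n - i) - w = d - 1" "w < d + (n - i) \<longleftrightarrow> 2 \<le> d" "d + (n - i) < w + i"
        unfolding True u using d by auto
      ultimately have "phiE i n w (d + (n - i)) = (if 2 \<le> d then - of_nat (i choose (d - 1)) else (0::'a))"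
        unfolding phiE_apply using w un \<open>\<not> pl\<close> by (simp del: atLeastAtMost_iff)
      then show ?thesis using Xw[OF y] True by simp
    next
      case False
      have "phiE i n w (d + (n - i)) = (0::'a)"
      proof (rule ccontr)
        assume "phiE i n w (d + (n - i)) \<noteq> (0::'a)"
        then have *: "w < d + (n - i)" "d + (n - i) < w + i" "i dvd w"
          using \<open>\<not> pl\<close> by (auto simp: phiE_apply split: if_splits)
        have "i dvd ?w" by simp
        have "w < ?w + i" "?w < w + i" using * u d by auto
        moreover have "w = ?w"
        proof (rule ccontr)
          assume "w \<noteq> ?w"
          then consider "w < ?w" | "?w < w" by linarith
          then show False
          proof cases
            case 1
            have "i dvd ?w - w" using \<open>i dvd ?w\<close> *(3) by (rule dvd_diff_nat)
            then show False using 1 \<open>?w < w + i\<close> by (auto dest!: dvd_imp_le)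
          next
            case 2
            have "i dvd w - ?w" using *(3) \<open>i dvd ?w\<close> by (rule dvd_diff_nat)
            then show False using 2 \<open>w < ?w + i\<close> by (auto dest!: dvd_imp_le)
          qed
        qed
        ultimately show False using False by simp
      qed
      then show ?thesis using False by simp
    qed
    then have S: "(\<Sum>w\<in>{1..n}. expX y w * phiE i n w (d + (n - i))) = (if y = i \<and> 2 \<le> d then - ((- 1) ^ q * of_nat (i choose (d - 1))) else (0::'a))"
      using wn by (simp add: sum.delta del: atLeastAtMost_iff)
    show ?thesis
    proof (cases "2 \<le> d")
      case True
      have "d + (n - i) = (d - 1) + Suc q * i" using u by simp
      moreover have "expX y ((d - 1) + Suc q * i) = (if y = d - 1 then (- 1) ^ Suc q else (0::'a))"
        by (rule mexp_phiX_top) (use y d True n i in auto)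
      ultimately show ?thesis unfolding expXE_apply[OF y un] S using True by simp
    next
      case False
      then have d1: "d = 1" using d by auto
      then have "d + (n - i) = ?w" using u by simp
      then show ?thesis unfolding expXE_apply[OF y un] S using Xw[OF y] y d1 by auto
    qed
  qed
  have ii: "i \<in> {1..i}" using i by auto
  have Zi: "expZ c i = (if c = i then 1 else (0::'a))" using c i \<open>\<not> pl\<close> by (auto simp: mexp_phiZ)
  have "phi_g i n c (d + (n - i)) = (\<Sum>y\<in>{1..i}. if y = d - 1 then - ((- 1) ^ q * expZ c y) else 0)
      + (\<Sum>y\<in>{1..i}. if y = i then (- 1) ^ q * of_nat (i choose (d - 1)) * expZ c y else (0::'a))"
    unfolding phi_g_apply[OF c un] sum.distrib[symmetric] by (intro sum.cong refl) (simp add: K algebra_simps)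
  also have "\<dots> = (if 2 \<le> d then - ((- 1) ^ q * expZ c (d - 1)) else 0) + (- 1) ^ q * of_nat (i choose (d - 1)) * expZ c i"
  proof -
    have "d - 1 \<in> {1..i} \<longleftrightarrow> 2 \<le> d" using d by auto
    then show ?thesis using ii by (simp add: sum.delta del: atLeastAtMost_iff)
  qed
  finally show ?thesis unfolding Zi q by (simp add: algebra_simps)
qed

text \<open>Pascal's rule for the entries of exp(-Z); in row i the absent next row corresponds to a
  vanishing binomial.\<close>

lemma expZ_pascal_plus:
  assumes pl "c \<in> {1..i}" "d \<in> {1..<i}"
  shows "(if c < i then expZ (c + 1) (d + 1) else 0) - expZ c (d + 1) = (expZ c d :: 'a::field_char_0)"
proof -
  have r: "d \<in> {1..n}" "d + 1 \<in> {1..n}" "c + 1 \<in> {1..i} \<longleftrightarrow> c < i" using assms i by auto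
  consider "c < d" | "c = d" | "d < c" by linarith
  then show ?thesis
  proof cases
    case 3
    obtain j where j: "c = d + 1 + j" using 3 less_imp_Suc_add[of d c] by auto
    obtain p where p: "i - d = Suc p" using assms by (cases "i - d") auto
    have p1: "i - (d + 1) = p" using p by simp
    have P: "(i - d) choose (j + 1) = (p choose j) + (p choose (j + 1))"
      using binomial_Suc_Suc[of p j] p by (simp add: Suc_eq_plus1)
    have Z: "expZ (c + 1) (d + 1) = ((- 1) ^ (j + 1) * of_nat (p choose (j + 1)) :: 'a)" if "c < i"
      using assms that r j mexp_phiZ[of "c + 1" "d + 1", where ?'a='a] by (simp add: p1 add.commute[of 1 j])
    have Z': "expZ c (d + 1) = ((- 1) ^ j * of_nat (p choose j) :: 'a)"
      using assms r j mexp_phiZ[of c "d + 1", where ?'a='a] by (simp add: p1)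
    have "expZ c d = ((- 1) ^ (j + 1) * of_nat ((i - d) choose (j + 1)) :: 'a)"
      using assms r j mexp_phiZ[of c d, where ?'a='a] by (simp add: add.commute[of 1 j])
    then have Z'': "expZ c d = ((- 1) ^ (j + 1) * of_nat ((p choose j) + (p choose (j + 1))) :: 'a)" unfolding P .
    have z: "p choose (j + 1) = 0" if "\<not> c < i" using that assms p j by (intro binomial_eq_0) auto
    show ?thesis
    proof (cases "c < i")
      case True
      then show ?thesis unfolding Z' Z'' using Z[OF True] by (simp add: distrib_left power_add)
    next
      case False
      then show ?thesis unfolding Z' Z'' by (simp add: z power_add)
    qed
  qed (use assms r in \<open>auto simp: mexp_phiZ\<close>)
qed

text \<open>Pascal's rule again; here the absent row i + 1 would not vanish, and the explicit
  binomial makes up for it.\<close>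

lemma expZ_pascal_minus:
  assumes "\<not> pl" "c \<in> {1..i}" "d \<in> {1..i}"
  shows "(if c < i then expZ (c + 1) d else 0) - expZ c d
    = ((if 2 \<le> d then expZ c (d - 1) else 0) - (if c = i then of_nat (i choose (d - 1)) else 0) :: 'a::field_char_0)"
proof -
  have Z: "expZ a b = (of_nat ((a - 1) choose (b - 1)) :: 'a)" if "a \<in> {1..i}" "b \<in> {1..i}" for a b
    using that assms(1) i by (auto simp: mexp_phiZ intro!: binomial_eq_0[symmetric])
  have P: "c choose (d - 1) = ((c - 1) choose (d - 1)) + (if 2 \<le> d then (c - 1) choose (d - 1 - 1) else 0)"
    using assms(2,3) by (cases "d - 1"; cases c) auto
  have Zd: "(if 2 \<le> d then expZ c (d - 1) else 0) = (of_nat (if 2 \<le> d then (c - 1) choose (d - 1 - 1) else 0) :: 'a)"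
  proof (cases "2 \<le> d")
    case True
    then have "d - 1 \<in> {1..i}" using assms(3) by auto
    then show ?thesis using True Z[OF assms(2), of "d - 1"] by simp
  qed simp
  show ?thesis
  proof (cases "c < i")
    case True
    then have "expZ (c + 1) d = (of_nat (c choose (d - 1)) :: 'a)" using Z[of "c + 1" d] assms by simp
    then show ?thesis unfolding Zd Z[OF assms(2,3)] P of_nat_add using True by simp
  next
    case False
    then have "i = c" using assms(2) by simp
    then show ?thesis unfolding Zd Z[OF assms(2,3)] using P by simp
  qed
qed

text \<open>The scalar is the sign that exp(-X) puts on the shifted columns of exp(-Z). Its square
  is 1, and with it the opD condition is Pascal's rule.\<close>

lemma gauge_phi: "gauge pl i n (phi_g i n) phi_h ((- 1) ^ (m - 1) :: 'a::field_char_0)"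
proof
  let ?lam = "(- 1) ^ (m - 1) :: 'a"
  have l2: "?lam * ?lam = 1" by (simp add: power_mult_distrib[symmetric])
  show "if pl then res i (phi_g i n) = mscale ?lam (mmul i opD (\<lambda>c s. phi_g i n c (s + (n - i))))
             else mmul i opD (phi_g i n) = mscale ?lam (res i (\<lambda>c s. phi_g i n c (s + (n - i))))"
  proof (cases pl)
    case True
    have m1: "(- 1) ^ m = - ?lam" using m_pos by (cases m) auto
    have "res i (phi_g i n) c d = mscale ?lam (mmul i opD (\<lambda>c s. phi_g i n c (s + (n - i)))) c d" for c d
    proof (cases "c \<in> {1..i} \<and> d \<in> {1..i}")
      case cd: True
      then have cd': "c \<in> {1..i}" "d \<in> {1..i}" "c + 1 \<in> {1..i} \<longleftrightarrow> c < i" by auto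
      note L = phi_g_last_plus[OF True _ cd'(2), where ?'a='a]
      have "mscale ?lam (mmul i opD (\<lambda>c s. phi_g i n c (s + (n - i)))) c d
          = ?lam * ((if c < i then phi_g i n (c + 1) (d + (n - i)) else 0) - phi_g i n c (d + (n - i)))"
        unfolding mscale_def opD_mmul[OF cd'(1,2)] ..
      also have "\<dots> = expZ c d"
      proof (cases "d < i")
        case d: True
        have "?lam * ((if c < i then phi_g i n (c + 1) (d + (n - i)) else 0) - phi_g i n c (d + (n - i)))
            = ?lam * ?lam * ((if c < i then expZ (c + 1) (d + 1) else 0) - expZ c (d + 1))"
          using cd' d L[of c] L[of "c + 1"] by (simp add: algebra_simps del: atLeastAtMost_iff)
        also have "\<dots> = expZ c d" using expZ_pascal_plus[OF True cd'(1), of d, where ?'a='a] d cd' l2 by simp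
        finally show ?thesis .
      next
        case d: False
        then have "d = i" using cd' by auto
        have "expZ c d = (if c < i then 0 else 1 :: 'a)" using cd' i True \<open>d = i\<close> by (auto simp: mexp_phiZ)
        moreover have "?lam * ((if c < i then phi_g i n (c + 1) (d + (n - i)) else 0) - phi_g i n c (d + (n - i)))
            = (if c < i then 0 else ?lam * ?lam)"
          using cd' d L[of c] L[of "c + 1"] by (simp add: m1 del: atLeastAtMost_iff)
        ultimately show ?thesis using l2 by simp
      qed
      finally show ?thesis using cd cd' phi_g_first[OF cd'(1,2), where ?'a='a] by (simp add: res_def)
    next
      case False
      then show ?thesis by (auto simp: res_def mscale_def mmul_def)
    qed
    then show ?thesis using True by (auto simp: fun_eq_iff)
  next
    case False
    have "mmul i opD (phi_g i n) c d = mscale ?lam (res i (\<lambda>c s. phi_g i n c (s + (n - i)))) c d" for c d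
    proof (cases "c \<in> {1..i} \<and> d \<in> {1..i}")
      case cd: True
      then have cd': "c \<in> {1..i}" "d \<in> {1..i}" "c + 1 \<in> {1..i} \<longleftrightarrow> c < i" by auto
      have "mmul i opD (phi_g i n) c d = (if c < i then expZ (c + 1) d else 0) - (expZ c d :: 'a)"
        unfolding opD_mmul[OF cd'(1,2)] using phi_g_first[OF _ cd'(2), where ?'a='a] cd' by (simp del: atLeastAtMost_iff)
      also have "\<dots> = ?lam * (?lam * ((if 2 \<le> d then expZ c (d - 1) else 0) - (if c = i then of_nat (i choose (d - 1)) else 0)))"
        unfolding expZ_pascal_minus[OF False cd'(1,2)] mult.assoc[symmetric] l2 by simp
      also have "\<dots> = ?lam * phi_g i n c (d + (n - i))" unfolding phi_g_last_minus[OF False cd'(1,2)] ..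
      finally show ?thesis using cd by (simp add: mscale_def res_def)
    next
      case False
      then show ?thesis by (auto simp: res_def mscale_def mmul_def)
    qed
    then show ?thesis using False by (auto simp: fun_eq_iff)
  qed
qed (use i mutual_inv_phi btri_phi_g btri_phi_h phi_g_shift in auto)

end

section \<open>The one-parameter family and its limits\<close>

lemma sum4_single:
  fixes F :: "nat \<Rightarrow> nat \<Rightarrow> nat \<Rightarrow> nat \<Rightarrow> 'a::comm_monoid_add"
  assumes "finite S" "a \<in> S" "b \<in> S" "c \<in> S" "d \<in> S"
    and z: "\<And>j k l m. F j k l m \<noteq> 0 \<Longrightarrow> j = a \<and> k = b \<and> l = c \<and> m = d"
  shows "(\<Sum>j\<in>S. \<Sum>k\<in>S. \<Sum>l\<in>S. \<Sum>m\<in>S. F j k l m) = F a b c d"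
proof -
  have single: "sum f S = f x" if "x \<in> S" "\<And>y. y \<noteq> x \<Longrightarrow> f y = 0" for f :: "nat \<Rightarrow> 'a" and x
    using sum.mono_neutral_right[of S "{x}" f] assms(1) that by auto
  have "(\<Sum>j\<in>S. \<Sum>k\<in>S. \<Sum>l\<in>S. \<Sum>m\<in>S. F j k l m) = (\<Sum>k\<in>S. \<Sum>l\<in>S. \<Sum>m\<in>S. F a k l m)"
    by (rule single[OF assms(2)]) (intro sum.neutral ballI, use z in blast)
  also have "\<dots> = (\<Sum>l\<in>S. \<Sum>m\<in>S. F a b l m)"
    by (rule single[OF assms(3)]) (intro sum.neutral ballI, use z in blast)
  also have "\<dots> = (\<Sum>m\<in>S. F a b c m)"
    by (rule single[OF assms(4)]) (intro sum.neutral ballI, use z in blast)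
  also have "\<dots> = F a b c d" by (rule single[OF assms(5)]) (use z in blast)
  finally show ?thesis .
qed

lemma mutual_inv_tpowH:
  assumes "(t::'a::field) \<noteq> 0"
  shows "mutual_inv n (tpowH i n t) (tpowH i n (inverse t))"
proof -
  have D: "mmul n (tpowH i n s) (tpowH i n (inverse s)) = mid n" if "s \<noteq> 0" for s :: 'a
  proof (intro ext)
    fix a b
    show "mmul n (tpowH i n s) (tpowH i n (inverse s)) a b = mid n a b"
    proof (cases "a \<in> {1..n} \<and> b \<in> {1..n}")
      case True
      then have ab: "a \<in> {1..n}" "b \<in> {1..n}" by auto
      have "mmul n (tpowH i n s) (tpowH i n (inverse s)) a b
          = (\<Sum>x\<in>{1..n}. if x = a then (if a = b then s powi Hexp i n a * inverse s powi Hexp i n a else 0) else 0)"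
        unfolding mmul_apply[OF ab] by (intro sum.cong refl) (use ab in \<open>auto simp: tpowH_def\<close>)
      also have "\<dots> = mid n a b" using True that by (simp add: mid_def sum.delta power_int_mult_distrib[symmetric])
      finally show ?thesis .
    next
      case False
      then have *: "a \<notin> {1..n} \<or> b \<notin> {1..n}" by blast
      show ?thesis unfolding msuppD[OF msupp_mmul *] msuppD[OF msupp_mid *] ..
    qed
  qed
  have "msupp n (tpowH i n s)" for s :: 'a by (rule msuppI) (auto simp: tpowH_def)
  then show ?thesis using D[of t] D[of "inverse t"] assms by (simp add: mutual_inv_def)
qed

text \<open>The trace correction in \<open>Hexp\<close> cancels between the two indices of each leg,
  so the exponent is 2n times the H-weight.\<close>

lemma act_tpowH:
  fixes T :: "'a::field tens2"
  assumes "t \<noteq> 0" "hweight i n w T" "T \<in> W n"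
  shows "act n (tpowH i n t) T = tscale (t powi (2 * int n * w)) T"
proof (intro ext)
  fix a b c d
  show "act n (tpowH i n t) T a b c d = tscale (t powi (2 * int n * w)) T a b c d"
  proof (cases "a \<in> {1..n} \<and> b \<in> {1..n} \<and> c \<in> {1..n} \<and> d \<in> {1..n}")
    case True
    then have R: "a \<in> {1..n}" "b \<in> {1..n}" "c \<in> {1..n}" "d \<in> {1..n}" by auto
    let ?D = "tpowH i n t" and ?D' = "tpowH i n (inverse t)"
    have "act n ?D T a b c d = ?D a a * T a b c d * ?D' b b * ?D c c * ?D' d d"
      unfolding act_apply[OF mutual_inv_tpowH[OF assms(1)] R]
      by (rule sum4_single) (use R in \<open>auto simp: tpowH_def split: if_splits\<close>)
    also have "\<dots> = t powi Hexp i n a * T a b c d * inverse t powi Hexp i n b * t powi Hexp i n c * inverse t powi Hexp i n d"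
      using R by (simp add: tpowH_def)
    also have "\<dots> = t powi (Hexp i n a + (- Hexp i n b) + Hexp i n c + (- Hexp i n d)) * T a b c d"
      using assms(1) by (simp add: power_int_add power_int_minus power_int_inverse mult_ac del: add_uminus_conv_diff)
    also have "\<dots> = t powi (2 * int n * w) * T a b c d"
    proof (cases "T a b c d = 0")
      case False
      then have h: "Hbase i a + Hbase i c = Hbase i b + Hbase i d + w"
        using assms(2) R unfolding hweight_def by blast
      have "Hexp i n a + (- Hexp i n b) + Hexp i n c + (- Hexp i n d)
          = 2 * int n * ((Hbase i a + Hbase i c) - (Hbase i b + Hbase i d))"
        by (simp add: Hexp_def algebra_simps)
      also have "\<dots> = 2 * int n * w" unfolding h by simp
      finally show ?thesis by simp
    qed simp
    finally show ?thesis by (simp add: tscale_def)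
  next
    case False
    then have *: "a \<notin> {1..n} \<or> b \<notin> {1..n} \<or> c \<notin> {1..n} \<or> d \<notin> {1..n}" by blast
    show ?thesis unfolding act_supp[OF *] using W_supp[OF assms(3), of a b c d] * by (simp add: tscale_def)
  qed
qed

lemma act_tadd: "mutual_inv n g h \<Longrightarrow> act n g (tadd S T) = tadd (act n g S) (act n g T)"
  by (intro ext) (simp add: act_def tadd_def Let_def sum.distrib algebra_simps)

lemma W_tadd_tscale:
  assumes "X \<in> W n" "Y \<in> W n"
  shows "tadd X (tscale s Y) \<in> W n"
  unfolding W_def
proof (intro CollectI conjI allI impI)
  fix j k l m
  show "tadd X (tscale s Y) j k l m = - tadd X (tscale s Y) l m j k"
    unfolding tadd_def tscale_def by (subst W_skew[OF assms(1)], subst W_skew[OF assms(2)]) simp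
  assume "\<not> (inR n j \<and> inR n k \<and> inR n l \<and> inR n m)"
  then have "X j k l m = 0" "Y j k l m = 0" using assms unfolding W_def by blast+
  then show "tadd X (tscale s Y) j k l m = 0" by (simp add: tadd_def tscale_def)
next
  fix l m
  have "(\<Sum>j\<in>{1..n}. X j j l m) = 0" "(\<Sum>j\<in>{1..n}. Y j j l m) = 0" using assms unfolding W_def by blast+
  then show "(\<Sum>j\<in>{1..n}. tadd X (tscale s Y) j j l m) = 0"
    by (simp add: tadd_def tscale_def sum.distrib sum_distrib_left[symmetric])
qed

lemma W_tscale: "X \<in> W n \<Longrightarrow> tscale s X \<in> W n"
  using W_tadd_tscale[of X n X "s - 1"] by (simp add: tadd_def tscale_def algebra_simps)

section \<open>Polynomial dependence on the parameter\<close>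

lemma sum_quadratic:
  fixes F :: "'b \<Rightarrow> 'a::comm_ring_1"
  assumes "\<And>x. F x = P x + s * Q x + s\<^sup>2 * R x"
  shows "sum F S = sum P S + s * sum Q S + s\<^sup>2 * sum R S"
  unfolding assms sum.distrib sum_distrib_left ..

lemma cybe_quadratic:
  assumes X: "X \<in> W n" and Y: "Y \<in> W n"
  shows "\<exists>L. \<forall>s. cybe n (tadd X (tscale s Y)) a b c d e f = cybe n X a b c d e f + s * L + s\<^sup>2 * cybe n Y a b c d e f"
proof -
  let ?S = "{1..n}"
  let ?L1 = "\<Sum>x\<in>?S. X a x c d * Y x b e f + Y a x c d * X x b e f - X a x e f * Y x b c d - Y a x e f * X x b c d"
  let ?L2 = "\<Sum>x\<in>?S. X a b c x * Y x d e f + Y a b c x * X x d e f - X c x e f * Y a b x d - Y c x e f * X a b x d"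
  let ?L3 = "\<Sum>x\<in>?S. X a b e x * Y c d x f + Y a b e x * X c d x f - X c d e x * Y a b x f - Y c d e x * X a b x f"
  have "cybe n (tadd X (tscale s Y)) a b c d e f
      = cybe n X a b c d e f + s * (?L1 + ?L2 + ?L3) + s\<^sup>2 * cybe n Y a b c d e f" for s
  proof -
    let ?r = "tadd X (tscale s Y)"
    have 1: "(\<Sum>x\<in>?S. ?r a x c d * ?r x b e f - ?r a x e f * ?r x b c d)
      = (\<Sum>x\<in>?S. X a x c d * X x b e f - X a x e f * X x b c d) + s * ?L1
        + s\<^sup>2 * (\<Sum>x\<in>?S. Y a x c d * Y x b e f - Y a x e f * Y x b c d)"
      by (rule sum_quadratic) (simp add: tadd_def tscale_def algebra_simps power2_eq_square)
    have 2: "(\<Sum>x\<in>?S. ?r a b c x * ?r x d e f - ?r c x e f * ?r a b x d)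
      = (\<Sum>x\<in>?S. X a b c x * X x d e f - X c x e f * X a b x d) + s * ?L2
        + s\<^sup>2 * (\<Sum>x\<in>?S. Y a b c x * Y x d e f - Y c x e f * Y a b x d)"
      by (rule sum_quadratic) (simp add: tadd_def tscale_def algebra_simps power2_eq_square)
    have 3: "(\<Sum>x\<in>?S. ?r a b e x * ?r c d x f - ?r c d e x * ?r a b x f)
      = (\<Sum>x\<in>?S. X a b e x * X c d x f - X c d e x * X a b x f) + s * ?L3
        + s\<^sup>2 * (\<Sum>x\<in>?S. Y a b e x * Y c d x f - Y c d e x * Y a b x f)"
      by (rule sum_quadratic) (simp add: tadd_def tscale_def algebra_simps power2_eq_square)
    show ?thesis
      unfolding cybe_expand[OF W_tadd_tscale[OF X Y]] cybe_expand[OF X] cybe_expand[OF Y] 1 2 3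
      by (simp only: distrib_left add_ac)
  qed
  then show ?thesis by blast
qed

lemma cybe_tscale:
  assumes "X \<in> W n"
  shows "cybe n (tscale s X) a b c d e f = s\<^sup>2 * cybe n X a b c d e f"
proof -
  have "(\<Sum>x\<in>{1..n}. (s * P x) * (s * Q x) - (s * P' x) * (s * Q' x)) = s\<^sup>2 * (\<Sum>x\<in>{1..n}. P x * Q x - P' x * Q' x)" for P Q P' Q' :: "nat \<Rightarrow> 'a"
    unfolding sum_distrib_left by (intro sum.cong refl) (simp add: algebra_simps power2_eq_square)
  then show ?thesis
    unfolding cybe_expand[OF W_tscale[OF assms]] cybe_expand[OF assms] by (simp add: tscale_def distrib_left)
qed

text \<open>The map taking t to t^k need not be onto, but in characteristic 0 the k-th powers of the
  positive integers already give infinitely many roots.\<close>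

lemma poly_eq_0_of_powers:
  fixes p :: "'a::field_char_0 poly"
  assumes "\<And>t. t \<noteq> 0 \<Longrightarrow> poly p (t ^ k) = 0" "0 < k"
  shows "p = 0"
proof (rule ccontr)
  assume "p \<noteq> 0"
  then have "finite {x. poly p x = 0}" by (rule poly_roots_finite)
  moreover have "range (\<lambda>j. of_nat (Suc j ^ k)) \<subseteq> {x. poly p x = 0}"
    using assms(1)[of "of_nat (Suc _)"] by (auto simp del: of_nat_Suc)
  moreover have "inj (\<lambda>j. of_nat (Suc j ^ k) :: 'a)"
    using assms(2) by (auto simp: inj_def power_eq_iff_eq_base simp del: of_nat_power power_Suc)
  ultimately show False using finite_subset range_inj_infinite by blast
qed

lemma polyfun_line:
  assumes "p \<in> polyfun"
  shows "\<exists>P. \<forall>s. p (tadd A (tscale s B)) = poly P s"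
  using assms
proof induction
  case (pconst c)
  show ?case by (intro exI[of _ "[:c:]"]) simp
next
  case (pcoord j k l m)
  show ?case by (intro exI[of _ "[:A j k l m, B j k l m:]"]) (simp add: tadd_def tscale_def)
next
  case (padd p q)
  then obtain P Q where "\<forall>s. p (tadd A (tscale s B)) = poly P s" "\<forall>s. q (tadd A (tscale s B)) = poly Q s" by blast
  then show ?case by (intro exI[of _ "P + Q"]) simp
next
  case (pmul p q)
  then obtain P Q where "\<forall>s. p (tadd A (tscale s B)) = poly P s" "\<forall>s. q (tadd A (tscale s B)) = poly Q s" by blast
  then show ?case by (intro exI[of _ "P * Q"]) simp
qed

lemma proj_closure_line:
  fixes A B :: "'a::field_char_0 tens2"
  assumes "A \<in> W n" "A \<noteq> (\<lambda>_ _ _ _. 0)" "0 < k"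
    and S: "\<And>t. t \<noteq> 0 \<Longrightarrow> tadd A (tscale (t ^ k) B) \<in> S"
  shows "A \<in> proj_closure n S"
proof -
  have "p A = 0" if p: "p \<in> polyfun" and z: "\<forall>y\<in>S. p y = 0" for p
  proof -
    obtain P where P: "\<And>s. p (tadd A (tscale s B)) = poly P s" using polyfun_line[OF p] by blast
    have "poly P (t ^ k) = 0" if "t \<noteq> 0" for t using S[OF that] z P by metis
    then have "P = 0" using assms(3) by (rule poly_eq_0_of_powers)
    then show ?thesis using P[of 0] by (simp add: tadd_def tscale_def)
  qed
  then show ?thesis using assms(1,2) by (simp add: proj_closure_def)
qed

text \<open>The factor k admits rescaled tensors, whose Yang--Baxter expression is multiplied by the
  square of the scalar.\<close>

lemma MCYBE_I:
  assumes "(r :: 'a::field_char_0 tens2) \<in> W n" "2 \<le> n" "k \<noteq> 0"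
    and c: "\<And>a b c d e f. cybe n r a b c d e f = k * casimir3 n a b c d e f"
  shows "r \<in> MCYBE n"
proof -
  have e: "cybe n r = (\<lambda>a b c d e f. k * casimir3 n a b c d e f)" using c by (intro ext)
  obtain a b c d e f where "casimir3 n a b c d e f \<noteq> (0::'a)" using casimir3_nonzero[OF assms(2), where ?'a='a] by (metis ext)
  then have "cybe n r a b c d e f \<noteq> 0" using assms(3) by (simp add: e)
  then have nz: "cybe n r \<noteq> (\<lambda>_ _ _ _ _ _. 0)" by metis
  have "lie_act3 n x (cybe n r) = (\<lambda>_ _ _ _ _ _. 0)" if "x \<in> sl n" for x
  proof -
    have "msupp n x" using that by (simp add: sl_def)
    then have "lie_act3 n x (casimir3 n) = (\<lambda>_ _ _ _ _ _. 0)" by (rule casimir3_invariant)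
    moreover have "lie_act3 n x (cybe n r) = (\<lambda>a b c d e f. k * lie_act3 n x (casimir3 n) a b c d e f)"
      unfolding e lie_act3_def by (intro ext) (simp add: distrib_left sum_distrib_left algebra_simps)
    ultimately show ?thesis by simp
  qed
  then show ?thesis using assms(1) nz by (simp add: MCYBE_def)
qed

context cg_shape
begin

lemma coprime_in: "coprime i n"
proof (rule coprimeI)
  fix k assume k: "k dvd i" "k dvd n"
  show "is_unit k"
  proof (cases pl)
    case True
    then have "k dvd m * i + 1" using nm k by simp
    then show ?thesis using k(1) by (simp add: dvd_add_right_iff)
  next
    case False
    then have "k dvd n + 1" using nm k by simp
    then show ?thesis using k(2) by (simp add: dvd_add_right_iff)
  qed
qed

lemma sum_Hexp: "(\<Sum>j\<in>{1..n}. Hexp i n j) = 0"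
  by (simp add: Hexp_def sum_subtractf sum_distrib_left[symmetric])

lemma Phi_in_SL:
  assumes "(t::'a::field_char_0) \<noteq> 0"
  shows "Phi i n t \<in> SL n"
proof -
  have P: "(\<Prod>j\<in>S. t powi f j) = t powi (\<Sum>j\<in>S. f j)" if "finite S" for S and f :: "nat \<Rightarrow> int"
    using that by induction (simp_all add: power_int_add assms)
  have "mdet n (tpowH i n t) = (\<Prod>j\<in>{1..n}. tpowH i n t j j)"
    by (rule mdet_triangular) (auto simp: tpowH_def)
  also have "\<dots> = (\<Prod>j\<in>{1..n}. t powi Hexp i n j)" by (intro prod.cong refl) (simp add: tpowH_def)
  also have "\<dots> = 1" by (simp add: P sum_Hexp)
  finally show ?thesis by (simp add: SL_def Phi_def mdet_mmul mdet_phi_g)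
qed

lemma act_Phi:
  assumes t: "(t::'a::field_char_0) \<noteq> 0"
  shows "act n (Phi i n t) (rCG i n) = tadd lim0 (tscale (t ^ (2 * n)) lim1)"
    and "cybe n (act n (Phi i n t) (rCG i n)) = casimir3 n"
proof -
  let ?D = "tpowH i n t" and ?D' = "tpowH i n (inverse t)" and ?G = "cgG i n :: 'a sqm \<Rightarrow> 'a sqm \<Rightarrow> bool"
  have MD: "mutual_inv n ?D ?D'" by (rule mutual_inv_tpowH[OF t])
  have MP: "mutual_inv n (Phi i n t) (mmul n phi_h ?D')"
    unfolding Phi_def by (rule mutual_inv_mmul[OF MD mutual_inv_phi])
  let ?GP = "conjG n (Phi i n t) (mmul n phi_h ?D') ?G"
  \<comment> \<open>Conjugation by \<Phi>(t) is conjugation by g followed by the torus element, so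
    the transformed r and the transformed limit tensors have their graphs in one set.\<close>
  have GP: "?GP = conjG n ?D ?D' (conjG n (phi_g i n) phi_h ?G)"
    unfolding conjG_def Phi_def conj_by_def by (simp add: mmul_assoc)
  have n0: "0 < n" using i by simp
  have mP: "manin n ?GP" by (rule manin_conjG[OF MP manin_cgG[OF i(2)]])
  have rW: "(rCG i n :: 'a tens2) \<in> W n" by (rule rCG_in_W[OF i(2) coprime_in])
  have gr: "rgraph n (act n (Phi i n t) (rCG i n)) ?GP"
    by (rule rgraph_act[OF MP rW rgraph_rCG[OF i coprime_in]])
  have lW: "(tadd lim0 lim1 :: 'a tens2) \<in> W n"
    using W_tadd_tscale[OF lim0_in_W lim1_in_W, of 1] by (simp add: tscale_def)
  have aW: "act n (Phi i n t) (rCG i n) \<in> W n" by (rule act_in_W[OF MP rW])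
  have "act n (Phi i n t) (rCG i n) = act n ?D (tadd lim0 lim1)"
    by (rule rgraph_unique[OF mP aW gr act_in_W[OF MD lW] _ n0])
      (unfold GP, rule rgraph_act[OF MD lW rgraph_lims[OF gauge_phi]])
  also have "\<dots> = tadd lim0 (tscale (t ^ (2 * n)) lim1)"
    unfolding act_tadd[OF MD] act_tpowH[OF t hweight_lim0 lim0_in_W] act_tpowH[OF t hweight_lim1 lim1_in_W]
    using power_int_of_nat[of t "2 * n"] by (simp add: tscale_def)
  finally show "act n (Phi i n t) (rCG i n) = tadd lim0 (tscale (t ^ (2 * n)) lim1)" .
  show "cybe n (act n (Phi i n t) (rCG i n)) = casimir3 n"
    by (rule cybe_eq_casimir3[OF mP aW gr n0])
qed

lemma cybe_lims:
  "cybe n (lim0 :: 'a::field_char_0 tens2) = casimir3 n" "cybe n (lim1 :: 'a tens2) = (\<lambda>_ _ _ _ _ _. 0)"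
proof -
  have "cybe n lim0 a b c d e f = (casimir3 n a b c d e f :: 'a) \<and> cybe n lim1 a b c d e f = (0::'a)" for a b c d e f
  proof -
    obtain L where L: "\<And>s. cybe n (tadd lim0 (tscale s lim1)) a b c d e f
        = cybe n lim0 a b c d e f + s * L + s\<^sup>2 * (cybe n lim1 a b c d e f :: 'a)"
      using cybe_quadratic[OF lim0_in_W lim1_in_W] by blast
    let ?P = "[:cybe n lim0 a b c d e f - casimir3 n a b c d e f, L, cybe n lim1 a b c d e f :: 'a:]"
    have "?P = 0"
    proof (rule poly_eq_0_of_powers[of _ "2 * n"])
      fix t :: 'a assume "t \<noteq> 0"
      then have "cybe n (tadd lim0 (tscale (t ^ (2 * n)) lim1)) a b c d e f = (casimir3 n a b c d e f :: 'a)"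
        using act_Phi[of t] by simp
      then show "poly ?P (t ^ (2 * n)) = 0" unfolding L by (simp add: algebra_simps power2_eq_square)
    qed (use i in simp)
    then show ?thesis by simp
  qed
  then show "cybe n (lim0 :: 'a tens2) = casimir3 n" "cybe n (lim1 :: 'a tens2) = (\<lambda>_ _ _ _ _ _. 0)"
    by (intro ext; simp)+
qed

text \<open>The zero tensor has carrier zero, whereas e_1n lies in the parabolic.\<close>

lemma lim1_nonzero: "(lim1 :: 'a::field_char_0 tens2) \<noteq> (\<lambda>_ _ _ _. 0)"
proof
  assume z: "(lim1 :: 'a tens2) = (\<lambda>_ _ _ _. 0)"
  have "(munit n 1 n :: 'a sqm) \<in> parabolic i n"
    unfolding parabolic_def sl_def mtrace_def using i msupp_munit[of n 1 n, where ?'a='a]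
    by (auto simp: munit_def intro!: sum.neutral simp del: msupp_munit)
  then have "(munit n 1 n :: 'a sqm) \<in> carrier n lim1" by (simp only: carrier_lim1)
  then have "munit n 1 n 1 n = (0::'a)" unfolding z carrier_def by (auto simp: fun_eq_iff)
  then show False using i by (simp add: munit_def)
qed

lemma limits_theorem:
  shows "\<exists>(r' :: 'a::field_char_0 tens2) b.
           r' \<in> MCYBE n \<and> b \<in> CYBE n
         \<and> (\<forall>t::'a. t \<noteq> 0 \<longrightarrow>
               act n (Phi i n t) (rCG i n) = tadd r' (tscale (t ^ (2 * n)) b))
         \<and> r' \<in> proj_closure n (component n (rCG i n))
         \<and> b \<in> proj_closure n (component n (rCG i n))
         \<and> boundary_solution n b
         \<and> carrier n b = parabolic i n"
proof -
  have n2: "2 \<le> n" and n0: "0 < 2 * n" using i by auto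
  have r': "(lim0 :: 'a tens2) \<in> MCYBE n"
    by (rule MCYBE_I[OF lim0_in_W n2, of 1]) (simp_all add: cybe_lims)
  have b: "(lim1 :: 'a tens2) \<in> CYBE n" by (simp add: CYBE_def cybe_lims lim1_in_W)
  \<comment> \<open>Zero solves the classical equation, so it cannot belong to
    \<open>MCYBE\<close>.\<close>
  have r'0: "(lim0 :: 'a tens2) \<noteq> (\<lambda>_ _ _ _. 0)"
  proof
    assume z: "(lim0 :: 'a tens2) = (\<lambda>_ _ _ _. 0)"
    then have "(\<lambda>_ _ _ _. 0 :: 'a) \<in> W n" using lim0_in_W[where ?'a='a] by simp
    then have "cybe n (lim0 :: 'a tens2) = (\<lambda>_ _ _ _ _ _. 0)"
      unfolding z by (intro ext) (simp add: cybe_expand)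
    then show False using r' by (simp add: MCYBE_def)
  qed
  \<comment> \<open>Replacing t by its inverse and rescaling by t^(2n) exchanges the roles of r' and
    b, so b is the limit at the other end of the same line.\<close>
  have rev: "tadd lim1 (tscale (t ^ (2 * n)) lim0) = tscale (t ^ (2 * n)) (act n (Phi i n (inverse t)) (rCG i n))"
    if t: "t \<noteq> 0" for t :: 'a
  proof -
    have "t ^ (2 * n) * inverse t ^ (2 * n) = 1" using t by (simp add: power_mult_distrib[symmetric])
    then have c: "t ^ (2 * n) * (inverse t ^ (2 * n) * x) = x" for x by (simp only: mult.assoc[symmetric] mult_1_left)
    have "act n (Phi i n (inverse t)) (rCG i n) = tadd lim0 (tscale (inverse t ^ (2 * n)) lim1)"
      using t by (intro act_Phi(1)) simp
    then show ?thesis by (simp only: tadd_def tscale_def distrib_left c add.commute)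
  qed
  have "(lim0 :: 'a tens2) \<in> proj_closure n (component n (rCG i n))"
  proof (rule proj_closure_line[OF lim0_in_W r'0 n0, of lim1])
    fix t :: 'a assume t: "t \<noteq> 0"
    have "tadd lim0 (tscale (t ^ (2 * n)) lim1) = tscale 1 (act n (Phi i n t) (rCG i n))"
      using act_Phi(1)[OF t] by (simp add: tscale_def)
    then show "tadd lim0 (tscale (t ^ (2 * n)) lim1) \<in> component n (rCG i n)"
      unfolding component_def using Phi_in_SL[OF t] by force
  qed
  moreover have "(lim1 :: 'a tens2) \<in> proj_closure n (component n (rCG i n))"
  proof (rule proj_closure_line[OF lim1_in_W lim1_nonzero n0, of lim0])
    fix t :: 'a assume t: "t \<noteq> 0"
    then have "Phi i n (inverse t) \<in> SL n" "t ^ (2 * n) \<noteq> 0" using Phi_in_SL[of "inverse t"] by simp_all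
    then show "tadd lim1 (tscale (t ^ (2 * n)) lim0) \<in> component n (rCG i n)"
      unfolding component_def rev[OF t] by blast
  qed
  moreover have "(lim1 :: 'a tens2) \<in> proj_closure n (MCYBE n)"
  proof (rule proj_closure_line[OF lim1_in_W lim1_nonzero n0, of lim0])
    fix t :: 'a assume t: "t \<noteq> 0"
    let ?r = "act n (Phi i n (inverse t)) (rCG i n)"
    have rW: "?r \<in> W n"
      using act_Phi(1)[of "inverse t"] t W_tadd_tscale[OF lim0_in_W lim1_in_W] by simp
    show "tadd lim1 (tscale (t ^ (2 * n)) lim0) \<in> MCYBE n"
      unfolding rev[OF t]
    proof (rule MCYBE_I[OF W_tscale[OF rW] n2])
      show "(t ^ (2 * n))\<^sup>2 \<noteq> 0" using t by simp
      fix a b c d e f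
      show "cybe n (tscale (t ^ (2 * n)) ?r) a b c d e f = (t ^ (2 * n))\<^sup>2 * casimir3 n a b c d e f"
        unfolding cybe_tscale[OF rW] using act_Phi(2)[of "inverse t"] t by simp
    qed
  qed
  ultimately show ?thesis
    using r' b act_Phi(1)[where ?'a='a] carrier_lim1[where ?'a='a]
    unfolding boundary_solution_def by blast
qed

end

theorem mainTheorem1:
  fixes i n :: nat
  assumes "0 < i" and "i < n"
    and "[int n = 1] (mod int i) \<or> [int n = -1] (mod int i)"
  shows "\<exists>(r' :: 'a::field_char_0 tens2) b.
           r' \<in> MCYBE n \<and> b \<in> CYBE n
         \<and> (\<forall>t::'a. t \<noteq> 0 \<longrightarrow>
               act n (Phi i n t) (rCG i n) = tadd r' (tscale (t ^ (2 * n)) b))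
         \<and> r' \<in> proj_closure n (component n (rCG i n))
         \<and> b \<in> proj_closure n (component n (rCG i n))
         \<and> boundary_solution n b
         \<and> carrier n b = parabolic i n"
proof (cases "n mod i = 1")
  case True
  have "n = (n div i) * i + 1" using div_mult_mod_eq[of n i] True by simp
  then interpret cg_shape True i n "n div i"
    using assms True by unfold_locales auto
  show ?thesis by (rule limits_theorem)
next
  case False
  \<comment> \<open>The value i = 1 falls into this branch, since n mod 1 = 0; the divisibility is
    then trivial.\<close>
  have "i dvd n + 1"
  proof (cases "i = 1")
    case i1: False
    have "\<not> [int n = 1] (mod int i)"
    proof
      assume "[int n = 1] (mod int i)"
      then have "[n = 1] (mod i)" using cong_int_iff[of n 1 i] by simp
      then show False using False i1 assms(1) by (simp add: cong_def)
    qed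
    then have "[int n = - 1] (mod int i)" using assms(3) by blast
    then have "int i dvd int n - (- 1)" by (simp add: cong_iff_dvd_diff)
    then have "int i dvd int (n + 1)" by simp
    then show ?thesis by (simp only: of_nat_dvd_iff)
  qed simp
  then have "n + 1 = ((n + 1) div i) * i" by simp
  then interpret cg_shape False i n "(n + 1) div i"
    using assms False by unfold_locales auto
  show ?thesis by (rule limits_theorem)
qed

end
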